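(* Let $A$ be a unital and commutative (associative) complex Banach algebra with unit $\mathbf{1}_A$, and let $N$ be a semisimple unital complex Jordan--Banach algebra. Suppose that $\mathfrak{A}\subseteq A^{-1}$ and $\mathfrak{N}\subseteq N^{-1}$ are clopen quadratic subsets (clopen relative to $A^{-1}$ and $N^{-1}$, respectively) which are closed for powers and inverses. Let $\Delta:\mathfrak{A}\to\mathfrak{N}$ be a surjective isometry (for the distances given by the norms). Then $A$ is semisimple and $N$ is associative, and the mapping $\Delta(\mathbf{1}_A)^{-1}\Delta$ (that is, $a\mapsto\Delta(\mathbf{1}_A)^{-1}\circ\Delta(a)$) admits an extension to an isometric real-linear algebra isomorphism from $A$ onto $N$. In particular, $A^{-1}$ and $N^{-1}$ are isometrically isomorphic as metric groups.
   Context: A complex Jordan algebra is a complex vector space $M$ with a commutative bilinear product $\circ$ satisfying $(a\circ b)\circ a^2=a\circ(b\circ a^2)$. A Jordan--Banach algebra is a Jordan algebra with a complete norm satisfying $\|a\circ b\|\le\|a\|\,\|b\|$; if it is unital one also requires $\|\mathbf{1}\|=1$ (likewise for unital Banach algebras). Every Banach algebra is a Jordan--Banach algebra with $a\circ b=\frac12(ab+ba)$. Write $U_a(x)=2(a\circ x)\circ a-a^2\circ x$. An element $a$ of a unital Jordan--Banach algebra $M$ is invertible if there is a (necessarily unique) $b=a^{-1}\in M$ with $a\circ b=\mathbf{1}$ and $a^2\circ b=a$; for Banach algebras this agrees with the usual notion. $M^{-1}$ denotes the set of invertible elements. A subset $\mathfrak{M}\subseteq M^{-1}$ is a quadratic subset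 if it is non-empty and $U_a(b)\in\mathfrak{M}$ for all $a,b\in\mathfrak{M}$. It is closed for powers and inverses if $a^n\in\mathfrak{M}$ (for $n\in\mathbb{N}$) and $a^{-1}\in\mathfrak{M}$ whenever $a\in\mathfrak{M}$. An element $a$ of a unital Jordan--Banach algebra is quasi-invertible if $\mathbf{1}-a$ is invertible. An ideal is a subspace $J$ with $U_M(J)\subseteq J$, $U_J(M)\subseteq J$ and $J^2\subseteq J$. The McCrimmon radical of a Jordan--Banach algebra is its largest ideal consisting of quasi-invertible elements (it exists); the algebra is semisimple if this radical is $\{0\}$. For Banach algebras it coincides with the Jacobson radical. *)

theory Defs
  imports "HOL-Analysis.Analysis" "HOL-Algebra.Group"
begin

text \<open>
  The completeness and the real structure of a complex Banach space come from the class
  \<^class>\<open>banach\<close>; the complex scalar multiplication is a locale parameter extending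
  the real one.
\<close>

locale complex_banach_space = vector_space smul
  for smul :: "complex \<Rightarrow> 'a::banach \<Rightarrow> 'a" +
  assumes scale_of_real: "smul (complex_of_real r) x = r *\<^sub>R x"
    and norm_scale: "norm (smul c x) = cmod c * norm x"

locale unital_jordan_banach_algebra = complex_banach_space smul
  for smul :: "complex \<Rightarrow> 'a::banach \<Rightarrow> 'a" +
  fixes jp :: "'a \<Rightarrow> 'a \<Rightarrow> 'a"
    and e :: 'a
  assumes jp_commute: "jp a b = jp b a"
    and jp_add_left: "jp (a + b) c = jp a c + jp b c"
    and jp_scale_left: "jp (smul z a) b = smul z (jp a b)"
    and jordan_identity: "jp (jp a b) (jp a a) = jp a (jp b (jp a a))"
    and norm_jp_le: "norm (jp a b) \<le> norm a * norm b"
    and jp_unit: "jp e a = a"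
    and norm_unit: "norm e = 1"

text \<open>
  The class \<^class>\<open>real_normed_algebra_1\<close> contains the submultiplicativity of the norm
  and the normalisation \<open>norm 1 = 1\<close>.
\<close>

locale unital_commutative_banach_algebra = complex_banach_space smul
  for smul :: "complex \<Rightarrow> 'a::{real_normed_algebra_1,comm_ring_1,banach} \<Rightarrow> 'a" +
  assumes scale_mult_left: "smul c x * y = smul c (x * y)"


definition jordan_U :: "('a::real_vector \<Rightarrow> 'a \<Rightarrow> 'a) \<Rightarrow> 'a \<Rightarrow> 'a \<Rightarrow> 'a" where
  "jordan_U jp a x = 2 *\<^sub>R jp (jp a x) a - jp (jp a a) x"

definition is_jordan_inverse :: "('a \<Rightarrow> 'a \<Rightarrow> 'a) \<Rightarrow> 'a \<Rightarrow> 'a \<Rightarrow> 'a \<Rightarrow> bool" where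
  "is_jordan_inverse jp e a b \<longleftrightarrow> jp a b = e \<and> jp (jp a a) b = a"

definition jordan_invertibles :: "('a \<Rightarrow> 'a \<Rightarrow> 'a) \<Rightarrow> 'a \<Rightarrow> 'a set" where
  "jordan_invertibles jp e = {a. \<exists>b. is_jordan_inverse jp e a b}"

text \<open>
  In a unital Jordan--Banach algebra an inverse is unique if it exists, so the definite
  description below denotes it for every invertible \<open>a\<close>.
\<close>

definition jordan_inverse :: "('a \<Rightarrow> 'a \<Rightarrow> 'a) \<Rightarrow> 'a \<Rightarrow> 'a \<Rightarrow> 'a" where
  "jordan_inverse jp e a = (THE b. is_jordan_inverse jp e a b)"

primrec jordan_power :: "('a \<Rightarrow> 'a \<Rightarrow> 'a) \<Rightarrow> 'a \<Rightarrow> 'a \<Rightarrow> nat \<Rightarrow> 'a" where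
  "jordan_power jp e a 0 = e"
| "jordan_power jp e a (Suc n) = jp a (jordan_power jp e a n)"

definition quadratic_subset :: "('a::real_vector \<Rightarrow> 'a \<Rightarrow> 'a) \<Rightarrow> 'a \<Rightarrow> 'a set \<Rightarrow> bool" where
  "quadratic_subset jp e S \<longleftrightarrow>
     S \<subseteq> jordan_invertibles jp e \<and> S \<noteq> {} \<and> (\<forall>a\<in>S. \<forall>b\<in>S. jordan_U jp a b \<in> S)"

text \<open>
  Only exponents at least 1 are required. For a quadratic subset closed under these powers and
  under inverses the exponent 0 comes for free, as the unit is \<open>U\<^sub>a ((a\<^sup>-\<^sup>1)\<^sup>2)\<close>.
\<close>

definition closed_powers_inverses :: "('a \<Rightarrow> 'a \<Rightarrow> 'a) \<Rightarrow> 'a \<Rightarrow> 'a set \<Rightarrow> bool" where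
  "closed_powers_inverses jp e S \<longleftrightarrow>
     (\<forall>a\<in>S. (\<forall>n\<ge>1. jordan_power jp e a n \<in> S) \<and> jordan_inverse jp e a \<in> S)"

definition clopen_in :: "'a::topological_space set \<Rightarrow> 'a set \<Rightarrow> bool" where
  "clopen_in X S \<longleftrightarrow> openin (top_of_set X) S \<and> closedin (top_of_set X) S"

definition jordan_ideal ::
    "(complex \<Rightarrow> 'a::real_vector \<Rightarrow> 'a) \<Rightarrow> ('a \<Rightarrow> 'a \<Rightarrow> 'a) \<Rightarrow> 'a set \<Rightarrow> bool" where
  "jordan_ideal smul jp J \<longleftrightarrow>
     module.subspace smul J \<and>
     (\<forall>m. \<forall>x\<in>J. jordan_U jp m x \<in> J) \<and>
     (\<forall>x\<in>J. \<forall>m. jordan_U jp x m \<in> J) \<and>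
     (\<forall>x\<in>J. \<forall>y\<in>J. jp x y \<in> J)"

definition quasi_invertible :: "('a::ab_group_add \<Rightarrow> 'a \<Rightarrow> 'a) \<Rightarrow> 'a \<Rightarrow> 'a \<Rightarrow> bool" where
  "quasi_invertible jp e a \<longleftrightarrow> e - a \<in> jordan_invertibles jp e"

definition quasi_invertible_ideal ::
    "(complex \<Rightarrow> 'a::real_vector \<Rightarrow> 'a) \<Rightarrow> ('a \<Rightarrow> 'a \<Rightarrow> 'a) \<Rightarrow> 'a \<Rightarrow> 'a set \<Rightarrow> bool" where
  "quasi_invertible_ideal smul jp e J \<longleftrightarrow>
     jordan_ideal smul jp J \<and> (\<forall>a\<in>J. quasi_invertible jp e a)"

text \<open>
  ``The largest quasi-invertible ideal'' is rendered as a predicate on sets; semisimplicity says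
  that \<open>{0}\<close> satisfies it.
\<close>

definition is_mccrimmon_radical ::
    "(complex \<Rightarrow> 'a::real_vector \<Rightarrow> 'a) \<Rightarrow> ('a \<Rightarrow> 'a \<Rightarrow> 'a) \<Rightarrow> 'a \<Rightarrow> 'a set \<Rightarrow> bool" where
  "is_mccrimmon_radical smul jp e R \<longleftrightarrow>
     quasi_invertible_ideal smul jp e R \<and>
     (\<forall>J. quasi_invertible_ideal smul jp e J \<longrightarrow> J \<subseteq> R)"

definition jordan_semisimple ::
    "(complex \<Rightarrow> 'a::real_vector \<Rightarrow> 'a) \<Rightarrow> ('a \<Rightarrow> 'a \<Rightarrow> 'a) \<Rightarrow> 'a \<Rightarrow> bool" where
  "jordan_semisimple smul jp e \<longleftrightarrow> is_mccrimmon_radical smul jp e {0}"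

definition invertible_group :: "('a \<Rightarrow> 'a \<Rightarrow> 'a) \<Rightarrow> 'a \<Rightarrow> 'a monoid" where
  "invertible_group jp e = \<lparr>carrier = jordan_invertibles jp e, mult = jp, one = e\<rparr>"

definition isometric_on :: "'a::metric_space set \<Rightarrow> ('a \<Rightarrow> 'b::metric_space) \<Rightarrow> bool" where
  "isometric_on S f \<longleftrightarrow> (\<forall>x\<in>S. \<forall>y\<in>S. dist (f x) (f y) = dist x y)"

definition isometric_real_algebra_iso ::
    "('a::real_normed_vector \<Rightarrow> 'a \<Rightarrow> 'a) \<Rightarrow> ('b::real_normed_vector \<Rightarrow> 'b \<Rightarrow> 'b) \<Rightarrow>
      ('a \<Rightarrow> 'b) \<Rightarrow> bool" where
  "isometric_real_algebra_iso p q \<Phi> \<longleftrightarrow>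
     linear \<Phi> \<and> bij \<Phi> \<and> (\<forall>a b. \<Phi> (p a b) = q (\<Phi> a) (\<Phi> b)) \<and> isometric_on UNIV \<Phi>"

definition isometrically_isomorphic_groups ::
    "('a::metric_space) monoid \<Rightarrow> ('b::metric_space) monoid \<Rightarrow> bool" where
  "isometrically_isomorphic_groups G H \<longleftrightarrow>
     group G \<and> group H \<and> (\<exists>\<psi>\<in>iso G H. isometric_on (carrier G) \<psi>)"


text \<open>
  In a commutative algebra \<open>(a b + b a) / 2\<close> is \<open>a b\<close>, so such an algebra is regarded as a
  Jordan algebra by using its own product as the Jordan product.
\<close>

lemma special_jordan_product_commutative:
  fixes a b :: "'a::{real_normed_algebra_1,comm_ring_1}"
  shows "(1/2) *\<^sub>R (a * b + b * a) = a * b"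
  by (simp add: mult.commute[of b a] flip: scaleR_2)

sublocale unital_commutative_banach_algebra \<subseteq> unital_jordan_banach_algebra smul "(*)" 1
proof unfold_locales
  show "smul z a * b = smul z (a * b)" for z a b
    by (rule scale_mult_left)
  show "(a + b) * c = a * c + b * c" for a b c :: 'a
    by (rule distrib_right)
qed (auto simp: norm_mult_ineq ac_simps)

lemma jordan_invertible_commutative_iff:
  fixes a :: "'a::comm_ring_1"
  shows "a \<in> jordan_invertibles (*) 1 \<longleftrightarrow> a dvd 1"
  by (auto simp: jordan_invertibles_def is_jordan_inverse_def dvd_def mult.assoc)

end

theory Submission
  imports Defs "HOL-Computational_Algebra.Fundamental_Theorem_Algebra"
begin

text \<open>
  By a local Mazur--Ulam argument \<open>\<Delta>\<close> is affine near every point, hence \<open>\<Delta> = T + u\<close> on the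
  open connected cone \<open>{l (1 + y) | l \<noteq> 0, \<parallel>y\<parallel> < d}\<close>, where \<open>T\<close> is a real-linear isometry of \<open>A\<close>
  onto \<open>N\<close>. For \<open>a \<in> \<AA>\<close> the points \<open>a + l\<close> with \<open>|l|\<close> large lie in the cone, so
  \<open>d = T\<^sup>-\<^sup>1 (\<Delta> a - u) - a\<close> satisfies \<open>\<parallel>d - l\<parallel> = |l|\<close>, and Cauchy's estimate for \<open>(l + d)\<^sup>n\<close> gives
  \<open>\<parallel>d\<parallel> \<le> |l| / n\<close>, i.e. \<open>d = 0\<close>. Both \<open>u\<close> and the image under \<open>T\<close> of the radical of \<open>A\<close> lie in
  \<open>{u. \<NN> + \<complex> u \<subseteq> \<NN>}\<close>, which is a quasi-invertible ideal and therefore zero.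

  For a character \<open>\<phi>\<close> of \<open>A\<close> the functional \<open>\<phi> \<circ> T\<^sup>-\<^sup>1\<close> has no zero on \<open>\<NN>\<close>. A
  Gleason--Kahane--Zelazko argument for its complex-linear and antilinear parts, applied to the
  powers \<open>(1 + t x)\<^sup>n\<close>, shows that both are multiples of one character \<open>\<psi>\<close> of \<open>N\<close> and its
  conjugate, and the isometry leaves only one of the two. Since the characters of \<open>A\<close> separate its
  points, so do the \<open>\<psi>\<close> on \<open>N\<close>; hence \<open>N\<close> is associative and \<open>T(1)\<^sup>-\<^sup>1 T\<close> is multiplicative.
\<close>

section \<open>A local Mazur--Ulam theorem\<close>

text \<open>The obstacle is that \<open>SA\<close> may be disconnected: a local argument leaves room
  for a different affine map on each component. The complex scalars repair this, because the
  punctured plane is connected and translation by large scalars brings every point of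
  \<open>SA\<close> into the cone, where the map is already known. In \<open>N\<close> the product
  of two different elements of \<open>SN\<close> need not lie in \<open>SN\<close>; hence the
  arguments on \<open>SN\<close> move only by scalars, by powers of one element and by the operators
  \<open>U\<close>. Characters of \<open>A\<close> that do not vanish at a prescribed
  \<open>u\<close> are found through their moduli: among the submultiplicative seminorms for which
  multiplication by \<open>u\<close> is a dilation, a minimal one is multiplicative, and a
  Gelfand--Mazur argument turns it into the modulus of a character. Finally \<open>T\<close> is only
  real-linear, so a character may reach \<open>N\<close> as a complex-linear or as an antilinear
  functional, and a priori as a mixture of both.\<close>

lemma isometric_on_compose:
  assumes "isometric_on S f" and "f ` S \<subseteq> S'" and "isometric_on S' g"
  shows "isometric_on S (g \<circ> f)"
  using assms unfolding isometric_on_def by (auto simp: image_subset_iff)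

lemma isometric_on_imp_inj_on: "isometric_on S f \<Longrightarrow> inj_on f S"
  unfolding isometric_on_def inj_on_def by (metis dist_eq_0_iff)

lemma isometric_on_inv_into:
  assumes "isometric_on S f"
  shows "isometric_on (f ` S) (inv_into S f)"
  using assms isometric_on_imp_inj_on[OF assms] unfolding isometric_on_def by auto

lemma isometric_on_subset: "isometric_on S f \<Longrightarrow> S' \<subseteq> S \<Longrightarrow> isometric_on S' f"
  unfolding isometric_on_def by blast

text \<open>Self-isometries of the bounded set \<open>S\<close> displace \<open>h\<close> by a
  bounded amount, whereas a non-zero displacement could be doubled for ever with the help of the
  reflection in \<open>h\<close>.\<close>

lemma isometry_fixes_centre:
  fixes S :: "'a::real_normed_vector set"
  assumes bdd: "bounded S" and hS: "h \<in> S"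
    and sym: "\<And>u. u \<in> S \<Longrightarrow> 2 *\<^sub>R h - u \<in> S"
    and p: "bij_betw p S S" "isometric_on S p"
  shows "p h = h"
proof (rule ccontr)
  assume ne: "p h \<noteq> h"
  define refl where "refl u = 2 *\<^sub>R h - u" for u
  have refl: "bij_betw refl S S" "isometric_on S refl"
    by (rule bij_betwI[where g = refl]) (auto simp: refl_def sym isometric_on_def dist_norm norm_minus_commute)
  \<comment> \<open>The isometry \<open>refl q\<^sup>-\<^sup>1 refl q\<close> moves the centre twice as far as \<open>q\<close> does.\<close>
  have double: "\<exists>q. bij_betw q S S \<and> isometric_on S q \<and> norm (q h - h) = 2 ^ n * norm (p h - h)" for n
  proof (induction n)
    case 0
    then show ?case using p by auto
  next
    case (Suc n)
    then obtain q where q: "bij_betw q S S" "isometric_on S q" "norm (q h - h) = 2 ^ n * norm (p h - h)"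
      by blast
    define q' where "q' = inv_into S q"
    have q': "bij_betw q' S S" "isometric_on S q'"
      unfolding q'_def using q(1) isometric_on_inv_into[OF q(2)]
      by (auto simp: bij_betw_inv_into bij_betw_imp_surj_on)
    let ?k = "refl \<circ> (q' \<circ> (refl \<circ> q))"
    have "bij_betw ?k S S"
      using q(1) q'(1) refl(1) by (intro bij_betw_trans)
    moreover have "isometric_on S ?k"
      using q(2) q'(2) refl(2) bij_betwE[OF q(1)] bij_betwE[OF q'(1)] bij_betwE[OF refl(1)]
      by (intro isometric_on_compose[where S' = S]) auto
    moreover have "norm (?k h - h) = 2 ^ Suc n * norm (p h - h)"
    proof -
      have qh: "q h \<in> S" using q(1) hS bij_betwE by blast
      have r: "refl (q h) \<in> S" using qh by (simp add: refl_def sym)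
      have h: "h = q' (q h)" using q(1) hS by (simp add: q'_def bij_betw_def)
      have "norm (?k h - h) = dist (q' (refl (q h))) h"
        by (simp add: refl_def dist_norm norm_minus_commute scaleR_2 algebra_simps)
      also have "\<dots> = dist (q' (refl (q h))) (q' (q h))" using h by simp
      also have "\<dots> = dist (refl (q h)) (q h)"
        using q'(2) qh r by (simp add: isometric_on_def)
      also have "\<dots> = norm (2 *\<^sub>R (h - q h))" by (simp add: refl_def dist_norm scaleR_2 algebra_simps)
      also have "\<dots> = 2 * norm (q h - h)" by (simp add: norm_minus_commute)
      finally show ?thesis using q(3) by simp
    qed
    ultimately show ?case by blast
  qed
  obtain B where B: "\<And>u. u \<in> S \<Longrightarrow> norm u \<le> B" using bdd by (auto simp: bounded_iff)
  have le: "2 ^ n * norm (p h - h) \<le> 2 * B" for n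
  proof -
    obtain q where q: "bij_betw q S S" "norm (q h - h) = 2 ^ n * norm (p h - h)"
      using double[of n] by blast
    have "q h \<in> S" using q(1) hS bij_betwE by blast
    then have "norm (q h - h) \<le> B + B" using B[of "q h"] B[OF hS] norm_triangle_ineq4[of "q h" h] by linarith
    then show ?thesis using q(2) by simp
  qed
  obtain n where "2 * B / norm (p h - h) < 2 ^ n"
    using real_arch_pow[of 2 "2 * B / norm (p h - h)"] by auto
  then show False using le[of n] ne by (simp add: divide_less_eq)
qed

text \<open>Pulling the reflection in \<open>h'\<close> back along \<open>f\<close> gives a
  self-isometry of \<open>S\<close>. It fixes \<open>h\<close>, so \<open>f h\<close> is a fixed
  point of the reflection, and \<open>h'\<close> is the only one.\<close>

lemma isometry_maps_centre:
  fixes S :: "'a::real_normed_vector set" and S' :: "'b::real_normed_vector set"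
  assumes "bounded S" "h \<in> S" and sym: "\<And>u. u \<in> S \<Longrightarrow> 2 *\<^sub>R h - u \<in> S"
    and "h' \<in> S'" and sym': "\<And>u. u \<in> S' \<Longrightarrow> 2 *\<^sub>R h' - u \<in> S'"
    and f: "f ` S = S'" "isometric_on S f"
  shows "f h = h'"
proof -
  define refl where "refl u = 2 *\<^sub>R h' - u" for u
  have refl: "bij_betw refl S' S'" "isometric_on S' refl"
    by (rule bij_betwI[where g = refl]) (auto simp: refl_def sym' isometric_on_def dist_norm norm_minus_commute)
  have bij: "bij_betw f S S'" using f isometric_on_imp_inj_on by (auto simp: bij_betw_def)
  let ?p = "inv_into S f \<circ> (refl \<circ> f)"
  have "bij_betw ?p S S"
    using bij refl(1) by (intro bij_betw_trans bij_betw_inv_into)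
  moreover have "isometric_on S ?p"
    using f refl isometric_on_inv_into[OF f(2)]
    by (intro isometric_on_compose[where S' = S']) (auto simp: bij_betw_def)
  ultimately have "?p h = h"
    using isometry_fixes_centre[OF assms(1,2), of ?p] sym by blast
  moreover have "f (?p h) = refl (f h)"
    using bij refl(1) assms(2) by (simp add: bij_betw_def f_inv_into_f image_iff) (metis f_inv_into_f imageI)
  ultimately have "refl (f h) = f h" by simp
  then have "2 *\<^sub>R h' = 2 *\<^sub>R f h" by (simp add: refl_def scaleR_2 algebra_simps)
  then show ?thesis by simp
qed

text \<open>The points at distance \<open>dist y z / 2\<close> from both \<open>y\<close> and
  \<open>z\<close> form a set that is symmetric about the midpoint and described by distances alone,
  so \<open>f\<close> carries it onto its counterpart. It lies within \<open>2 * r\<close> of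
  \<open>x\<close>, whence the doubled radii.\<close>

lemma isometry_preserves_midpoint:
  fixes f :: "'a::real_normed_vector \<Rightarrow> 'b::real_normed_vector"
  assumes iso: "isometric_on U f" and U: "ball x (2 * r) \<subseteq> U" "ball (f x) (2 * r) \<subseteq> f ` U"
    and y: "y \<in> ball x r" and z: "z \<in> ball x r"
  shows "f (midpoint y z) = midpoint (f y) (f z)"
proof -
  define S where "S = {u. dist u y = dist y z / 2 \<and> dist u z = dist y z / 2}"
  define S' where "S' = {u. dist u (f y) = dist y z / 2 \<and> dist u (f z) = dist y z / 2}"
  have refl: "dist (2 *\<^sub>R midpoint v w - u) v = dist u w" "dist (2 *\<^sub>R midpoint v w - u) w = dist u v"
    for u v w :: "'c::real_normed_vector"
    by (simp_all add: midpoint_def dist_norm norm_minus_commute)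
  have r: "0 < r" using y by (metis dist_not_less_zero dist_commute mem_ball not_less_iff_gr_or_eq order_less_trans)
  have yU: "y \<in> U" and zU: "z \<in> U" and xU: "x \<in> U" using U(1) y z r by (auto simp: subset_iff)
  have yz: "dist y z < 2 * r"
    using y z dist_triangle[of y z x] by (simp add: dist_commute)
  have fyz: "dist (f y) (f z) = dist y z" "dist (f x) (f y) = dist x y"
    using iso yU zU xU by (auto simp: isometric_on_def)
  have SU: "S \<subseteq> U"
  proof
    fix u assume "u \<in> S"
    then have "dist x u < 2 * r"
      using y yz dist_triangle[of x u y] by (simp add: S_def dist_commute)
    then show "u \<in> U" using U(1) by auto
  qed
  have "f ` S = S'"
  proof
    show "f ` S \<subseteq> S'"
      using iso SU yU zU by (auto simp: S_def S'_def isometric_on_def subset_iff)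
    show "S' \<subseteq> f ` S"
    proof
      fix u' assume u': "u' \<in> S'"
      then have "dist (f x) u' < 2 * r"
        using y yz fyz dist_triangle[of "f x" u' "f y"] by (simp add: S'_def dist_commute)
      then obtain u where u: "u \<in> U" "u' = f u" using U(2) by auto
      then have "u \<in> S" using u' iso yU zU by (auto simp: S_def S'_def isometric_on_def)
      then show "u' \<in> f ` S" using u by blast
    qed
  qed
  moreover have "isometric_on S f" using iso SU isometric_on_subset by blast
  moreover have "S \<subseteq> cball y (dist y z / 2)" by (auto simp: S_def dist_commute)
  then have "bounded S" using bounded_subset bounded_cball by blast
  ultimately show ?thesis
    by (intro isometry_maps_centre[where S = S and S' = S'])
      (auto simp: S_def S'_def refl fyz dist_midpoint)
qed

text \<open>Replacing \<open>n c\<close> by its integer part costs a bounded error, while the defect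
  of homogeneity at \<open>c\<close> is multiplied by \<open>n\<close>; letting \<open>n\<close>
  grow removes the defect.\<close>

lemma additive_bounded_imp_linear:
  fixes f :: "'a::real_normed_vector \<Rightarrow> 'b::real_normed_vector"
  assumes add: "\<And>x y. f (x + y) = f x + f y" and bd: "\<And>x. norm (f x) \<le> norm x"
  shows "linear f"
proof (rule linearI)
  fix c :: real and x
  have f0: "f 0 = 0" using bd[of 0] by simp
  have fm: "f (- x) = - f x" for x using add[of x "- x"] f0 by (simp add: add_eq_0_iff)
  have fn: "f (of_nat n *\<^sub>R x) = of_nat n *\<^sub>R f x" for n x
    by (induction n) (simp_all add: f0 add scaleR_add_left)
  have fi: "f (of_int m *\<^sub>R x) = of_int m *\<^sub>R f x" for m x
    by (cases m rule: int_cases2) (simp_all add: fn fm)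
  define e where "e = norm (f (c *\<^sub>R x) - c *\<^sub>R f x)"
  have "of_nat n * e \<le> 2 * norm x" for n
  proof -
    define m where "m = \<lfloor>of_nat n * c\<rfloor>"
    define d where "d = of_nat n * c - of_int m"
    have d: "\<bar>d\<bar> \<le> 1" unfolding d_def m_def by linarith
    have "of_nat n *\<^sub>R (c *\<^sub>R x) = of_int m *\<^sub>R x + d *\<^sub>R x"
      by (simp add: d_def algebra_simps)
    then have "of_nat n *\<^sub>R f (c *\<^sub>R x) = of_int m *\<^sub>R f x + f (d *\<^sub>R x)"
      by (metis add fi fn)
    then have "of_nat n *\<^sub>R (f (c *\<^sub>R x) - c *\<^sub>R f x) = f (d *\<^sub>R x) - d *\<^sub>R f x"
      by (simp add: d_def algebra_simps)
    then have "of_nat n * e = norm (f (d *\<^sub>R x) - d *\<^sub>R f x)"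
      unfolding e_def by (metis norm_scaleR abs_of_nat)
    also have "\<dots> \<le> norm (d *\<^sub>R x) + norm (d *\<^sub>R f x)"
      using norm_triangle_ineq4 bd add_right_mono order_trans by blast
    also have "\<dots> \<le> norm x + norm x"
      using d bd[of x] mult_mono[of "\<bar>d\<bar>" 1 "norm x" "norm x"] mult_mono[of "\<bar>d\<bar>" 1 "norm (f x)" "norm x"] by simp
    finally show ?thesis by simp
  qed
  moreover have "e \<ge> 0" by (simp add: e_def)
  ultimately have "e = 0"
    by (metis mult.commute reals_Archimedean3 less_eq_real_def not_less)
  then show "f (c *\<^sub>R x) = c *\<^sub>R f x" by (simp add: e_def)
qed (rule add)

text \<open>Since \<open>g 0 = 0\<close>, preserving midpoints makes \<open>g\<close> commute with
  halving. So \<open>2 ^ n g (y / 2 ^ n)\<close> is the same for all \<open>n\<close> that bring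
  \<open>y / 2 ^ n\<close> into the ball, and this common value is the extension.\<close>

lemma midpoint_map_extends_linear:
  fixes g :: "'a::real_normed_vector \<Rightarrow> 'b::real_normed_vector"
  assumes r: "r > 0" and g0: "g 0 = 0"
    and mid: "\<And>y z. y \<in> ball 0 r \<Longrightarrow> z \<in> ball 0 r \<Longrightarrow> g (midpoint y z) = midpoint (g y) (g z)"
    and nrm: "\<And>y. y \<in> ball 0 r \<Longrightarrow> norm (g y) = norm y"
  shows "\<exists>T. linear T \<and> (\<forall>y\<in>ball 0 r. g y = T y) \<and> (\<forall>y. norm (T y) = norm y)"
proof -
  have half: "g ((1/2) *\<^sub>R y) = (1/2) *\<^sub>R g y" if "norm y < r" for y
    using mid[of y 0] that r by (simp add: midpoint_def g0)
  define S where "S n y = (2::real) ^ n *\<^sub>R g ((1 / 2 ^ n) *\<^sub>R y)" for n :: nat and y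
  have small: "norm ((1 / 2 ^ n) *\<^sub>R y) < r" if "norm y < 2 ^ n * r" for n y
    using that by (simp add: divide_less_eq mult.commute)
  have stepS: "S (n + k) y = S n y" if "norm y < 2 ^ n * r" for n k y
  proof (induction k)
    case (Suc k)
    have "norm y < 2 ^ (n + k) * r"
    proof -
      have "2 ^ n * r \<le> 2 ^ (n + k) * r" using r by (simp add: power_add)
      then show ?thesis using that by linarith
    qed
    then have "g ((1/2) *\<^sub>R ((1 / 2 ^ (n + k)) *\<^sub>R y)) = (1/2) *\<^sub>R g ((1 / 2 ^ (n + k)) *\<^sub>R y)"
      using half small by blast
    then have "S (n + Suc k) y = S (n + k) y" by (simp add: S_def)
    then show ?case using Suc by simp
  qed simp
  have ex: "\<exists>n. norm y < 2 ^ n * r" for y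
    using real_arch_pow[of 2 "norm y / r"] r by (auto simp: divide_less_eq)
  define T where "T y = S (SOME n. norm y < 2 ^ n * r) y" for y
  have T: "T y = S n y" if n: "norm y < 2 ^ n * r" for n y
  proof -
    define m where "m = (SOME n. norm y < 2 ^ n * r)"
    have m: "norm y < 2 ^ m * r" unfolding m_def using ex by (rule someI_ex)
    have "S m y = S (m + n) y" "S n y = S (n + m) y" using stepS m n by simp_all
    then show ?thesis by (simp add: T_def m_def add.commute)
  qed
  have Tn: "norm (T y) = norm y" for y
  proof -
    obtain n where n: "norm y < 2 ^ n * r" using ex by blast
    then show ?thesis using nrm[of "(1 / 2 ^ n) *\<^sub>R y"] small[OF n] by (simp add: T[OF n] S_def)
  qed
  have Tadd: "T (y + z) = T y + T z" for y z
  proof -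
    obtain n where n: "norm y + norm z < 2 ^ n * r" using ex[of "norm y + norm z"] by auto
    then have y: "norm y < 2 ^ n * r" and z: "norm z < 2 ^ n * r"
      using norm_ge_zero[of y] norm_ge_zero[of z] by linarith+
    have "norm (y + z) < 2 ^ n * r" using n norm_triangle_ineq[of y z] by linarith
    moreover have "2 ^ n * r \<le> 2 ^ Suc n * r" using r by simp
    ultimately have yz: "norm (y + z) < 2 ^ Suc n * r" by linarith
    have "midpoint ((1 / 2 ^ n) *\<^sub>R y) ((1 / 2 ^ n) *\<^sub>R z) = (1 / 2 ^ Suc n) *\<^sub>R (y + z)"
      by (simp add: midpoint_def scaleR_add_right)
    then have "T (y + z) = 2 ^ Suc n *\<^sub>R midpoint (g ((1 / 2 ^ n) *\<^sub>R y)) (g ((1 / 2 ^ n) *\<^sub>R z))"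
      using mid[of "(1 / 2 ^ n) *\<^sub>R y" "(1 / 2 ^ n) *\<^sub>R z"] small[OF y] small[OF z]
      by (simp add: T[OF yz] S_def)
    also have "\<dots> = T y + T z" by (simp add: T[OF y] T[OF z] S_def midpoint_def scaleR_add_right)
    finally show ?thesis .
  qed
  have "linear T" using Tadd Tn by (intro additive_bounded_imp_linear) simp_all
  moreover have "g y = T y" if "y \<in> ball 0 r" for y using T[of y 0] that by (simp add: S_def)
  ultimately show ?thesis using Tn by blast
qed

lemma isometry_locally_affine:
  fixes f :: "'a::real_normed_vector \<Rightarrow> 'b::real_normed_vector"
  assumes iso: "isometric_on U f" and op: "open U" "open (f ` U)" and x: "x \<in> U"
  shows "\<exists>r>0. \<exists>T. linear T \<and> (\<forall>v. norm (T v) = norm v) \<and> ball x r \<subseteq> U \<and>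
    (\<forall>y\<in>ball x r. f y = f x + T (y - x))"
proof -
  obtain r1 where r1: "r1 > 0" "ball x r1 \<subseteq> U" using op x by (meson open_contains_ball)
  obtain r2 where r2: "r2 > 0" "ball (f x) r2 \<subseteq> f ` U" using op x by (meson open_contains_ball imageI)
  define r where "r = min r1 r2 / 2"
  have r: "r > 0" "ball x (2 * r) \<subseteq> U" "ball (f x) (2 * r) \<subseteq> f ` U"
    using r1 r2 by (auto simp: r_def)
  define g where "g v = f (x + v) - f x" for v
  have "\<exists>T. linear T \<and> (\<forall>y\<in>ball 0 r. g y = T y) \<and> (\<forall>y. norm (T y) = norm y)"
  proof (rule midpoint_map_extends_linear[OF r(1)])
    show "g 0 = 0" by (simp add: g_def)
  next
    fix y z :: 'a assume "y \<in> ball 0 r" "z \<in> ball 0 r"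
    then have "x + y \<in> ball x r" "x + z \<in> ball x r" by (simp_all add: dist_norm)
    then have "f (midpoint (x + y) (x + z)) = midpoint (f (x + y)) (f (x + z))"
      using isometry_preserves_midpoint[OF iso r(2,3)] by blast
    moreover have "midpoint (x + y) (x + z) = x + midpoint y z"
    proof -
      have "inverse 2 *\<^sub>R ((x + y) + (x + z)) = inverse 2 *\<^sub>R (2 *\<^sub>R x) + inverse 2 *\<^sub>R (y + z)"
        unfolding scaleR_add_right[symmetric] by (simp add: scaleR_2)
      then show ?thesis unfolding midpoint_def by (simp only: scaleR_scaleR) simp
    qed
    ultimately show "g (midpoint y z) = midpoint (g y) (g z)"
      by (simp add: g_def) (simp add: midpoint_def algebra_simps flip: scaleR_2)
  next
    fix y :: 'a assume "y \<in> ball 0 r"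
    then have "x + y \<in> U" using r by (auto simp: subset_iff dist_norm)
    then show "norm (g y) = norm y"
      using iso x by (simp add: isometric_on_def g_def dist_norm)
  qed
  then obtain T where T: "linear T" "\<And>y. y \<in> ball 0 r \<Longrightarrow> g y = T y" "\<And>y. norm (T y) = norm y"
    by blast
  have "f y = f x + T (y - x)" if "y \<in> ball x r" for y
    using T(2)[of "y - x"] that by (simp add: g_def dist_norm norm_minus_commute diff_eq_eq add.commute)
  moreover have "ball x r \<subseteq> U" using r by (auto simp: subset_iff)
  ultimately show ?thesis using r(1) T by blast
qed

lemma isometry_affine_on_connected:
  fixes f :: "'a::real_normed_vector \<Rightarrow> 'b::real_normed_vector"
  assumes iso: "isometric_on U f" and op: "open U" "open (f ` U)"
    and D: "connected D" "open D" "D \<subseteq> U" and x0: "x0 \<in> D"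
  shows "\<exists>T. linear T \<and> (\<forall>v. norm (T v) = norm v) \<and> (\<forall>y\<in>D. f y = f x0 + T (y - x0))"
proof -
  have "\<forall>x. \<exists>r T. x \<in> U \<longrightarrow> r > 0 \<and> linear T \<and> (\<forall>v. norm (T v) = norm v) \<and> ball x r \<subseteq> U \<and>
      (\<forall>y\<in>ball x r. f y = f x + T (y - x))"
    using isometry_locally_affine[OF iso op] by metis
  then obtain r T where rT: "\<And>x. x \<in> U \<Longrightarrow> r x > 0" "\<And>x. x \<in> U \<Longrightarrow> linear (T x)"
    "\<And>x v. x \<in> U \<Longrightarrow> norm (T x v) = norm v" "\<And>x. x \<in> U \<Longrightarrow> ball x (r x) \<subseteq> U"
    "\<And>x y. x \<in> U \<Longrightarrow> y \<in> ball x (r x) \<Longrightarrow> f y = f x + T x (y - x)"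
    by metis
  have ev: "eventually (\<lambda>y. y \<in> ball x (r x)) (at x within D)" if "x \<in> D" for x
    unfolding eventually_at using rT(1)[of x] that D(3) by (auto simp: dist_commute intro!: exI[of _ "r x"])
  \<comment> \<open>Both affine formulas hold near \<open>y\<close>; comparing them at
    \<open>y + t v\<close> with one small \<open>t > 0\<close> identifies the linear parts in every
    direction \<open>v\<close>.\<close>
  have same: "T y = T x" if x: "x \<in> U" and y: "y \<in> ball x (r x)" for x y
  proof
    fix v :: 'a
    have yU: "y \<in> U" using rT(4) x y by blast
    obtain d where d: "d > 0" "ball y d \<subseteq> ball x (r x)" using y open_ball open_contains_ball by metis
    define t where "t = (min d (r y) / 2) / (norm v + 1)"
    have n1: "norm v + 1 > 0" by (simp add: add_nonneg_pos)
    have t: "t > 0" using d rT(1)[OF yU] n1 by (simp add: t_def)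
    have "t * norm v \<le> t * (norm v + 1)" using t by simp
    also have "\<dots> = min d (r y) / 2" unfolding t_def using n1 by (intro nonzero_eq_divide_eq[THEN iffD1]) simp_all
    also have "\<dots> < min d (r y)" using d rT(1)[OF yU] by linarith
    finally have tv: "norm (t *\<^sub>R v) < min d (r y)" using t by simp
    then have y1: "y + t *\<^sub>R v \<in> ball y (r y)" and y2: "y + t *\<^sub>R v \<in> ball x (r x)"
      using d(2) by (auto simp: subset_iff dist_norm)
    have "f (y + t *\<^sub>R v) = f y + T y (t *\<^sub>R v)" using rT(5)[OF yU y1] by simp
    moreover have "f (y + t *\<^sub>R v) = f x + T x (y - x) + T x (t *\<^sub>R v)"
      using rT(5)[OF x y2] linear_add[OF rT(2)[OF x], of "y - x" "t *\<^sub>R v"] by (simp add: algebra_simps)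
    moreover have "f y = f x + T x (y - x)" using rT(5)[OF x y] .
    ultimately have "T y (t *\<^sub>R v) = T x (t *\<^sub>R v)" by simp
    then show "T y v = T x v" using t by (simp add: linear_scale[OF rT(2)] x yU)
  qed
  have T_eq: "T x = T x0" if "x \<in> D" for x
  proof (rule connected_local_const[OF D(1) that x0], intro ballI)
    fix a assume "a \<in> D"
    then show "\<forall>\<^sub>F b in at a within D. T a = T b"
      using ev[of a] D(3) by (auto elim!: eventually_mono simp: same subset_iff)
  qed
  let ?T = "T x0"
  have x0U: "x0 \<in> U" using x0 D(3) by blast
  have "f y - ?T y = f x0 - ?T x0" if "y \<in> D" for y
  proof (rule connected_local_const[OF D(1) that x0], intro ballI)
    fix a assume a: "a \<in> D"
    then have aU: "a \<in> U" using D by blast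
    have "f a - ?T a = f b - ?T b" if "b \<in> ball a (r a)" for b
      using rT(5)[OF aU that] T_eq[OF a] linear_diff[OF rT(2)[OF x0U]] by simp
    then show "\<forall>\<^sub>F b in at a within D. f a - ?T a = f b - ?T b"
      using ev[OF a] by (auto elim!: eventually_mono)
  qed
  then have "f y = f x0 + ?T (y - x0)" if "y \<in> D" for y
    using that by (simp add: linear_diff[OF rT(2)[OF x0U]]) (simp add: algebra_simps)
  then show ?thesis using rT x0U by blast
qed

section \<open>Inverses in Jordan algebras\<close>

context unital_jordan_banach_algebra
begin

lemma jp_add_right: "jp a (b + c) = jp a b + jp a c"
  by (simp add: jp_commute[of a] jp_add_left)

lemma jp_scale_right: "jp a (smul z b) = smul z (jp a b)"
  by (simp add: jp_commute[of a] jp_scale_left)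

lemma jp_unit_right: "jp a e = a"
  by (simp add: jp_commute[of a] jp_unit)

lemma bounded_bilinear_jp: "bounded_bilinear jp"
proof
  show "jp (a + b) c = jp a c + jp b c" "jp a (b + c) = jp a b + jp a c" for a b c
    by (rule jp_add_left jp_add_right)+
  show "jp (r *\<^sub>R a) b = r *\<^sub>R jp a b" "jp a (r *\<^sub>R b) = r *\<^sub>R jp a b" for r a b
    by (simp_all add: jp_scale_left jp_scale_right flip: scale_of_real)
  show "\<exists>K. \<forall>a b. norm (jp a b) \<le> norm a * norm b * K"
    using norm_jp_le by (intro exI[of _ 1]) simp
qed

lemmas jp_simps = jp_add_left jp_add_right
  bounded_bilinear.diff_left[OF bounded_bilinear_jp] bounded_bilinear.diff_right[OF bounded_bilinear_jp]
  bounded_bilinear.minus_left[OF bounded_bilinear_jp] bounded_bilinear.minus_right[OF bounded_bilinear_jp]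
  bounded_bilinear.zero_left[OF bounded_bilinear_jp] bounded_bilinear.zero_right[OF bounded_bilinear_jp]
  bounded_bilinear.scaleR_left[OF bounded_bilinear_jp] bounded_bilinear.scaleR_right[OF bounded_bilinear_jp]

lemma double_eqD: "x + x = y + y \<Longrightarrow> x = (y :: 'a)"
  by (simp flip: scaleR_2)

lemma jordan_linearised:
  "jp (jp x w) (jp y z) + jp (jp y w) (jp x z) + jp (jp z w) (jp x y) =
   jp x (jp w (jp y z)) + jp y (jp w (jp x z)) + jp z (jp w (jp x y))"
proof -
  have J: "jp (jp v w) (jp v v) = jp v (jp w (jp v v))" for v by (rule jordan_identity)
  define F where "F v = jp (jp v w) (jp v v) - jp v (jp w (jp v v))" for v
  have F: "F v = 0" for v by (simp add: F_def J)
  \<comment> \<open>Polarisation of the cubic identity \<open>F = 0\<close>.\<close>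
  have "F (x + y + z) - F (x + y) - F (x + z) - F (y + z) + F x + F y + F z = 0"
    by (simp add: F)
  then have "(jp (jp x w) (jp y z) + jp (jp y w) (jp x z) + jp (jp z w) (jp x y)) +
      (jp (jp x w) (jp y z) + jp (jp y w) (jp x z) + jp (jp z w) (jp x y)) =
    (jp x (jp w (jp y z)) + jp y (jp w (jp x z)) + jp z (jp w (jp x y))) +
    (jp x (jp w (jp y z)) + jp y (jp w (jp x z)) + jp z (jp w (jp x y)))"
    unfolding F_def by (simp add: jp_simps jp_commute[of y x] jp_commute[of z x] jp_commute[of z y] algebra_simps)
  then show ?thesis by (rule double_eqD)
qed

text \<open>Read as an operator identity in \<open>w\<close>: the commutators
  \<open>[L x, L (y z)]\<close>, \<open>[L y, L (x z)]\<close> and \<open>[L z, L (x y)]\<close> add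
  up to zero, where \<open>L x\<close> is multiplication by \<open>x\<close>.\<close>

lemma jordan_linearised_comm:
  "jp x (jp (jp y z) w) + jp y (jp (jp x z) w) + jp z (jp (jp x y) w) =
   jp (jp y z) (jp x w) + jp (jp x z) (jp y w) + jp (jp x y) (jp z w)"
  using jordan_linearised[of x w y z] by (simp add: jp_commute)

text \<open>The same identity read as an operator identity in \<open>z\<close>; it expresses
  multiplication by \<open>w (x y)\<close> through multiplications by shorter products.\<close>

lemma jordan_linearised_op:
  "jp (jp x w) (jp y z) + jp (jp y w) (jp x z) + jp (jp x y) (jp w z) =
   jp x (jp w (jp y z)) + jp y (jp w (jp x z)) + jp (jp w (jp x y)) z"
  using jordan_linearised[of x w y z] by (simp add: jp_commute)

lemma jordan_U_alt: "jordan_U jp a x = jp a (jp a x) + jp a (jp a x) - jp (jp a a) x"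
  by (simp add: jordan_U_def scaleR_2 jp_commute)

text \<open>The commutator identity at \<open>a, a, a\<close>, at \<open>a, a, b\<close> and at
  \<open>a, b, b\<close>: every commutator that contains \<open>L (a b) = L e\<close> vanishes. The
  last claim is the second one at \<open>z = b\<close>.\<close>

lemma inverse_commutators:
  assumes ab: "jp a b = e" and sb: "jp (jp a a) b = a"
  shows "jp a (jp (jp a a) z) = jp (jp a a) (jp a z)"
    and "jp b (jp (jp a a) z) = jp (jp a a) (jp b z)"
    and "jp a (jp (jp b b) z) = jp (jp b b) (jp a z)"
    and "jp (jp a a) (jp b b) = e"
proof -
  have tri: "x + x + x = y + y + y \<Longrightarrow> x = y" for x y :: 'a
  proof -
    assume "x + x + x = y + y + y"
    then have "3 *\<^sub>R x = 3 *\<^sub>R y" by (simp add: scaleR_add_left[of 1 2, simplified] scaleR_2 algebra_simps)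
    then show "x = y" by simp
  qed
  show "jp a (jp (jp a a) z) = jp (jp a a) (jp a z)" for z
    using jordan_linearised_comm[of a a a z] by (rule tri)
  show *: "jp b (jp (jp a a) z) = jp (jp a a) (jp b z)" for z
    using jordan_linearised_comm[of a a b z] by (simp add: ab jp_unit jp_commute[of b a] jp_simps algebra_simps)
  show "jp a (jp (jp b b) z) = jp (jp b b) (jp a z)"
    using jordan_linearised_comm[of a b b z] by (simp add: ab jp_unit jp_commute[of b a] jp_simps algebra_simps)
  show "jp (jp a a) (jp b b) = e"
    using *[of b] by (simp add: sb ab jp_commute[of b a])
qed

lemma square_of_inverse:
  assumes ab: "jp a b = e" and sb: "jp (jp a a) b = a"
  shows "jp (jp b b) a = b"
proof -
  define s t c where "s = jp a a" and "t = jp b b" and "c = jp a t"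
  note com = inverse_commutators[OF ab sb, folded s_def t_def]
  have sb': "jp s b = a" using sb by (simp add: s_def)
  \<comment> \<open>With \<open>L x\<close> the multiplication by \<open>x\<close>, one gets \<open>[L a, L c] = [L a, L b]\<close>; so \<open>L a\<close> commutes
    with \<open>L d\<close> for \<open>d = c - b\<close>, and \<open>d = 2 a (d (a t)) = 2 a (a (d t)) = 2 t (a (a d)) = 0\<close>.\<close>
  have k1: "jp s (jp t z) - jp t (jp s z) = (jp a (jp b z) - jp b (jp a z)) + (jp a (jp b z) - jp b (jp a z))" for z
    using jordan_linearised_comm[of s b b z, folded t_def]
    by (simp add: sb' algebra_simps)
  have k2: "jp t (jp s z) + jp a (jp c z) + jp a (jp c z) = jp s (jp t z) + jp c (jp a z) + jp c (jp a z)" for z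
    using jordan_linearised_comm[of t a a z, folded s_def]
    by (simp add: jp_commute[of t a] c_def[symmetric] algebra_simps)
  have "(jp a (jp c z) - jp c (jp a z)) + (jp a (jp c z) - jp c (jp a z)) = jp s (jp t z) - jp t (jp s z)" for z
    using k2[of z] by (simp add: algebra_simps)
  then have "(jp a (jp c z) - jp c (jp a z)) + (jp a (jp c z) - jp c (jp a z)) =
      (jp a (jp b z) - jp b (jp a z)) + (jp a (jp b z) - jp b (jp a z))" for z
    by (simp only: k1)
  then have k3: "jp a (jp c z) - jp c (jp a z) = jp a (jp b z) - jp b (jp a z)" for z
    by (rule double_eqD)
  define d where "d = c - b"
  have ad: "jp a (jp d z) = jp d (jp a z)" for z
    using k3[of z] by (simp add: d_def jp_simps algebra_simps)
  have ac: "jp a c = e"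
    using com(3)[of a] com(4) by (simp add: c_def jp_commute[of a t] jp_commute[of t s] s_def[symmetric])
  have sc: "jp s c = a" using com(1)[of t] com(4) by (simp add: c_def jp_unit_right)
  have d0: "jp a d = 0" "jp s d = 0" using ab ac sb' sc by (simp_all add: d_def jp_simps)
  have "jp a (jp a (jp d t)) = jp t (jp a (jp a d))"
    by (simp add: jp_commute[of d t] com(3))
  then have "jp a (jp d (jp a t)) = 0" using d0 ad by (simp add: jp_simps)
  moreover have "jp s (jp d t) = d"
    using jordan_linearised_comm[of a a d t, folded s_def] com(4)
    by (simp add: d0 jp_commute[of d a] jp_simps jp_unit_right)
  moreover have "jp s (jp d t) + jp (jp d a) (jp a t) + jp (jp d a) (jp a t) = jp a (jp d (jp a t)) + jp a (jp d (jp a t)) + jp (jp d s) t"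
    using jordan_linearised_op[of a d a t, folded s_def] by (simp add: jp_commute[of a d] algebra_simps)
  ultimately have "d = 0" using d0 by (simp add: jp_commute[of d a] jp_commute[of d s] jp_simps)
  then show ?thesis by (simp add: d_def c_def t_def jp_commute)
qed

lemma inverse_symmetric:
  assumes "is_jordan_inverse jp e a b"
  shows "is_jordan_inverse jp e b a"
proof -
  have "jp a b = e" and "jp (jp a a) b = a" using assms by (simp_all add: is_jordan_inverse_def)
  then show ?thesis
    unfolding is_jordan_inverse_def using square_of_inverse by (metis jp_commute)
qed

lemma jordan_U_linear:
  "jordan_U jp a (x + y) = jordan_U jp a x + jordan_U jp a y"
  "jordan_U jp a (x - y) = jordan_U jp a x - jordan_U jp a y"
  by (simp_all add: jordan_U_alt jp_simps algebra_simps)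

text \<open>With \<open>K = [L a, L b]\<close> the first identity says \<open>[L a, K] = 0\<close>
  and the sixth \<open>K (L t) = 0\<close>. The latter results from computing
  \<open>(L t) (U a) (L t)\<close> in two ways by the fourth and the fifth identity.\<close>

lemma inverse_operator_identities:
  fixes a b t
  assumes inv: "is_jordan_inverse jp e a b"
  defines "t \<equiv> jp b b"
  shows "jp a (jp a (jp b z)) + jp b (jp a (jp a z)) = jp a (jp b (jp a z)) + jp a (jp b (jp a z))"
    and "jordan_U jp a (jp b z) = jp a z + (jp a (jp a (jp b z)) - jp b (jp a (jp a z)))"
    and "jp b (jordan_U jp a z) = jp a z - (jp a (jp a (jp b z)) - jp b (jp a (jp a z)))"
    and "jordan_U jp a (jp t z) = jp b (jp a z) + jp b (jp a z) - z"
    and "jp t (jordan_U jp a z) = jp a (jp b z) + jp a (jp b z) - z"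
    and "jp a (jp b (jp t z)) = jp b (jp a (jp t z))"
    and "jp a (jp t z) = jp t (jp a z)" and "jp b (jp t z) = jp t (jp b z)"
proof -
  define s where "s = jp a a"
  have ab: "jp a b = e" and sb: "jp (jp a a) b = a" using inv by (auto simp: is_jordan_inverse_def)
  have ba: "jp b a = e" and ta: "jp (jp b b) a = b"
    using inverse_symmetric[OF inv] by (auto simp: is_jordan_inverse_def)
  have sb': "jp s b = a" "jp b s = a" and ta': "jp t a = b" "jp a t = b"
    using sb ta by (simp_all add: s_def t_def jp_commute)
  have com: "jp s (jp a z) = jp a (jp s z)" "jp s (jp b z) = jp b (jp s z)"
    "jp a (jp t z) = jp t (jp a z)" "jp s t = e" "jp t s = e" for z
    using inverse_commutators[OF ab sb] by (simp_all add: s_def t_def jp_commute[of "jp b b" "jp a a"])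
  have com': "jp b (jp t z) = jp t (jp b z)" for z
    using inverse_commutators(1)[OF ba ta] by (simp add: t_def)
  have ii: "jp b (jp s z) + jp a z = jp a (jp b (jp a z)) + jp a (jp b (jp a z))" for z
    using jordan_linearised_op[of a b a z] by (simp add: s_def[symmetric] ab ba sb' com jp_unit algebra_simps)
  have i: "jp b (jp s z) + jp a z = jp a (jp a (jp b z)) + jp b (jp a (jp a z))" for z
    using jordan_linearised_op[of a a b z]
    by (simp add: s_def[symmetric] ab ba com jp_unit jp_unit_right algebra_simps)
  show 1: "jp a (jp a (jp b z)) + jp b (jp a (jp a z)) = jp a (jp b (jp a z)) + jp a (jp b (jp a z))"
    using i ii by metis
  have s: "jp b (jp s z) = jp a (jp a (jp b z)) + jp b (jp a (jp a z)) - jp a z"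
    using i[of z] by (simp add: algebra_simps)
  show "jordan_U jp a (jp b z) = jp a z + (jp a (jp a (jp b z)) - jp b (jp a (jp a z)))"
    unfolding jordan_U_alt s_def[symmetric] com(2) s by (simp add: algebra_simps)
  show "jp b (jordan_U jp a z) = jp a z - (jp a (jp a (jp b z)) - jp b (jp a (jp a z)))"
    unfolding jordan_U_alt s_def[symmetric] jp_simps s by (simp add: algebra_simps)
  have v: "jordan_U jp a (jp t z) = jp b (jp a z) + jp b (jp a z) - z" for z
    using jordan_linearised_op[of a t a z]
    by (simp add: s_def[symmetric] ta' jordan_U_alt com jp_unit algebra_simps)
  then show "jordan_U jp a (jp t z) = jp b (jp a z) + jp b (jp a z) - z" .
  have k1: "jp t (jp s z) = jp s (jp t z) - (jp a (jp b z) - jp b (jp a z)) - (jp a (jp b z) - jp b (jp a z))" for z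
    using jordan_linearised_comm[of s b b z] by (simp add: t_def[symmetric] sb' algebra_simps)
  have v': "jp t (jordan_U jp a z) = jp a (jp b z) + jp a (jp b z) - z" for z
    using v[of z] k1[of z] unfolding jordan_U_alt s_def[symmetric]
    by (simp add: jp_simps com(3) algebra_simps)
  then show "jp t (jordan_U jp a z) = jp a (jp b z) + jp a (jp b z) - z" .
  have "jp t (jordan_U jp a (jp t z)) = jp b (jp a (jp t z)) + jp b (jp a (jp t z)) - jp t z"
    unfolding v by (simp add: jp_simps com(3) com')
  then have "jp a (jp b (jp t z)) + jp a (jp b (jp t z)) = jp b (jp a (jp t z)) + jp b (jp a (jp t z))"
    unfolding v' by simp
  then show "jp a (jp b (jp t z)) = jp b (jp a (jp t z))" by (rule double_eqD)
  show "jp a (jp t z) = jp t (jp a z)" "jp b (jp t z) = jp t (jp b z)"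
    by (rule com(3) com')+
qed

lemma inverse_operators_commute:
  assumes inv: "is_jordan_inverse jp e a b"
  shows "jp a (jp b z) = jp b (jp a z)"
proof -
  define s t where "s = jp a a" and "t = jp b b"
  note I = inverse_operator_identities[OF inv, folded s_def t_def]
  note I' = inverse_operator_identities[OF inverse_symmetric[OF inv], folded s_def t_def]
  \<comment> \<open>The commutator \<open>K = [L a, L b]\<close> commutes with \<open>L a\<close> and \<open>L b\<close>, and
    \<open>K = 2 K (L a) (L b) = 2 K (L b) (L a)\<close>; evaluating \<open>(L b) (U a) (L b)\<close> in two ways gives
    \<open>K = 2 K (L a) (L b) + 2 K (L b) (L a) = 2 K\<close>.\<close>
  define K where "K z = jp a (jp b z) - jp b (jp a z)" for z
  have Klin: "K (x + y) = K x + K y" "K (x - y) = K x - K y" for x y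
    by (simp_all add: K_def jp_simps)
  have Ka: "K (jp a z) = jp a (K z)" for z
    using I(1)[of z] by (simp add: K_def jp_simps algebra_simps)
  have Kb: "K (jp b z) = jp b (K z)" for z
    using I'(1)[of z] by (simp add: K_def jp_simps algebra_simps)
  have Kt: "K (jp t z) = 0" for z using I(6)[of z] by (simp add: K_def)
  have Ks: "K (jp s z) = 0" for z using I'(6)[of z] by (simp add: K_def)
  have "K (jordan_U jp a (jp t z)) = 0" for z
    by (simp add: jordan_U_alt s_def[symmetric] Klin Ka Ks Kt jp_simps)
  then have Y: "jp b (jp a (K z)) + jp b (jp a (K z)) = K z" for z
    unfolding I(4) by (simp add: Klin Ka Kb algebra_simps)
  have "K (jp t (jordan_U jp a z)) = 0" for z by (rule Kt)
  then have X: "jp a (jp b (K z)) + jp a (jp b (K z)) = K z" for z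
    unfolding I(5) by (simp add: Klin Ka Kb algebra_simps)
  have aK: "jp a (jp a (jp b z)) - jp b (jp a (jp a z)) = jp a (K z) + jp a (K z)" for z
    using Ka[of z] by (simp add: K_def jp_simps algebra_simps)
  have "jp b (jordan_U jp a (jp b z)) = jp b (jp a z) + (jp b (jp a (K z)) + jp b (jp a (K z)))"
    unfolding I(2) aK by (simp add: jp_simps)
  moreover have "jp b (jordan_U jp a (jp b z)) = jp a (jp b z) - (jp a (jp b (K z)) + jp a (jp b (K z)))"
    unfolding I(3) aK Kb by simp
  ultimately have "jp b (jp a z) + K z = jp a (jp b z) - K z"
    unfolding X Y by simp
  then have "K z = 0" by (simp add: K_def algebra_simps)
  then show ?thesis by (simp add: K_def)
qed

text \<open>Once \<open>L a\<close> and \<open>L b\<close> commute, \<open>(U a) (L b) = L a\<close>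
  and \<open>(U a) (L (b b)) = 2 (L a) (L b) - 1\<close>; substituting
  \<open>U b = 2 (L b) (L b) - L (b b)\<close> leaves the identity.\<close>

lemma jordan_U_inverse:
  assumes inv: "is_jordan_inverse jp e a b"
  shows "jordan_U jp a (jordan_U jp b z) = z"
proof -
  note com = inverse_operators_commute[OF inv]
  have "jordan_U jp a (jp b w) = jp a w" for w
    using inverse_operator_identities(2)[OF inv] by (simp add: com)
  then show ?thesis
    by (simp add: jordan_U_alt[of b] jordan_U_linear inverse_operator_identities(4)[OF inv] com)
qed

lemma jordan_U_apply_inverse: "is_jordan_inverse jp e a b \<Longrightarrow> jordan_U jp a b = a"
  by (simp add: jordan_U_alt is_jordan_inverse_def jp_unit_right)

text \<open>\<open>U a\<close> is injective and sends every inverse of \<open>a\<close> to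
  \<open>a\<close>.\<close>

lemma is_jordan_inverse_unique:
  assumes "is_jordan_inverse jp e a b" and "is_jordan_inverse jp e a c"
  shows "b = c"
  using assms jordan_U_inverse[OF inverse_symmetric] jordan_U_apply_inverse by metis

lemma jordan_inverse_eqI: "is_jordan_inverse jp e a b \<Longrightarrow> jordan_inverse jp e a = b"
  unfolding jordan_inverse_def using is_jordan_inverse_unique by blast

lemma is_jordan_inverse_jordan_inverse:
  "a \<in> jordan_invertibles jp e \<Longrightarrow> is_jordan_inverse jp e a (jordan_inverse jp e a)"
  unfolding jordan_invertibles_def using jordan_inverse_eqI by auto

end

section \<open>The set of invertible elements and its clopen quadratic subsets\<close>

text \<open>Solving \<open>x + K x = y\<close> means finding the fixed point of the contraction
  \<open>x \<mapsto> y - K x\<close>.\<close>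

lemma bij_add_contraction:
  fixes K :: "'a::banach \<Rightarrow> 'a"
  assumes K: "linear K" "\<And>x. norm (K x) \<le> k * norm x" and k: "0 \<le> k" "k < 1"
  shows "bij (\<lambda>x. x + K x)"
proof -
  have "\<exists>!x. y - K x = x" for y
  proof (rule banach_fix_type[OF k])
    show "\<forall>x z. dist (y - K x) (y - K z) \<le> k * dist x z"
    proof (intro allI)
      fix x z
      show "dist (y - K x) (y - K z) \<le> k * dist x z"
        using K(2)[of "z - x"] by (simp add: dist_norm linear_diff[OF K(1)] norm_minus_commute)
    qed
  qed
  moreover have "y - K x = x \<longleftrightarrow> x + K x = y" for x y by (auto simp: algebra_simps)
  ultimately have "\<exists>!x. x + K x = y" for y by simp
  then show ?thesis by (simp add: bij_iff)
qed

context complex_banach_space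
begin

lemma bounded_bilinear_smul: "bounded_bilinear smul"
proof
  show "smul (a + b) x = smul a x + smul b x" "smul a (x + y) = smul a x + smul a y" for a b x y
    by (rule scale_left_distrib scale_right_distrib)+
  show "smul (r *\<^sub>R a) x = r *\<^sub>R smul a x" for r a x
    by (simp add: scaleR_conv_of_real flip: scale_of_real)
  show "smul a (r *\<^sub>R x) = r *\<^sub>R smul a x" for r a x
    by (simp add: mult.commute flip: scale_of_real)
  show "\<exists>K. \<forall>a b. norm (smul a b) \<le> norm a * norm b * K"
    by (intro exI[of _ 1]) (simp add: norm_scale)
qed

end

context unital_jordan_banach_algebra
begin

text \<open>This moves invertibility from elements to linear operators, where perturbation arguments
  apply. The inverse is the preimage \<open>d\<close> of \<open>c\<close>: since \<open>U c\<close>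
  commutes with multiplication by \<open>c\<close> and by \<open>c c\<close>, it maps
  \<open>c d\<close> and \<open>e\<close> to the same element, and likewise \<open>(c c) d\<close>
  and \<open>c\<close>.\<close>

lemma jordan_invertible_if_bij_U:
  assumes "bij (jordan_U jp c)"
  shows "c \<in> jordan_invertibles jp e"
proof -
  have inj: "jordan_U jp c x = jordan_U jp c y \<Longrightarrow> x = y" for x y
    using assms by (simp add: bij_def inj_eq)
  obtain d where d: "jordan_U jp c d = c" using assms by (metis bij_pointE)
  have com: "jp c (jp (jp c c) z) = jp (jp c c) (jp c z)" for z
    using jordan_identity[of c z] by (simp add: jp_commute)
  have "jordan_U jp c (jp c z) = jp c (jordan_U jp c z)"
    "jordan_U jp c (jp (jp c c) z) = jp (jp c c) (jordan_U jp c z)" for z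
    by (simp_all add: jordan_U_alt jp_simps com)
  then have "jordan_U jp c (jp c d) = jordan_U jp c e" "jordan_U jp c (jp (jp c c) d) = jordan_U jp c c"
    by (simp_all add: d) (simp_all add: jordan_U_alt jp_unit jp_unit_right jp_commute)
  then have "is_jordan_inverse jp e c d" unfolding is_jordan_inverse_def using inj by blast
  then show ?thesis by (auto simp: jordan_invertibles_def)
qed

lemma norm_jordan_U_le: "norm (jordan_U jp a x) \<le> 3 * (norm a)\<^sup>2 * norm x"
proof -
  have 1: "norm (jp a (jp a x)) \<le> norm a * (norm a * norm x)"
    by (intro order_trans[OF norm_jp_le] mult_left_mono norm_jp_le) auto
  have 2: "norm (jp (jp a a) x) \<le> (norm a * norm a) * norm x"
    by (intro order_trans[OF norm_jp_le] mult_right_mono norm_jp_le) auto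
  have "norm (jordan_U jp a x) \<le> norm (jp a (jp a x)) + norm (jp a (jp a x)) + norm (jp (jp a a) x)"
    unfolding jordan_U_alt by (meson norm_triangle_ineq norm_triangle_ineq4 add_mono order_refl order_trans)
  then show ?thesis using 1 2 by (simp add: power2_eq_square)
qed

lemma linear_jordan_U: "linear (jordan_U jp a)"
  by (rule linearI) (simp_all add: jordan_U_alt jp_simps algebra_simps)

lemma norm_jordan_U_diff_le:
  "norm (jordan_U jp c x - jordan_U jp a x) \<le> 3 * norm (c - a) * (norm c + norm a) * norm x"
proof -
  have 1: "norm (jp c (jp (c - a) x)) \<le> norm c * (norm (c - a) * norm x)"
    by (intro order_trans[OF norm_jp_le] mult_left_mono norm_jp_le) auto
  have 2: "norm (jp (c - a) (jp a x)) \<le> norm (c - a) * (norm a * norm x)"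
    by (intro order_trans[OF norm_jp_le] mult_left_mono norm_jp_le) auto
  have 3: "norm (jp (jp (c + a) (c - a)) x) \<le> ((norm c + norm a) * norm (c - a)) * norm x"
    by (intro order_trans[OF norm_jp_le] mult_right_mono order_trans[OF norm_jp_le] norm_triangle_ineq) auto
  let ?u = "jp c (jp (c - a) x)" and ?v = "jp (c - a) (jp a x)" and ?w = "jp (jp (c + a) (c - a)) x"
  have "jordan_U jp c x - jordan_U jp a x = (?u + ?v) + (?u + ?v) - ?w"
    by (simp add: jordan_U_alt jp_simps jp_commute[of a c] algebra_simps)
  then have "norm (jordan_U jp c x - jordan_U jp a x) \<le> (norm ?u + norm ?v) + (norm ?u + norm ?v) + norm ?w"
    using norm_triangle_ineq4[of "(?u + ?v) + (?u + ?v)" ?w] norm_triangle_ineq[of "?u + ?v" "?u + ?v"]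
      norm_triangle_ineq[of ?u ?v] by simp
  also have "\<dots> \<le> 3 * norm (c - a) * (norm c + norm a) * norm x"
    using 1 2 3 by (simp add: algebra_simps)
  finally show ?thesis .
qed

text \<open>For \<open>c\<close> near \<open>a\<close> one has \<open>U c = (U a) (1 + K)\<close>
  with \<open>K = (U b) (U c - U a)\<close> a contraction, so \<open>U c\<close> is bijective along
  with \<open>U a\<close>.\<close>

lemma open_jordan_invertibles: "open (jordan_invertibles jp e)"
proof (unfold open_dist, intro ballI)
  fix a assume "a \<in> jordan_invertibles jp e"
  then obtain b where b: "is_jordan_inverse jp e a b" by (auto simp: jordan_invertibles_def)
  \<comment> \<open>The 9 is the product of the factors 3 in the two norm estimates for
    \<open>U\<close>, and \<open>2 * norm a + 1\<close> bounds \<open>norm c + norm a\<close>. The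
    final \<open>+ 1\<close> ensures both \<open>norm (c - a) \<le> 1\<close> and a contraction
    constant strictly below 1.\<close>
  define M where "M = 9 * (norm b)\<^sup>2 * (2 * norm a + 1) + 1"
  have M: "M \<ge> 1" by (simp add: M_def)
  show "\<exists>d>0. \<forall>c. dist c a < d \<longrightarrow> c \<in> jordan_invertibles jp e"
  proof (intro exI[of _ "1 / M"] conjI allI impI)
    fix c assume "dist c a < 1 / M"
    then have h: "norm (c - a) * M < 1" using M by (simp add: dist_norm pos_less_divide_eq)
    have "norm (c - a) * 1 \<le> norm (c - a) * M" using M by (intro mult_left_mono) auto
    then have h1: "norm (c - a) \<le> 1" using h by simp
    define k where "k = norm (c - a) * (9 * (norm b)\<^sup>2 * (2 * norm a + 1))"
    have "k = norm (c - a) * M - norm (c - a)" by (simp add: k_def M_def algebra_simps)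
    then have "k < 1" using h norm_ge_zero[of "c - a"] by linarith
    moreover have "0 \<le> k" by (simp add: k_def)
    ultimately have k: "0 \<le> k" "k < 1" by simp_all
    define K where "K z = jordan_U jp b (jordan_U jp c z - jordan_U jp a z)" for z
    have "linear K"
      unfolding K_def
      by (intro linear_compose[of "\<lambda>z. jordan_U jp c z - jordan_U jp a z" "jordan_U jp b", unfolded o_def]
          linear_compose_sub linear_jordan_U)
    moreover have "norm (K z) \<le> k * norm z" for z
    proof -
      have ca: "norm c \<le> norm a + 1" using h1 norm_triangle_ineq2[of c a] by linarith
      have "norm (K z) \<le> 3 * (norm b)\<^sup>2 * (3 * norm (c - a) * (norm c + norm a) * norm z)"
        unfolding K_def by (intro order_trans[OF norm_jordan_U_le] mult_left_mono norm_jordan_U_diff_le) auto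
      also have "\<dots> \<le> 3 * (norm b)\<^sup>2 * (3 * norm (c - a) * (2 * norm a + 1) * norm z)"
        using ca by (intro mult_left_mono mult_right_mono) auto
      finally show ?thesis by (simp add: k_def algebra_simps)
    qed
    ultimately have bij: "bij (\<lambda>z. z + K z)" using k by (rule bij_add_contraction)
    have "jordan_U jp c = jordan_U jp a \<circ> (\<lambda>z. z + K z)"
    proof
      fix z
      show "jordan_U jp c z = (jordan_U jp a \<circ> (\<lambda>z. z + K z)) z"
        by (simp add: K_def jordan_U_linear(1) jordan_U_inverse[OF b])
    qed
    moreover have "bij (jordan_U jp a)"
      using jordan_U_inverse[OF b] jordan_U_inverse[OF inverse_symmetric[OF b]]
      by (intro o_bij[where g = "jordan_U jp b"]) auto
    ultimately have "bij (jordan_U jp c)" using bij bij_comp by metis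
    then show "c \<in> jordan_invertibles jp e" by (rule jordan_invertible_if_bij_U)
  qed (use M in auto)
qed

lemma is_jordan_inverse_scale:
  assumes "is_jordan_inverse jp e a b" and "c \<noteq> 0"
  shows "is_jordan_inverse jp e (smul c a) (smul (1 / c) b)"
  using assms by (simp add: is_jordan_inverse_def jp_scale_left jp_scale_right)

end

locale clopen_quadratic_subset = unital_jordan_banach_algebra smul jp e
  for smul :: "complex \<Rightarrow> 'a::banach \<Rightarrow> 'a" and jp e +
  fixes S :: "'a set"
  assumes quadratic: "quadratic_subset jp e S"
    and clopen: "clopen_in (jordan_invertibles jp e) S"
    and powers_inverses: "closed_powers_inverses jp e S"
begin

lemma subset_invertibles: "S \<subseteq> jordan_invertibles jp e"
  using quadratic by (simp add: quadratic_subset_def)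

lemma U_closed: "a \<in> S \<Longrightarrow> b \<in> S \<Longrightarrow> jordan_U jp a b \<in> S"
  using quadratic by (simp add: quadratic_subset_def)

lemma inverse_exists:
  assumes "a \<in> S"
  obtains b where "b \<in> S" "is_jordan_inverse jp e a b"
  using assms subset_invertibles powers_inverses is_jordan_inverse_jordan_inverse
  unfolding closed_powers_inverses_def by blast

lemma power_closed: "a \<in> S \<Longrightarrow> n \<ge> 1 \<Longrightarrow> jordan_power jp e a n \<in> S"
  using powers_inverses by (simp add: closed_powers_inverses_def)

lemma unit_mem: "e \<in> S"
proof -
  obtain a where a: "a \<in> S" using quadratic by (auto simp: quadratic_subset_def)
  then obtain b where b: "b \<in> S" "is_jordan_inverse jp e a b" by (rule inverse_exists)
  have "jp b b \<in> S" using power_closed[OF b(1), of 2] by (simp add: numeral_2_eq_2 jp_unit_right)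
  moreover have "jordan_U jp a (jp b b) = e"
    using b(2) inverse_operator_identities(4)[OF b(2), of e] by (simp add: is_jordan_inverse_def jp_unit jp_unit_right jp_commute)
  ultimately show ?thesis using U_closed[OF a] by metis
qed

lemma connected_subset:
  assumes "connected C" "C \<subseteq> jordan_invertibles jp e" "a \<in> C" "a \<in> S"
  shows "C \<subseteq> S"
proof -
  obtain O1 where O1: "open O1" "S = jordan_invertibles jp e \<inter> O1"
    using clopen by (auto simp: clopen_in_def openin_open)
  obtain C1 where C1: "closed C1" "S = jordan_invertibles jp e \<inter> C1"
    using clopen by (auto simp: clopen_in_def closedin_closed)
  have "C \<inter> S = C \<inter> O1" "C \<inter> S = C \<inter> C1" using O1 C1 assms(2) by auto
  then have "openin (top_of_set C) (C \<inter> S)" "closedin (top_of_set C) (C \<inter> S)"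
    using O1 C1 by (auto simp: openin_open closedin_closed)
  then have "C \<inter> S = {} \<or> C \<inter> S = C" using assms(1) connected_clopen by blast
  then show ?thesis using assms by auto
qed

lemma open_S: "open S"
  using clopen open_jordan_invertibles openin_open_trans by (auto simp: clopen_in_def)

text \<open>The non-zero complex multiples of \<open>a\<close> are invertible and form a connected
  set, which a clopen subset cannot cut. Non-zero real multiples alone would not connect
  \<open>a\<close> with \<open>- a\<close>.\<close>

lemma scale_closed:
  assumes a: "a \<in> S" and c: "c \<noteq> 0"
  shows "smul c a \<in> S"
proof -
  have "continuous_on (- {0}) (\<lambda>c. smul c a)"
    by (rule bounded_bilinear.continuous_on[OF bounded_bilinear_smul continuous_on_id continuous_on_const])
  then have "connected ((\<lambda>c. smul c a) ` (- {0}))"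
    by (rule connected_continuous_image) (simp add: connected_punctured_universe)
  moreover have "(\<lambda>c. smul c a) ` (- {0}) \<subseteq> jordan_invertibles jp e"
  proof
    fix x assume "x \<in> (\<lambda>c. smul c a) ` (- {0})"
    then obtain c where c: "c \<noteq> 0" "x = smul c a" by blast
    obtain b where "is_jordan_inverse jp e a b" using a by (rule inverse_exists)
    then have "is_jordan_inverse jp e x (smul (1 / c) b)"
      unfolding c(2) using c(1) by (rule is_jordan_inverse_scale)
    then show "x \<in> jordan_invertibles jp e" by (auto simp: jordan_invertibles_def)
  qed
  moreover have "a \<in> (\<lambda>c. smul c a) ` (- {0})" by (rule image_eqI[of _ _ 1]) simp_all
  ultimately have "(\<lambda>c. smul c a) ` (- {0}) \<subseteq> S" using a by (rule connected_subset)
  then show ?thesis using c by auto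
qed

lemma open_connected_cone:
  obtains D d where "open D" "connected D" "D \<subseteq> S" "e \<in> D" "d > 0"
    "\<And>a l. norm a < cmod l * d \<Longrightarrow> a + smul l e \<in> D"
proof -
  obtain d where d: "d > 0" "ball e d \<subseteq> S" using open_S unit_mem by (meson open_contains_ball)
  define D where "D = (\<lambda>(l, x). smul l x) ` ((- {0}) \<times> ball e d)"
  have inD: "a + smul l e \<in> D" if "norm a < cmod l * d" for a l
  proof -
    have l: "l \<noteq> 0" using that by auto
    have "norm (smul (1 / l) a) < d"
      using that l by (simp add: norm_scale norm_divide divide_less_eq mult.commute)
    then have "e + smul (1 / l) a \<in> ball e d" by (simp add: dist_norm)
    moreover have "smul l (e + smul (1 / l) a) = a + smul l e"
      using l by (simp add: scale_right_distrib add.commute)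
    ultimately show ?thesis unfolding D_def using l by force
  qed
  have "D = (\<Union>l\<in>-{0}. ball (smul l e) (cmod l * d))"
  proof (intro equalityI subsetI)
    fix z assume "z \<in> D"
    then obtain l x where z: "l \<noteq> 0" "x \<in> ball e d" "z = smul l x" by (fastforce simp: D_def)
    have "dist (smul l e) z = cmod l * dist e x"
      by (simp add: z dist_norm norm_scale flip: scale_right_diff_distrib)
    then show "z \<in> (\<Union>l\<in>-{0}. ball (smul l e) (cmod l * d))"
      using z(1,2) by (intro UN_I[of l]) simp_all
  next
    fix z assume "z \<in> (\<Union>l\<in>-{0}. ball (smul l e) (cmod l * d))"
    then obtain l where "norm (z - smul l e) < cmod l * d" by (auto simp: dist_norm norm_minus_commute)
    then show "z \<in> D" using inD by fastforce
  qed
  then have "open D" by auto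
  moreover have "continuous_on ((- {0}) \<times> ball e d) (\<lambda>p. smul (fst p) (snd p))"
    by (intro bounded_bilinear.continuous_on[OF bounded_bilinear_smul] continuous_on_fst continuous_on_snd
        continuous_on_id)
  then have "connected D" unfolding D_def case_prod_unfold
    by (rule connected_continuous_image) (simp add: connected_Times connected_punctured_universe)
  moreover have "D \<subseteq> S" unfolding D_def using d(2) scale_closed by fastforce
  moreover have "e \<in> D" using inD[of 0 1] d by simp
  ultimately show ?thesis using that d inD by blast
qed

end

section \<open>The isometry is the restriction of a linear isometry\<close>

text \<open>The contour integral is replaced by an average over roots of unity, whose orthogonality
  isolates the coefficient \<open>v k\<close> exactly.\<close>

lemma (in complex_banach_space) cauchy_estimate:
  assumes R: "R \<ge> 0" and le: "\<And>t. cmod t = R \<Longrightarrow> norm (\<Sum>m\<le>n. smul (t ^ m) (v m)) \<le> M" and k: "k \<le> n"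
  shows "norm (v k) * R ^ k \<le> M"
proof -
  \<comment> \<open>With more than \<open>n\<close> roots, different exponents up to
    \<open>n\<close> remain different modulo \<open>N\<close>.\<close>
  define N where "N = Suc n"
  have N0: "of_nat N \<noteq> (0 :: complex)" unfolding of_nat_eq_0_iff by (simp add: N_def)
  define w where "w m = exp (2 * of_real pi * \<i> * of_nat m / of_nat N)" for m :: nat
  have w1: "cmod (w m) = 1" for m by (simp add: w_def norm_exp_eq_Re)
  have wpow: "w m ^ j = w (m * j)" for m j
    by (simp add: w_def exp_of_nat_mult[symmetric] mult_ac)
  have wN: "w m ^ N = 1" for m
  proof -
    have "w m ^ N = exp (of_nat N * (2 * of_real pi * \<i> * of_nat m / of_nat N))"
      unfolding w_def by (rule exp_of_nat_mult[symmetric])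
    also have "\<dots> = exp (of_nat m * (2 * of_real pi * \<i>))"
      using N0 by (intro arg_cong[of _ _ exp]) (simp add: field_simps)
    also have "\<dots> = 1" by (simp add: exp_of_nat_mult exp_two_pi_i)
    finally show ?thesis .
  qed
  define z where "z m = w m * cnj (w k)" for m
  have zz: "w m * cnj (w m) = 1" for m using w1[of m] by (simp add: complex_norm_square[symmetric])
  have sum_z: "(\<Sum>j<N. z m ^ j) = (if m = k then of_nat N else 0)" if "m \<le> n" for m
  proof (cases "m = k")
    case True
    then show ?thesis by (simp add: z_def zz)
  next
    case False
    have "z m \<noteq> 1"
    proof
      assume "z m = 1"
      then have "w m * (w k * cnj (w k)) = w k" by (simp add: z_def ac_simps)
      then have "w m = w k" by (simp add: zz)
      then have "m mod N = k mod N"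
        using complex_root_unity_eq[of N m k] by (simp add: w_def N_def)
      then show False using False that k by (simp add: N_def)
    qed
    moreover have "z m ^ N = 1" by (simp add: z_def power_mult_distrib wN flip: complex_cnj_power)
    ultimately show ?thesis using False by (simp add: geometric_sum)
  qed
  have "(\<Sum>j<N. smul (cnj (w k) ^ j) (\<Sum>m\<le>n. smul ((of_real R * w j) ^ m) (v m))) =
      (\<Sum>m\<le>n. smul (of_real R ^ m * (\<Sum>j<N. z m ^ j)) (v m))"
  proof -
    have "cnj (w k) ^ j * (of_real R * w j) ^ m = of_real R ^ m * z m ^ j" for j m
      by (simp add: z_def power_mult_distrib wpow mult_ac)
    then have "(\<Sum>j<N. smul (cnj (w k) ^ j) (\<Sum>m\<le>n. smul ((of_real R * w j) ^ m) (v m))) =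
        (\<Sum>j<N. \<Sum>m\<le>n. smul (of_real R ^ m * z m ^ j) (v m))"
      by (simp add: scale_sum_right)
    also have "\<dots> = (\<Sum>m\<le>n. \<Sum>j<N. smul (of_real R ^ m * z m ^ j) (v m))" by (rule sum.swap)
    finally show ?thesis by (simp add: sum_distrib_left scale_sum_left)
  qed
  also have "\<dots> = (\<Sum>m\<le>n. if m = k then smul (of_real R ^ k * of_nat N) (v k) else 0)"
    by (intro sum.cong) (auto simp: sum_z)
  also have "\<dots> = smul (of_real R ^ k * of_nat N) (v k)" using k by simp
  finally have "norm (smul (of_real R ^ k * of_nat N) (v k)) =
      norm (\<Sum>j<N. smul (cnj (w k) ^ j) (\<Sum>m\<le>n. smul ((of_real R * w j) ^ m) (v m)))" by simp
  also have "\<dots> \<le> (\<Sum>j<N. norm (smul (cnj (w k) ^ j) (\<Sum>m\<le>n. smul ((of_real R * w j) ^ m) (v m))))"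
    by (rule norm_sum)
  also have "\<dots> \<le> (\<Sum>j<N. M)"
    using le R by (intro sum_mono) (simp add: norm_scale norm_power w1 norm_mult)
  finally have "real N * (norm (v k) * R ^ k) \<le> real N * M"
    using R by (simp add: norm_scale norm_mult norm_power ac_simps)
  then show ?thesis by (simp add: N_def)
qed

context unital_commutative_banach_algebra
begin

lemma scale_one_mult: "smul c 1 * x = smul c x"
  by (simp add: scale_mult_left)

lemma scale_one_power: "smul c 1 ^ n = smul (c ^ n) 1"
  by (induction n) (simp_all add: scale_one_mult)

lemma zero_if_norm_add_scalar:
  assumes R: "R \<ge> 0" and d: "\<And>l. cmod l = R \<Longrightarrow> norm (d + smul l 1) \<le> R"
  shows "d = 0"
proof (cases "R = 0")
  case True
  then show ?thesis using d[of 0] by simp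
next
  case False
  have "real n * norm d \<le> R" if n: "n \<ge> 1" for n
  proof -
    \<comment> \<open>The coefficient with index \<open>n - 1\<close> is the one linear in
      \<open>d\<close>; it equals \<open>n d\<close>.\<close>
    have "norm (of_nat (n choose (n - 1)) * d ^ (n - (n - 1))) * R ^ (n - 1) \<le> R ^ n"
    proof (rule cauchy_estimate[where n = n and v = "\<lambda>k. of_nat (n choose k) * d ^ (n - k)"])
      fix t assume t: "cmod t = R"
      have "(\<Sum>m\<le>n. smul (t ^ m) (of_nat (n choose m) * d ^ (n - m))) = (smul t 1 + d) ^ n"
        unfolding binomial_ring scale_one_power
        by (intro sum.cong refl) (metis mult.assoc mult.commute scale_one_mult)
      also have "norm \<dots> \<le> norm (smul t 1 + d) ^ n" by (rule norm_power_ineq)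
      also have "\<dots> \<le> R ^ n" using d[OF t] by (intro power_mono) (simp_all add: add.commute)
      finally show "norm (\<Sum>m\<le>n. smul (t ^ m) (of_nat (n choose m) * d ^ (n - m))) \<le> R ^ n" .
    qed (use R in auto)
    moreover have "n choose (n - 1) = n" "n - (n - 1) = 1" using n binomial_symmetric[of "n - 1" n] by auto
    moreover have "of_nat n * d = of_nat n *\<^sub>R d" by (simp add: scaleR_conv_of_real)
    ultimately have "(real n * norm d) * R ^ (n - 1) \<le> R * R ^ (n - 1)"
      using n by (simp add: power_eq_if)
    then show ?thesis using R False by simp
  qed
  then have "real n * norm d \<le> R" for n by (cases "n = 0") (use R in auto)
  then have "norm d \<le> 0" by (meson not_less reals_Archimedean3)
  then show ?thesis by simp
qed

end

section \<open>Directions in which a clopen quadratic subset is translation invariant\<close>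

context clopen_quadratic_subset
begin

definition shifts :: "'a set" where
  "shifts = {u. \<forall>h\<in>S. \<forall>c. h + smul c u \<in> S}"

text \<open>For \<open>c \<noteq> 0\<close> write \<open>h + c u\<close> as
  \<open>c (h / c + u)\<close>; invariance of \<open>S\<close> under complex scalars reduces every
  translation to the one by \<open>u\<close> itself.\<close>

lemma shiftsI_real:
  assumes "\<And>h r. h \<in> S \<Longrightarrow> h + r *\<^sub>R u \<in> S"
  shows "u \<in> shifts"
  unfolding shifts_def
proof (intro CollectI ballI allI)
  fix h c assume h: "h \<in> S"
  show "h + smul c u \<in> S"
  proof (cases "c = 0")
    case False
    have "smul c (smul (1 / c) h + 1 *\<^sub>R u) \<in> S"
      using assms[of _ 1] scale_closed h False by simp
    then show ?thesis using False by (simp add: scale_right_distrib)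
  qed (use h in simp)
qed

text \<open>The bijections \<open>U h\<close> with \<open>h \<in> S\<close> map \<open>S\<close>
  onto itself and hence preserve its shifts. Multiplication by an arbitrary \<open>m\<close> is
  recovered from \<open>U (e + t m) - U (e - t m) = 4 t (L m)\<close>, with \<open>t\<close> so
  small that \<open>e + t m\<close> and \<open>e - t m\<close> lie in \<open>S\<close>.\<close>

lemma shifts_quasi_invertible_ideal: "quasi_invertible_ideal smul jp e shifts"
proof -
  have sub: "subspace shifts"
  proof (rule subspaceI)
    show "0 \<in> shifts" by (simp add: shifts_def)
    show "x + y \<in> shifts" if "x \<in> shifts" "y \<in> shifts" for x y
      using that by (simp add: shifts_def scale_right_distrib flip: add.assoc)
    show "smul c x \<in> shifts" if "x \<in> shifts" for c x
      using that by (simp add: shifts_def)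
  qed
  have scaleR: "r *\<^sub>R x \<in> shifts" if "x \<in> shifts" for r x
    using subspace_scale[OF sub that, of "of_real r"] by (simp add: scale_of_real)
  have U: "jordan_U jp h u \<in> shifts" if h: "h \<in> S" and u: "u \<in> shifts" for h u
    unfolding shifts_def
  proof (intro CollectI ballI allI)
    fix k c assume k: "k \<in> S"
    obtain b where b: "b \<in> S" "is_jordan_inverse jp e h b" using h by (rule inverse_exists)
    have "jordan_U jp h (jordan_U jp b k + smul c u) \<in> S"
      using U_closed[OF b(1) k] u h U_closed by (auto simp: shifts_def)
    moreover have "jordan_U jp h (smul c u) = smul c (jordan_U jp h u)"
      by (simp add: jordan_U_alt jp_scale_right scale_right_distrib scale_right_diff_distrib)
    ultimately show "k + smul c (jordan_U jp h u) \<in> S"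
      by (simp add: jordan_U_linear jordan_U_inverse[OF b(2)])
  qed
  have mult: "jp m u \<in> shifts" if u: "u \<in> shifts" for m u
  proof -
    obtain d where d: "d > 0" "ball e d \<subseteq> S" using open_S unit_mem by (meson open_contains_ball)
    define t where "t = d / (norm m + 1)"
    have t: "t > 0" using d(1) by (simp add: t_def add_nonneg_pos)
    have "norm (t *\<^sub>R m) < d"
      using d(1) by (simp add: t_def divide_less_eq add_nonneg_pos)
    then have "e + t *\<^sub>R m \<in> S" "e - t *\<^sub>R m \<in> S" using d(2) by (auto simp: subset_iff dist_norm)
    then have "jordan_U jp (e + t *\<^sub>R m) u - jordan_U jp (e - t *\<^sub>R m) u \<in> shifts"
      using U u subspace_diff[OF sub] by blast
    moreover have "jordan_U jp (e + t *\<^sub>R m) u - jordan_U jp (e - t *\<^sub>R m) u = (4 * t) *\<^sub>R jp m u"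
    proof -
      have "jordan_U jp (e + t *\<^sub>R m) u - jordan_U jp (e - t *\<^sub>R m) u =
          t *\<^sub>R jp m u + t *\<^sub>R jp m u + t *\<^sub>R jp m u + t *\<^sub>R jp m u"
        by (simp add: jordan_U_alt jp_simps jp_unit jp_unit_right algebra_simps)
      also have "\<dots> = (4 * t) *\<^sub>R jp m u" by (simp flip: scaleR_add_left)
      finally show ?thesis .
    qed
    ultimately have "(1 / (4 * t)) *\<^sub>R (4 * t) *\<^sub>R jp m u \<in> shifts" using scaleR by metis
    then show ?thesis using t by simp
  qed
  have mult': "jp u m \<in> shifts" if "u \<in> shifts" for m u
    using mult[OF that, of m] by (simp add: jp_commute)
  have "jordan_ideal smul jp shifts"
    unfolding jordan_ideal_def jordan_U_alt using sub mult mult'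
    by (auto intro!: subspace_add[OF sub] subspace_diff[OF sub])
  moreover have "quasi_invertible jp e a" if "a \<in> shifts" for a
  proof -
    have "e + smul (- 1) a \<in> S" using that unit_mem unfolding shifts_def by blast
    then show ?thesis using subset_invertibles by (auto simp: quasi_invertible_def)
  qed
  ultimately show ?thesis by (simp add: quasi_invertible_ideal_def)
qed

lemma shifts_trivial: "jordan_semisimple smul jp e \<Longrightarrow> u \<in> shifts \<Longrightarrow> u = 0"
  using shifts_quasi_invertible_ideal
  by (auto simp: jordan_semisimple_def is_mccrimmon_radical_def)

end

locale surjective_isometry =
  CA: unital_commutative_banach_algebra scaleA +
  A: clopen_quadratic_subset scaleA "(*)" 1 SA +
  N: clopen_quadratic_subset scaleN jpN eN SN
  for scaleA :: "complex \<Rightarrow> 'a::{real_normed_algebra_1,comm_ring_1,banach} \<Rightarrow> 'a" and SA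
    and scaleN :: "complex \<Rightarrow> 'b::banach \<Rightarrow> 'b" and jpN eN SN +
  fixes \<Delta> :: "'a \<Rightarrow> 'b"
  assumes surj: "\<Delta> ` SA = SN" and iso: "isometric_on SA \<Delta>"
    and semisimple: "jordan_semisimple scaleN jpN eN"
begin

lemma affine:
  "\<exists>T u. linear T \<and> (\<forall>x. norm (T x) = norm x) \<and> range T = UNIV \<and> (\<forall>a\<in>SA. \<Delta> a = T a + u)"
proof -
  obtain D d where D: "open D" "connected D" "D \<subseteq> SA" "1 \<in> D" "d > 0"
    "\<And>a l. norm a < cmod l * d \<Longrightarrow> a + scaleA l 1 \<in> D"
    using A.open_connected_cone by blast
  have "open (\<Delta> ` SA)" using N.open_S surj by simp
  then obtain T where T: "linear T" "\<And>v. norm (T v) = norm v" "\<And>y. y \<in> D \<Longrightarrow> \<Delta> y = \<Delta> 1 + T (y - 1)"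
    using isometry_affine_on_connected[OF iso A.open_S _ D(2,1,3,4)] by blast
  define u where "u = \<Delta> 1 - T 1"
  have TD: "\<Delta> y = T y + u" if "y \<in> D" for y
    using T(3)[OF that] by (simp add: u_def linear_diff[OF T(1)])
  \<comment> \<open>A small multiple of \<open>h\<close> added to \<open>\<Delta> 1\<close> stays in
    the open set \<open>SN\<close>, so it is attained by \<open>\<Delta>\<close>; the isometry
    places the preimage near 1, inside \<open>D\<close>, where \<open>\<Delta>\<close> is given by
    \<open>T\<close>.\<close>
  have "h \<in> range T" for h
  proof -
    obtain r1 where r1: "r1 > 0" "ball 1 r1 \<subseteq> D" using D(1,4) by (meson open_contains_ball)
    obtain r2 where r2: "r2 > 0" "ball (\<Delta> 1) r2 \<subseteq> SN"
      using N.open_S A.unit_mem surj by (metis imageI open_contains_ball)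
    obtain m where m: "m > 0" "m \<le> r1" "m \<le> r2" using r1(1) r2(1) by (metis linorder_linear)
    define t where "t = m / (norm h + 1)"
    have t: "t > 0" using m by (simp add: t_def add_nonneg_pos)
    have "norm (t *\<^sub>R h) < m"
      using m(1) by (simp add: t_def pos_divide_less_eq add_nonneg_pos)
    then have th: "norm (t *\<^sub>R h) < r1" "norm (t *\<^sub>R h) < r2" using m by simp_all
    then have "\<Delta> 1 + t *\<^sub>R h \<in> SN" using r2(2) by (auto simp: subset_iff dist_norm)
    then obtain g where g: "g \<in> SA" "\<Delta> g = \<Delta> 1 + t *\<^sub>R h" using surj by (metis imageE)
    then have "dist g 1 = norm (t *\<^sub>R h)"
      using iso A.unit_mem unfolding isometric_on_def by (metis add_diff_cancel_left' dist_norm)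
    then have "g \<in> D" using th r1(2) by (auto simp: subset_iff dist_commute)
    then have "T (g - 1) = t *\<^sub>R h" using T(3)[of g] g by simp
    then have "T ((1 / t) *\<^sub>R (g - 1)) = h" using t by (simp add: linear_scale[OF T(1)])
    then show ?thesis by blast
  qed
  then have ran: "range T = UNIV" by blast
  have "\<Delta> a = T a + u" if a: "a \<in> SA" for a
  proof -
    obtain x where x: "T x = \<Delta> a - u" using ran by (metis surjD)
    \<comment> \<open>For \<open>cmod l = R\<close> this gives \<open>norm a < cmod l * d\<close>,
      the condition for \<open>a - l\<close> to lie in the cone \<open>D\<close>.\<close>
    define R where "R = (norm a + 1) / d"
    have R: "R \<ge> 0" using D(5) by (simp add: R_def)
    have "x - a = 0"
    proof (rule CA.zero_if_norm_add_scalar[OF R])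
      fix l assume l: "cmod l = R"
      have "a + scaleA (- l) 1 \<in> D" using D(5) l by (intro D(6)) (simp add: R_def)
      moreover from this have "a + scaleA (- l) 1 \<in> SA" using D(3) by blast
      ultimately have "norm (\<Delta> a - (T (a + scaleA (- l) 1) + u)) = norm (scaleA l 1)"
        using iso a TD unfolding isometric_on_def
        by (metis (no_types, lifting) CA.scale_minus_left add.commute diff_add_cancel diff_minus_eq_add dist_norm uminus_add_conv_diff add_diff_cancel_left')
      moreover have "\<Delta> a - (T (a + scaleA (- l) 1) + u) = T (x - a + scaleA l 1)"
        using x by (simp add: linear_add[OF T(1)] linear_diff[OF T(1)] linear_neg[OF T(1)] algebra_simps)
      ultimately show "norm (x - a + scaleA l 1) \<le> R"
        using T(2) l by (simp add: CA.norm_scale)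
    qed
    then show ?thesis using x by simp
  qed
  then show ?thesis using T ran by blast
qed

text \<open>Rescaling separates the constant from the linear part: going from \<open>a\<close> to
  \<open>r a\<close>, applying \<open>\<Delta>\<close> and multiplying by \<open>1 / r\<close> turns
  \<open>T a + u\<close> into \<open>T a + (1 / r) u\<close>, which again lies in
  \<open>SN\<close>.\<close>

lemma linear_extension:
  "\<exists>T. linear T \<and> (\<forall>x. norm (T x) = norm x) \<and> range T = UNIV \<and> (\<forall>a\<in>SA. \<Delta> a = T a)"
proof -
  obtain T u where T: "linear T" "\<And>x. norm (T x) = norm x" "range T = UNIV" "\<And>a. a \<in> SA \<Longrightarrow> \<Delta> a = T a + u"
    using affine by blast
  \<comment> \<open>Here \<open>1 / r = 1 + s\<close>, so the value \<open>s = - 1\<close> is out of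
    reach; it is obtained afterwards by two translations with \<open>- 1 / 2\<close>.\<close>
  have step: "h + s *\<^sub>R u \<in> SN" if h: "h \<in> SN" and s: "s \<noteq> - 1" for h s
  proof -
    obtain a where a: "a \<in> SA" "h = T a + u" using h surj T(4) by (metis imageE)
    define r where "r = 1 / (1 + s)"
    have r: "r \<noteq> 0" "1 / r = 1 + s" using s by (auto simp: r_def)
    have "r *\<^sub>R a \<in> SA" using A.scale_closed[OF a(1), of "of_real r"] r by (simp add: CA.scale_of_real)
    then have "r *\<^sub>R T a + u \<in> SN" using surj T(4) by (metis imageI linear_scale[OF T(1)])
    then have "(1 / r) *\<^sub>R (r *\<^sub>R T a + u) \<in> SN"
      unfolding N.scale_of_real[symmetric]
      by (rule N.scale_closed) (subst of_real_eq_0_iff, use r(1) in simp)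
    moreover have "(1 / r) *\<^sub>R (r *\<^sub>R T a + u) = T a + (1 / r) *\<^sub>R u"
      using r(1) by (simp add: scaleR_add_right)
    ultimately have "T a + (1 / r) *\<^sub>R u \<in> SN" by (simp only:)
    then show ?thesis unfolding r(2) by (simp add: a(2) scaleR_add_left add.assoc)
  qed
  have "u \<in> N.shifts"
  proof (rule N.shiftsI_real)
    fix h r assume h: "h \<in> SN"
    show "h + r *\<^sub>R u \<in> SN"
    proof (cases "r = - 1")
      case True
      have "(h + (- 1 / 2) *\<^sub>R u) + (- 1 / 2) *\<^sub>R u \<in> SN" by (intro step h) auto
      moreover have "(h + (- 1 / 2) *\<^sub>R u) + (- 1 / 2) *\<^sub>R u = h + r *\<^sub>R u"
        unfolding True add.assoc scaleR_add_left[symmetric] by simp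
      ultimately show ?thesis by (simp only:)
    qed (use step h in auto)
  qed
  then have "u = 0" using N.shifts_trivial semisimple by blast
  then show ?thesis using T by auto
qed

end

section \<open>Characters of semisimple commutative Banach algebras\<close>

lemma le_add_if_le_approx:
  fixes a b c :: real
  assumes "\<And>r s. a < r \<Longrightarrow> b < s \<Longrightarrow> c \<le> r + s"
  shows "c \<le> a + b"
proof (rule field_le_epsilon)
  fix d :: real assume "d > 0"
  then show "c \<le> a + b + d" using assms[of "a + d / 2" "b + d / 2"] by simp
qed

lemma le_mult_if_le_approx:
  fixes a b c :: real
  assumes le: "\<And>r s. a < r \<Longrightarrow> b < s \<Longrightarrow> c \<le> r * s"
  shows "c \<le> a * b"
proof (rule tendsto_lowerbound)
  show "((\<lambda>d. (a + d) * (b + d)) \<longlongrightarrow> a * b) (at_right 0)" by (auto intro!: tendsto_eq_intros)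
  show "\<forall>\<^sub>F d in at_right 0. c \<le> (a + d) * (b + d)"
    using le by (auto simp: eventually_at_right_field intro!: exI[of _ 1])
qed simp

text \<open>Complex homogeneity is left to be derived: the bound by the norm controls
  \<open>q\<close> on scalars, and submultiplicativity applied to a scalar and to its inverse gives
  both inequalities.\<close>

definition algebra_seminorm :: "('a::real_normed_algebra_1 \<Rightarrow> real) \<Rightarrow> bool" where
  "algebra_seminorm q \<longleftrightarrow> q 1 = 1 \<and> (\<forall>x. 0 \<le> q x) \<and> (\<forall>x. q x \<le> norm x) \<and>
     (\<forall>x y. q (x + y) \<le> q x + q y) \<and> (\<forall>x y. q (x * y) \<le> q x * q y)"

lemma algebra_seminormD:
  assumes "algebra_seminorm q"
  shows "q 1 = 1" "0 \<le> q x" "q x \<le> norm x" "q (x + y) \<le> q x + q y" "q (x * y) \<le> q x * q y"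
  using assms by (auto simp: algebra_seminorm_def)

lemma algebra_seminorm_norm: "algebra_seminorm norm"
  by (simp add: algebra_seminorm_def norm_triangle_ineq norm_mult_ineq)

lemma algebra_seminorm_power_le:
  assumes "algebra_seminorm q"
  shows "q (x ^ n) \<le> q x ^ n"
proof (induction n)
  case (Suc n)
  have "q (x * x ^ n) \<le> q x * q (x ^ n)" by (rule algebra_seminormD[OF assms])
  also have "\<dots> \<le> q x * q x ^ n" using Suc by (intro mult_left_mono algebra_seminormD[OF assms])
  finally show ?case by simp
qed (simp add: algebra_seminormD[OF assms])

lemma algebra_seminorm_sum_le:
  assumes "algebra_seminorm q"
  shows "q (sum f A) \<le> (\<Sum>i\<in>A. q (f i))"
proof (induction A rule: infinite_finite_induct)
  case (insert i A)
  then show ?case using algebra_seminormD(4)[OF assms, of "f i" "sum f A"] by simp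
qed (use algebra_seminormD(3)[OF assms, of 0] in simp_all)

text \<open>Equality holds at exponents that are powers of two. Splitting \<open>x ^ (2 ^ n)\<close>
  into \<open>x ^ n\<close> and \<open>x ^ (2 ^ n - n)\<close> leaves no room for strict inequality
  at \<open>n\<close>.\<close>

lemma algebra_seminorm_power_eq:
  assumes q: "algebra_seminorm q" and sq: "\<And>x. q (x * x) = q x * q x"
  shows "q (x ^ n) = q x ^ n"
proof (cases "q x = 0")
  case True
  then show ?thesis
    using algebra_seminorm_power_le[OF q, of x n] algebra_seminormD(1,2)[OF q] by (cases n) (auto intro: antisym)
next
  case False
  then have pos: "q x > 0" using algebra_seminormD(2)[OF q, of x] by simp
  have "q (x ^ (2 ^ k)) = q x ^ (2 ^ k)" for k
    by (induction k) (simp_all add: mult_2 power_add sq)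
  then have "q x ^ (2 ^ n) = q (x ^ n * x ^ (2 ^ n - n))" by (simp flip: power_add)
  also have "\<dots> \<le> q (x ^ n) * q x ^ (2 ^ n - n)"
    by (intro order_trans[OF algebra_seminormD(5)[OF q]] mult_left_mono algebra_seminorm_power_le[OF q]
        algebra_seminormD[OF q])
  finally have "q x ^ n * q x ^ (2 ^ n - n) \<le> q (x ^ n) * q x ^ (2 ^ n - n)"
    by (simp flip: power_add)
  then have "q x ^ n \<le> q (x ^ n)" using pos by simp
  then show ?thesis using algebra_seminorm_power_le[OF q, of x n] by simp
qed

text \<open>The infimum of these rates is the usual spectral radius, the limit of the n-th roots of
  \<open>q (x ^ n)\<close>. Working with rates replaces roots and limits by inequalities between
  powers.\<close>

definition growth_rates :: "('a::real_normed_algebra_1 \<Rightarrow> real) \<Rightarrow> 'a \<Rightarrow> real set" where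
  "growth_rates q x = {r. 0 < r \<and> (\<exists>C. \<forall>n. q (x ^ n) \<le> C * r ^ n)}"

definition spectral_radius :: "('a::real_normed_algebra_1 \<Rightarrow> real) \<Rightarrow> 'a \<Rightarrow> real" where
  "spectral_radius q x = Inf (growth_rates q x)"

lemma spectral_radius_le: "r \<in> growth_rates q x \<Longrightarrow> spectral_radius q x \<le> r"
  unfolding spectral_radius_def
  by (rule cInf_lower) (auto simp: growth_rates_def intro!: bdd_belowI[of _ 0])

lemma growth_rates_above_seminorm:
  assumes "algebra_seminorm q" "q x < r"
  shows "r \<in> growth_rates q x"
proof -
  have "q (x ^ n) \<le> 1 * r ^ n" for n
    using order_trans[OF algebra_seminorm_power_le[OF assms(1)] power_mono] assms algebra_seminormD(2) by fastforce
  moreover have "r > 0" using assms algebra_seminormD(2) order_le_less_trans by blast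
  ultimately show ?thesis unfolding growth_rates_def by blast
qed

lemma growth_rateE:
  assumes "r \<in> growth_rates q x" and q: "algebra_seminorm q"
  obtains C where "C > 0" "\<And>n. q (x ^ n) \<le> C * r ^ n"
proof -
  obtain C where C: "\<And>n. q (x ^ n) \<le> C * r ^ n" using assms(1) by (auto simp: growth_rates_def)
  moreover have "C > 0" using C[of 0] algebra_seminormD(1)[OF q] by simp
  ultimately show ?thesis using that by blast
qed

lemma growth_rates_above_spectral_radius:
  assumes q: "algebra_seminorm q" and r: "spectral_radius q x < r"
  shows "r \<in> growth_rates q x"
proof -
  have "growth_rates q x \<noteq> {}" using growth_rates_above_seminorm[OF q] gt_ex by blast
  then obtain s where s: "s \<in> growth_rates q x" "s < r"
    using r cInf_lessD unfolding spectral_radius_def by blast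
  then obtain C where C: "C > 0" "\<And>n. q (x ^ n) \<le> C * s ^ n" using growth_rateE q by blast
  have s0: "s > 0" using s(1) by (simp add: growth_rates_def)
  have "q (x ^ n) \<le> C * r ^ n" for n
    by (rule order_trans[OF C(2)]) (use s s0 C(1) in \<open>intro mult_left_mono power_mono; simp\<close>)
  moreover have "r > 0" using s(2) s0 by simp
  ultimately show ?thesis by (auto simp: growth_rates_def)
qed

lemma spectral_radius_greatest:
  assumes "algebra_seminorm q" and "\<And>r. r \<in> growth_rates q x \<Longrightarrow> c \<le> r"
  shows "c \<le> spectral_radius q x"
  by (rule dense_ge) (use assms growth_rates_above_spectral_radius in blast)

lemma spectral_radius_nonneg: "algebra_seminorm q \<Longrightarrow> 0 \<le> spectral_radius q x"
  by (rule spectral_radius_greatest) (auto simp: growth_rates_def)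

lemma spectral_radius_le_seminorm:
  assumes "algebra_seminorm q"
  shows "spectral_radius q x \<le> q x"
  by (rule dense_ge) (use assms growth_rates_above_seminorm spectral_radius_le in blast)

text \<open>Rates \<open>r\<close> of \<open>x\<close> and \<open>s\<close> of \<open>y\<close>
  yield the rate \<open>r + s\<close> of \<open>x + y\<close> by the binomial theorem and
  \<open>r * s\<close> of \<open>x * y\<close> by distributing powers; both steps rest on
  commutativity.\<close>

lemma algebra_seminorm_spectral_radius:
  fixes q :: "'a::{real_normed_algebra_1,comm_ring_1} \<Rightarrow> real"
  assumes q: "algebra_seminorm q"
  shows "algebra_seminorm (spectral_radius q)"
proof -
  note qD = algebra_seminormD[OF q]
  have one: "1 \<le> spectral_radius q 1"
  proof (rule spectral_radius_greatest[OF q])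
    fix r assume r: "r \<in> growth_rates q 1"
    then obtain C where C: "C > 0" "\<And>n. q (1 ^ n) \<le> C * r ^ n" using growth_rateE q by blast
    have r0: "r > 0" using r by (simp add: growth_rates_def)
    show "1 \<le> r"
    proof (rule ccontr)
      assume "\<not> 1 \<le> r"
      then obtain n where "r ^ n < 1 / C" using real_arch_pow_inv[of "1 / C" r] C(1) by auto
      then show False using C(2)[of n] C(1) qD(1) by (simp add: field_simps)
    qed
  qed
  have add: "spectral_radius q (x + y) \<le> spectral_radius q x + spectral_radius q y" for x y
  proof (rule le_add_if_le_approx)
    fix r s assume "spectral_radius q x < r" "spectral_radius q y < s"
    then have rs: "r \<in> growth_rates q x" "s \<in> growth_rates q y"
      using growth_rates_above_spectral_radius q by auto
    then have pos: "r > 0" "s > 0" by (auto simp: growth_rates_def)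
    obtain C D where C: "C > 0" "\<And>n. q (x ^ n) \<le> C * r ^ n" and D: "D > 0" "\<And>n. q (y ^ n) \<le> D * s ^ n"
      using rs growth_rateE q by metis
    have "q ((x + y) ^ n) \<le> (C * D) * (r + s) ^ n" for n
    proof -
      have "q ((x + y) ^ n) \<le> (\<Sum>k\<le>n. q (of_nat (n choose k) * x ^ k * y ^ (n - k)))"
        unfolding binomial_ring by (rule algebra_seminorm_sum_le[OF q])
      also have "\<dots> \<le> (\<Sum>k\<le>n. of_nat (n choose k) * (C * r ^ k) * (D * s ^ (n - k)))"
      proof (rule sum_mono)
        fix k
        have "q (of_nat (n choose k) * x ^ k * y ^ (n - k)) \<le> q (of_nat (n choose k)) * q (x ^ k) * q (y ^ (n - k))"
          by (intro order_trans[OF qD(5)] mult_right_mono qD)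
        also have "\<dots> \<le> of_nat (n choose k) * (C * r ^ k) * (D * s ^ (n - k))"
          using qD(3)[of "of_nat (n choose k)"] C D pos
          by (intro mult_mono qD mult_nonneg_nonneg) (simp_all add: less_imp_le)
        finally show "q (of_nat (n choose k) * x ^ k * y ^ (n - k)) \<le> \<dots>" .
      qed
      also have "\<dots> = (C * D) * (r + s) ^ n"
        by (simp add: binomial_ring sum_distrib_left mult_ac)
      finally show ?thesis .
    qed
    then show "spectral_radius q (x + y) \<le> r + s"
      using pos by (intro spectral_radius_le) (auto simp: growth_rates_def)
  qed
  have mult: "spectral_radius q (x * y) \<le> spectral_radius q x * spectral_radius q y" for x y
  proof (rule le_mult_if_le_approx)
    fix r s assume "spectral_radius q x < r" "spectral_radius q y < s"
    then have rs: "r \<in> growth_rates q x" "s \<in> growth_rates q y"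
      using growth_rates_above_spectral_radius q by auto
    then have pos: "r > 0" "s > 0" by (auto simp: growth_rates_def)
    obtain C D where C: "C > 0" "\<And>n. q (x ^ n) \<le> C * r ^ n" and D: "D > 0" "\<And>n. q (y ^ n) \<le> D * s ^ n"
      using rs growth_rateE q by metis
    have "q ((x * y) ^ n) \<le> (C * D) * (r * s) ^ n" for n
    proof -
      have "q ((x * y) ^ n) \<le> q (x ^ n) * q (y ^ n)" unfolding power_mult_distrib by (rule qD)
      also have "\<dots> \<le> (C * r ^ n) * (D * s ^ n)" using C D pos by (intro mult_mono qD) auto
      finally show ?thesis by (simp add: power_mult_distrib mult_ac)
    qed
    then show "spectral_radius q (x * y) \<le> r * s"
      using pos by (intro spectral_radius_le) (auto simp: growth_rates_def)
  qed
  show ?thesis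
    unfolding algebra_seminorm_def
    using one add mult spectral_radius_nonneg[OF q] spectral_radius_le_seminorm[OF q] qD(1,3)
    by (metis order_antisym order_trans)
qed

lemma spectral_radius_square:
  fixes q :: "'a::{real_normed_algebra_1,comm_ring_1} \<Rightarrow> real"
  assumes q: "algebra_seminorm q"
  shows "spectral_radius q (x * x) = spectral_radius q x * spectral_radius q x"
proof (rule antisym)
  show "spectral_radius q (x * x) \<le> spectral_radius q x * spectral_radius q x"
    by (rule algebra_seminormD(5)[OF algebra_seminorm_spectral_radius[OF q]])
  show "spectral_radius q x * spectral_radius q x \<le> spectral_radius q (x * x)"
  proof (rule spectral_radius_greatest[OF q])
    fix r assume r: "r \<in> growth_rates q (x * x)"
    then obtain C where C: "C > 0" "\<And>n. q ((x * x) ^ n) \<le> C * r ^ n" using growth_rateE q by blast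
    define s where "s = sqrt r"
    have s: "s > 0" "r = s * s" using r by (auto simp: s_def growth_rates_def)
    \<comment> \<open>An odd power of \<open>x\<close> is \<open>x\<close> times a power of
      \<open>x * x\<close>; the factor \<open>q x / s\<close> pays for the extra \<open>x\<close>,
      and the 1 covers even powers.\<close>
    define D where "D = C * max 1 (q x / s)"
    have "q (x ^ n) \<le> D * s ^ n" for n
    proof (cases "even n")
      case True
      then obtain k where k: "n = 2 * k" by blast
      have "q (x ^ n) \<le> C * s ^ n" using C(2)[of k] by (simp add: k s(2) power_mult_distrib mult_2 power_add)
      also have "\<dots> \<le> D * s ^ n" using C(1) s(1) by (intro mult_right_mono) (auto simp: D_def)
      finally show ?thesis .
    next
      case False
      then obtain k where k: "n = 2 * k + 1" by (rule oddE)
      have "q (x ^ n) \<le> q x * q ((x * x) ^ k)"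
        using algebra_seminormD(5)[OF q, of x "(x * x) ^ k"] by (simp add: k power_mult_distrib mult_2 power_add)
      also have "\<dots> \<le> q x * (C * r ^ k)" by (intro mult_left_mono C algebra_seminormD[OF q])
      also have "\<dots> = C * (q x / s) * s ^ n"
        using s(1) by (simp add: k s(2) power_mult_distrib mult_2 power_add)
      also have "\<dots> \<le> D * s ^ n"
        unfolding D_def using C(1) s(1) by (intro mult_right_mono mult_left_mono) auto
      finally show ?thesis .
    qed
    then have "spectral_radius q x \<le> s" using s(1) by (intro spectral_radius_le) (auto simp: growth_rates_def)
    then show "spectral_radius q x * spectral_radius q x \<le> r"
      unfolding s(2) using spectral_radius_nonneg[OF q] s(1) by (intro mult_mono) auto
  qed
qed

text \<open>The quotients decrease in \<open>n\<close> by submultiplicativity, so the limit exists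
  and lies below \<open>q\<close>. Multiplying \<open>x\<close> by \<open>a\<close> merely shifts
  the sequence, which makes multiplication by \<open>a\<close> an exact dilation by
  \<open>q a\<close>.\<close>

definition localised_seminorm :: "('a::real_normed_algebra_1 \<Rightarrow> real) \<Rightarrow> 'a \<Rightarrow> 'a \<Rightarrow> real" where
  "localised_seminorm q a x = lim (\<lambda>n. q (a ^ n * x) / q a ^ n)"

context
  fixes q :: "'a::{real_normed_algebra_1,comm_ring_1} \<Rightarrow> real" and a :: 'a
  assumes q: "algebra_seminorm q" and a: "q a > 0" and pow: "\<And>n. q (a ^ n) = q a ^ n"
begin

lemma localised_seminorm_lim:
  "(\<lambda>n. q (a ^ n * x) / q a ^ n) \<longlonglongrightarrow> localised_seminorm q a x"
  and localised_seminorm_le: "localised_seminorm q a x \<le> q (a ^ n * x) / q a ^ n"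
proof -
  let ?f = "\<lambda>n. q (a ^ n * x) / q a ^ n"
  have "?f (Suc n) \<le> ?f n" for n
    using algebra_seminormD(5)[OF q, of a "a ^ n * x"] a by (simp add: field_simps)
  then have dec: "decseq ?f" by (rule decseq_SucI)
  have "convergent ?f"
    using dec by (rule decseq_convergent[of _ 0, THEN exE]) (use a algebra_seminormD(2)[OF q] in \<open>auto simp: convergent_def\<close>)
  then show lim: "?f \<longlonglongrightarrow> localised_seminorm q a x"
    unfolding localised_seminorm_def by (simp add: convergent_LIMSEQ_iff)
  show "localised_seminorm q a x \<le> ?f n" using dec lim by (rule decseq_ge)
qed

lemma localised_seminorm_le_seminorm: "localised_seminorm q a x \<le> q x"
  using localised_seminorm_le[of x 0] by simp

lemma localised_seminorm_mult: "localised_seminorm q a (a * x) = q a * localised_seminorm q a x"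
proof (rule LIMSEQ_unique[OF localised_seminorm_lim])
  have "(\<lambda>n. q a * (q (a ^ Suc n * x) / q a ^ Suc n)) \<longlonglongrightarrow> q a * localised_seminorm q a x"
    by (intro tendsto_mult tendsto_const LIMSEQ_Suc localised_seminorm_lim)
  then show "(\<lambda>n. q (a ^ n * (a * x)) / q a ^ n) \<longlonglongrightarrow> q a * localised_seminorm q a x"
    using a by (simp add: mult_ac)
qed

lemma algebra_seminorm_localised: "algebra_seminorm (localised_seminorm q a)"
proof -
  note qD = algebra_seminormD[OF q]
  have "localised_seminorm q a 1 = 1"
    by (rule LIMSEQ_unique[OF localised_seminorm_lim]) (use a in \<open>simp add: pow\<close>)
  moreover have "0 \<le> localised_seminorm q a x" for x
    by (rule LIMSEQ_le_const[OF localised_seminorm_lim]) (use a qD(2) in auto)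
  moreover have "localised_seminorm q a (x + y) \<le> localised_seminorm q a x + localised_seminorm q a y" for x y
  proof (rule LIMSEQ_le[OF localised_seminorm_lim tendsto_add[OF localised_seminorm_lim localised_seminorm_lim]])
    show "\<exists>N. \<forall>n\<ge>N. q (a ^ n * (x + y)) / q a ^ n \<le> q (a ^ n * x) / q a ^ n + q (a ^ n * y) / q a ^ n"
      using qD(4) a by (auto simp: distrib_left intro!: divide_right_mono simp flip: add_divide_distrib)
  qed
  moreover have "localised_seminorm q a (x * y) \<le> localised_seminorm q a x * localised_seminorm q a y" for x y
  proof (rule LIMSEQ_le_const[OF tendsto_mult[OF localised_seminorm_lim localised_seminorm_lim]], intro exI allI impI)
    fix n
    have "localised_seminorm q a (x * y) \<le> q ((a ^ n * x) * (a ^ n * y)) / q a ^ (n + n)"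
      using localised_seminorm_le[of "x * y" "n + n"] by (simp add: power_add mult_ac)
    also have "\<dots> \<le> (q (a ^ n * x) * q (a ^ n * y)) / q a ^ (n + n)"
      using a by (intro divide_right_mono qD) auto
    finally show "localised_seminorm q a (x * y) \<le> q (a ^ n * x) / q a ^ n * (q (a ^ n * y) / q a ^ n)"
      by (simp add: power_add)
  qed
  ultimately show ?thesis
    unfolding algebra_seminorm_def using localised_seminorm_le_seminorm qD(3) order_trans by blast
qed

lemma localised_seminorm_scaled:
  assumes "\<And>x. q (u * x) = s * q x"
  shows "localised_seminorm q a (u * x) = s * localised_seminorm q a x"
proof (rule LIMSEQ_unique[OF localised_seminorm_lim])
  have "(\<lambda>n. s * (q (a ^ n * x) / q a ^ n)) \<longlonglongrightarrow> s * localised_seminorm q a x"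
    by (intro tendsto_mult tendsto_const localised_seminorm_lim)
  moreover have "q (a ^ n * (u * x)) = s * q (a ^ n * x)" for n
    using assms[of "a ^ n * x"] by (simp add: mult_ac)
  ultimately show "(\<lambda>n. q (a ^ n * (u * x)) / q a ^ n) \<longlonglongrightarrow> s * localised_seminorm q a x" by simp
qed

end

text \<open>
  A minimal seminorm with \<open>q (u x) = s q x\<close> is multiplicative because passing to the spectral
  radius and localising both stay in this class and do not increase \<open>q\<close>. The side
  condition forces \<open>q u = s\<close>, so that the resulting character does not vanish at \<open>u\<close>.
\<close>

lemma exists_minimal_scaled_seminorm:
  fixes p :: "'a::real_normed_algebra_1 \<Rightarrow> real"
  assumes s: "s > 0" and p: "algebra_seminorm p" "\<And>x. p (u * x) = s * p x"
  obtains q where "algebra_seminorm q" "\<And>x. q (u * x) = s * q x"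
    "\<And>q'. algebra_seminorm q' \<Longrightarrow> (\<And>x. q' (u * x) = s * q' x) \<Longrightarrow> (\<And>x. q' x \<le> q x) \<Longrightarrow> q' = q"
proof -
  define F where "F = {q. algebra_seminorm q \<and> (\<forall>x. q (u * x) = s * q x)}"
  \<comment> \<open>The order is reversed, so that the maximal element of Zorn's lemma is a minimal
    seminorm.\<close>
  define P where "P q q' \<longleftrightarrow> (\<forall>x. q' x \<le> q x)" for q q' :: "'a \<Rightarrow> real"
  have "\<exists>m\<in>F. \<forall>q\<in>F. P m q \<longrightarrow> q = m"
  proof (rule predicate_Zorn)
    show "partial_order_on F (relation_of P F)"
    proof (rule partial_order_on_relation_ofI)
      show "P a a" if "a \<in> F" for a by (simp add: P_def)
      show "P a c" if "a \<in> F" "b \<in> F" "c \<in> F" "P a b" "P b c" for a b c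
        using that unfolding P_def by (meson order_trans)
      show "a = b" if "a \<in> F" "b \<in> F" "P a b" "P b a" for a b
        using that unfolding P_def by (auto intro!: ext antisym)
    qed
  next
    fix C assume C: "C \<in> Chains (relation_of P F)"
    then have CF: "C \<subseteq> F" and tot: "\<And>q q'. q \<in> C \<Longrightarrow> q' \<in> C \<Longrightarrow> P q q' \<or> P q' q"
      by (auto simp: Chains_def relation_of_def)
    show "\<exists>m\<in>F. \<forall>q\<in>C. P q m"
    proof (cases "C = {}")
      case True
      then show ?thesis using p by (auto simp: F_def)
    next
      case False
      define Q where "Q x = (INF q\<in>C. q x)" for x
      have D: "q 1 = 1" "0 \<le> q x" "q x \<le> norm x" "q (x + y) \<le> q x + q y" "q (x * y) \<le> q x * q y" "q (u * x) = s * q x"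
        if "q \<in> C" for q x y
        using CF that algebra_seminormD[of q] by (auto simp: F_def)
      have bdd: "bdd_below ((\<lambda>q. q x) ` C)" for x using D(2) by (intro bdd_belowI[of _ 0]) auto
      have lower: "Q x \<le> q x" if "q \<in> C" for q x unfolding Q_def by (rule cINF_lower[OF bdd that])
      have great: "c \<le> Q x" if "\<And>q. q \<in> C \<Longrightarrow> c \<le> q x" for c x
        unfolding Q_def using False that by (rule cINF_greatest)
      have less: "\<exists>q\<in>C. q x < r" if "Q x < r" for x r
        using great[of r x] that by (meson not_less)
      \<comment> \<open>One member of the chain has to witness both bounds: this is what makes a
        pointwise infimum subadditive and submultiplicative.\<close>
      have common: "\<exists>q\<in>C. q x < r \<and> q y < t" if xy: "Q x < r" "Q y < t" for x y r t
      proof -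
        obtain q1 q2 where "q1 \<in> C" "q1 x < r" "q2 \<in> C" "q2 y < t" using less xy by metis
        then show ?thesis using tot[of q1 q2] unfolding P_def by (meson order_le_less_trans)
      qed
      obtain q0 where q0: "q0 \<in> C" using False by blast
      have "Q 1 = 1" 
      proof (rule antisym)
        show "Q 1 \<le> 1" using lower[OF q0, of 1] D(1)[OF q0] by simp
        show "1 \<le> Q 1" by (intro great) (simp add: D(1))
      qed
      moreover have "0 \<le> Q x" for x using great D(2) by blast
      moreover have "Q x \<le> norm x" for x using lower[OF q0] D(3)[OF q0] order_trans by blast
      moreover have "Q (x + y) \<le> Q x + Q y" for x y
      proof (rule le_add_if_le_approx)
        fix r t assume "Q x < r" "Q y < t"
        then obtain q where "q \<in> C" "q x < r" "q y < t" using common by blast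
        then show "Q (x + y) \<le> r + t" using lower[of q "x + y"] D(4)[of q x y] by linarith
      qed
      moreover have "Q (x * y) \<le> Q x * Q y" for x y
      proof (rule le_mult_if_le_approx)
        fix r t assume "Q x < r" "Q y < t"
        then obtain q where q: "q \<in> C" "q x < r" "q y < t" using common by blast
        then have "q x * q y \<le> r * t"
          using D(2)[OF q(1), of x] D(2)[OF q(1), of y] by (intro mult_mono) linarith+
        then show "Q (x * y) \<le> r * t" using q lower[of q "x * y"] D(5)[of q x y] by linarith
      qed
      moreover have "Q (u * x) = s * Q x" for x
      proof (rule antisym)
        have "Q (u * x) / s \<le> Q x"
          by (intro great) (use lower[of _ "u * x"] D(6) s in \<open>simp add: divide_le_eq mult.commute\<close>)
        then show "Q (u * x) \<le> s * Q x" using s by (simp add: divide_le_eq mult.commute)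
        show "s * Q x \<le> Q (u * x)" by (intro great) (use lower[of _ x] s in \<open>simp add: D(6)\<close>)
      qed
      ultimately have "Q \<in> F" by (simp add: F_def algebra_seminorm_def)
      then show ?thesis using lower by (auto simp: P_def)
    qed
  qed
  then show ?thesis using that by (auto simp: F_def P_def)
qed

lemma minimal_scaled_seminorm_multiplicative:
  fixes q :: "'a::{real_normed_algebra_1,comm_ring_1} \<Rightarrow> real"
  assumes s: "s > 0" and q: "algebra_seminorm q" and qu: "\<And>x. q (u * x) = s * q x"
    and min: "\<And>q'. algebra_seminorm q' \<Longrightarrow> (\<And>x. q' (u * x) = s * q' x) \<Longrightarrow> (\<And>x. q' x \<le> q x) \<Longrightarrow> q' = q"
  shows "q (x * y) = q x * q y"
proof -
  have "spectral_radius q = q"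
  proof (rule min)
    show "algebra_seminorm (spectral_radius q)" by (rule algebra_seminorm_spectral_radius[OF q])
    show "spectral_radius q x \<le> q x" for x by (rule spectral_radius_le_seminorm[OF q])
    show "spectral_radius q (u * x) = s * spectral_radius q x" for x
    proof (rule antisym)
      have "spectral_radius q (u * x) \<le> spectral_radius q u * spectral_radius q x"
        by (rule algebra_seminormD(5)[OF algebra_seminorm_spectral_radius[OF q]])
      also have "\<dots> \<le> s * spectral_radius q x"
        using spectral_radius_le_seminorm[OF q, of u] qu[of 1] algebra_seminormD(1)[OF q]
        by (intro mult_right_mono spectral_radius_nonneg[OF q]) simp
      finally show "spectral_radius q (u * x) \<le> s * spectral_radius q x" .
      \<comment> \<open>Since \<open>q ((u * x) ^ n) = s ^ n * q (x ^ n)\<close>, every rate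
        \<open>r\<close> of \<open>u * x\<close> gives the rate \<open>r / s\<close> of
        \<open>x\<close>.\<close>
      show "s * spectral_radius q x \<le> spectral_radius q (u * x)"
      proof (rule spectral_radius_greatest[OF q])
        fix r assume r: "r \<in> growth_rates q (u * x)"
        then obtain C where C: "C > 0" "\<And>n. q ((u * x) ^ n) \<le> C * r ^ n" using growth_rateE q by blast
        have un: "q (u ^ n * y) = s ^ n * q y" for n y
          by (induction n) (simp_all add: qu mult.assoc)
        have "q (x ^ n) \<le> C * (r / s) ^ n" for n
          using C(2)[of n] s by (simp add: power_mult_distrib un power_divide field_simps)
        then have "spectral_radius q x \<le> r / s"
          using r s by (intro spectral_radius_le) (auto simp: growth_rates_def)
        then show "s * spectral_radius q x \<le> r" using s by (simp add: field_simps)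
      qed
    qed
  qed
  then have sq: "q (x * x) = q x * q x" for x using spectral_radius_square[OF q, of x] by simp
  show ?thesis
  proof (cases "q x = 0")
    case True
    then show ?thesis using algebra_seminormD(2,5)[OF q] by (metis antisym mult_zero_left)
  next
    case False
    then have x: "q x > 0" using algebra_seminormD(2)[OF q, of x] by simp
    have "q (x ^ n) = q x ^ n" for n by (rule algebra_seminorm_power_eq[OF q]) (rule sq)
    note loc = q x this
    \<comment> \<open>By minimality \<open>q\<close> coincides with its localisation at
      \<open>x\<close>, for which multiplication by \<open>x\<close> is a dilation by
      \<open>q x\<close>; this is the claimed product formula.\<close>
    have "localised_seminorm q x = q"
    proof (rule min)
      show "algebra_seminorm (localised_seminorm q x)" by (rule algebra_seminorm_localised[of q x, OF loc])
      show "localised_seminorm q x (u * y) = s * localised_seminorm q x y" for y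
        by (rule localised_seminorm_scaled[of q x u s, OF loc qu])
      show "localised_seminorm q x y \<le> q y" for y by (rule localised_seminorm_le_seminorm[of q x, OF loc])
    qed
    then show ?thesis using localised_seminorm_mult[of q x y, OF loc] by simp
  qed
qed

section \<open>From multiplicative seminorms to characters: a Gelfand--Mazur argument\<close>

context unital_commutative_banach_algebra
begin

lemma algebra_seminorm_smul:
  assumes q: "algebra_seminorm q"
  shows "q (smul c x) = cmod c * q x"
proof (rule antisym)
  have le: "q (smul c x) \<le> cmod c * q x" for c x
  proof -
    have "q (smul c 1 * x) \<le> q (smul c 1) * q x" by (rule algebra_seminormD(5)[OF q])
    also have "\<dots> \<le> cmod c * q x"
      using algebra_seminormD(3)[OF q, of "smul c 1"]
      by (intro mult_right_mono algebra_seminormD(2)[OF q]) (simp add: norm_scale)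
    finally show ?thesis by (simp add: scale_one_mult)
  qed
  show "q (smul c x) \<le> cmod c * q x" by (rule le)
  show "cmod c * q x \<le> q (smul c x)"
  proof (cases "c = 0")
    case True
    then show ?thesis using algebra_seminormD(2)[OF q, of 0] by simp
  next
    case False
    then show ?thesis using le[of "1 / c" "smul c x"] by (simp add: norm_divide field_simps)
  qed
qed

lemma algebra_seminorm_diff_le:
  fixes x y :: 'a
  assumes q: "algebra_seminorm q"
  shows "q (x - y) \<le> q x + q y" and "q x \<le> q (x - y) + q y" and "q (x - y) = q (y - x)"
proof -
  have m: "q (- z) = q z" for z using algebra_seminorm_smul[OF q, of "- 1" z] by simp
  show "q (x - y) \<le> q x + q y" using algebra_seminormD(4)[OF q, of x "- y"] m by simp
  show "q x \<le> q (x - y) + q y" using algebra_seminormD(4)[OF q, of "x - y" y] by simp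
  show "q (x - y) = q (y - x)" using m[of "x - y"] by simp
qed

lemma algebra_seminorm_scalar: "algebra_seminorm q \<Longrightarrow> q (smul c 1) = cmod c"
  by (simp add: algebra_seminorm_smul algebra_seminormD(1))

text \<open>
  If \<open>c \<mapsto> q (b - c)\<close> has a positive minimum \<open>m\<close> at \<open>0\<close>, factoring \<open>b ^ N - d ^ N\<close> into linear
  factors shows that it equals \<open>m\<close> on the whole disc of radius \<open>m\<close>; so it would be constant.
\<close>

lemma multiplicative_seminorm_minimum_spreads:
  assumes q: "algebra_seminorm q" and mult: "\<And>x y. q (x * y) = q x * q y"
    and m: "q b = m" "m > 0" "\<And>c. m \<le> q (b - smul c 1)" and d: "cmod d < m"
  shows "q (b - smul d 1) = m"
proof -
  \<comment> \<open>Of the \<open>2 ^ k\<close> linear factors of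
    \<open>b ^ (2 ^ k) - d ^ (2 ^ k)\<close> all but one are estimated from below by
    \<open>m\<close>. For powers of two the induction proceeds by the difference of two
    squares.\<close>
  have factor: "q (b - smul d 1) * m ^ (2 ^ k - 1) \<le> q (b ^ (2 ^ k) - smul (d ^ (2 ^ k)) 1)" for k d
  proof (induction k arbitrary: d)
    case (Suc k)
    define N :: nat where "N = 2 ^ k"
    have N: "N \<ge> 1" by (simp add: N_def)
    \<comment> \<open>An N-th root of -1: it turns the factor \<open>b ^ N + d ^ N\<close> into
      \<open>b ^ N - (w d) ^ N\<close>, to which the induction hypothesis applies.\<close>
    define w where "w = exp (\<i> * of_real pi / of_nat N)"
    have w: "w ^ N = - 1" using N by (simp add: w_def exp_of_nat_mult[symmetric])
    have "m ^ N = m * m ^ (N - 1)" using N by (simp add: power_eq_if)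
    also have "\<dots> \<le> q (b - smul (w * d) 1) * m ^ (N - 1)" using m by (intro mult_right_mono) auto
    also have "\<dots> \<le> q (b ^ N - smul ((w * d) ^ N) 1)" using Suc[of "w * d"] by (simp add: N_def)
    also have "b ^ N - smul ((w * d) ^ N) 1 = b ^ N + smul (d ^ N) 1" by (simp add: power_mult_distrib w)
    finally have plus: "m ^ N \<le> q (b ^ N + smul (d ^ N) 1)" .
    have "q (b - smul d 1) * m ^ (2 ^ Suc k - 1) = (q (b - smul d 1) * m ^ (N - 1)) * m ^ N"
      using N by (simp add: N_def[symmetric] power_add[symmetric] mult.assoc mult_2)
    also have "\<dots> \<le> q (b ^ N - smul (d ^ N) 1) * q (b ^ N + smul (d ^ N) 1)"
      using Suc[of d] plus m(2) algebra_seminormD(2)[OF q] by (intro mult_mono) (auto simp: N_def)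
    also have "\<dots> = q (b ^ (2 ^ Suc k) - smul (d ^ (2 ^ Suc k)) 1)"
    proof -
      have "(b ^ N - smul (d ^ N) 1) * (b ^ N + smul (d ^ N) 1) = b ^ N * b ^ N - smul (d ^ N) 1 * smul (d ^ N) 1"
        by (simp add: algebra_simps)
      also have "\<dots> = b ^ (2 ^ Suc k) - smul (d ^ (2 ^ Suc k)) 1"
        by (simp add: N_def mult_2 power_add scale_one_mult)
      finally show ?thesis by (simp flip: mult)
    qed
    finally show ?case .
  qed simp
  have "q (b - smul d 1) \<le> m + m * (cmod d / m) ^ (2 ^ k)" for k
  proof -
    define N :: nat where "N = 2 ^ k"
    have N: "N \<ge> 1" by (simp add: N_def)
    have "q (b - smul d 1) * m ^ (N - 1) \<le> q (b ^ N - smul (d ^ N) 1)" using factor by (simp add: N_def)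
    also have "\<dots> \<le> q (b ^ N) + q (smul (d ^ N) 1)" by (rule algebra_seminorm_diff_le[OF q])
    also have "\<dots> \<le> m ^ N + cmod d ^ N"
      using algebra_seminorm_power_le[OF q, of b N] m(1) by (simp add: algebra_seminorm_scalar[OF q] norm_power)
    also have "\<dots> = (m + m * (cmod d / m) ^ N) * m ^ (N - 1)"
    proof -
      have "(m + m * (cmod d / m) ^ N) * m ^ (N - 1) = (m * m ^ (N - 1)) * (1 + (cmod d / m) ^ N)"
        by (simp add: algebra_simps)
      also have "m * m ^ (N - 1) = m ^ N" using N by (simp add: power_eq_if)
      finally have "(m + m * (cmod d / m) ^ N) * m ^ (N - 1) = m ^ N * (1 + (cmod d / m) ^ N)" .
      then show ?thesis using m(2) by (simp add: power_divide distrib_left)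
    qed
    finally show ?thesis using m(2) by (simp add: N_def)
  qed
  moreover have "(\<lambda>k. m + m * (cmod d / m) ^ (2 ^ k)) \<longlonglongrightarrow> m + m * 0"
  proof (intro tendsto_add tendsto_mult tendsto_const)
    have "(\<lambda>n. (cmod d / m) ^ n) \<longlonglongrightarrow> 0" using d m(2) by (intro LIMSEQ_realpow_zero) auto
    moreover have "strict_mono (\<lambda>k. 2 ^ k :: nat)" by (auto intro!: strict_monoI_Suc)
    ultimately show "(\<lambda>k. (cmod d / m) ^ (2 ^ k)) \<longlonglongrightarrow> 0"
      using LIMSEQ_subseq_LIMSEQ unfolding o_def by blast
  qed
  ultimately have "q (b - smul d 1) \<le> m" using LIMSEQ_le_const by force
  then show ?thesis using m(3) by (simp add: antisym)
qed

text \<open>The function \<open>f c = q (a - c)\<close> grows with \<open>c\<close> and attains its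
  minimum. A positive minimum would persist along arbitrarily many equal steps in one direction,
  contradicting the growth.\<close>

lemma multiplicative_seminorm_eigenvalue:
  assumes q: "algebra_seminorm q" and mult: "\<And>x y. q (x * y) = q x * q y"
  shows "\<exists>c. q (a - smul c 1) = 0"
proof -
  define f where "f c = q (a - smul c 1)" for c
  have ge: "cmod c - q a \<le> f c" for c
    using algebra_seminorm_diff_le(2)[OF q, of "smul c 1" a] algebra_seminorm_diff_le(3)[OF q, of a]
    by (simp add: f_def algebra_seminorm_scalar[OF q])
  have "f c - f d \<le> cmod (c - d)" for c d
  proof -
    have "a - smul d 1 + smul (d - c) 1 = a - smul c 1" by (simp add: scale_left_diff_distrib)
    then have "q (a - smul c 1) \<le> q (a - smul d 1) + q (smul (d - c) 1)"
      by (metis algebra_seminormD(4)[OF q])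
    then show ?thesis
      unfolding f_def algebra_seminorm_scalar[OF q] by (simp add: norm_minus_commute)
  qed
  then have lip: "\<bar>f c - f d\<bar> \<le> cmod (c - d)" for c d
    by (metis abs_le_iff minus_diff_eq norm_minus_commute)
  have cont: "continuous_on X f" for X
    unfolding continuous_on_iff dist_norm real_norm_def using lip order_le_less_trans by metis
  \<comment> \<open>Outside this disc \<open>f c \<ge> cmod c - q a\<close> exceeds
    \<open>f 0 = q a\<close>, so a minimum over the disc is global.\<close>
  define R where "R = 2 * q a + 1"
  have "cball 0 R \<noteq> ({} :: complex set)" using algebra_seminormD(2)[OF q, of a] by (simp add: R_def)
  then obtain c0 where c0: "c0 \<in> cball 0 R" "\<And>c. c \<in> cball 0 R \<Longrightarrow> f c0 \<le> f c"
    using continuous_attains_inf[OF compact_cball _ cont, of 0 R] by blast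
  have min: "f c0 \<le> f c" for c
  proof (cases "c \<in> cball 0 R")
    case False
    then have "f 0 \<le> f c" using ge[of c] algebra_seminormD(2)[OF q, of a] by (simp add: R_def f_def)
    moreover have "f c0 \<le> f 0" using c0(2)[of 0] algebra_seminormD(2)[OF q, of a] by (simp add: R_def)
    ultimately show ?thesis by simp
  qed (use c0 in auto)
  have "f c0 = 0"
  proof (rule ccontr)
    assume "f c0 \<noteq> 0"
    then have m: "f c0 > 0" using algebra_seminormD(2)[OF q] by (simp add: f_def order_less_le)
    \<comment> \<open>The step is half of the minimum, hence strictly inside the disc on which the
      minimum is known to spread.\<close>
    have "f (c0 + of_nat n * of_real (f c0 / 2)) = f c0" for n
    proof (induction n)
      case (Suc n)
      define c where "c = c0 + of_nat n * of_real (f c0 / 2)"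
      have "q ((a - smul c 1) - smul (of_real (f c0 / 2)) 1) = f c0"
      proof (rule multiplicative_seminorm_minimum_spreads[OF q mult])
        show "q (a - smul c 1) = f c0" using Suc by (simp add: c_def f_def)
        show "f c0 \<le> q (a - smul c 1 - smul d 1)" for d
          using min[of "c + d"] by (simp add: f_def scale_left_distrib diff_diff_eq)
      qed (use m in auto)
      then have "f (c + of_real (f c0 / 2)) = f c0" by (simp add: f_def scale_left_distrib diff_diff_eq)
      moreover have "c + of_real (f c0 / 2) = c0 + of_nat (Suc n) * of_real (f c0 / 2)"
        unfolding c_def of_nat_Suc distrib_right by simp
      ultimately show ?case by (simp only:)
    qed simp
    then have le: "cmod (c0 + of_nat n * of_real (f c0 / 2)) \<le> f c0 + q a" for n
      using ge[of "c0 + of_nat n * of_real (f c0 / 2)"] by simp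
    have "real n * (f c0 / 2) \<le> f c0 + q a + cmod c0" for n
    proof -
      have "real n * (f c0 / 2) = cmod (of_nat n * of_real (f c0 / 2))" using m by (simp add: norm_mult)
      also have "\<dots> \<le> cmod (c0 + of_nat n * of_real (f c0 / 2)) + cmod c0"
        using norm_triangle_ineq4[of "c0 + of_nat n * of_real (f c0 / 2)" c0] by simp
      finally show ?thesis using le[of n] by linarith
    qed
    then show False using m by (meson half_gt_zero not_less reals_Archimedean3)
  qed
  then show ?thesis by (auto simp: f_def)
qed

definition character :: "('a \<Rightarrow> complex) \<Rightarrow> bool" where
  "character \<phi> \<longleftrightarrow> \<phi> 1 = 1 \<and> (\<forall>x y. \<phi> (x + y) = \<phi> x + \<phi> y) \<and> (\<forall>x y. \<phi> (x * y) = \<phi> x * \<phi> y) \<and>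
     (\<forall>c x. \<phi> (smul c x) = c * \<phi> x) \<and> (\<forall>x. cmod (\<phi> x) \<le> norm x)"

text \<open>On scalars \<open>q\<close> is the modulus, so the eigenvalue is unique; each algebraic
  rule for \<open>\<phi>\<close> then follows by checking that the expected value is an
  eigenvalue.\<close>

lemma character_of_multiplicative_seminorm:
  assumes q: "algebra_seminorm q" and mult: "\<And>x y. q (x * y) = q x * q y"
  obtains \<phi> where "character \<phi>" "\<And>x. cmod (\<phi> x) = q x"
proof -
  obtain \<phi> where \<phi>: "\<And>x. q (x - smul (\<phi> x) 1) = 0"
    using multiplicative_seminorm_eigenvalue[OF q mult] by metis
  have uniq: "\<phi> x = c" if "q (x - smul c 1) = 0" for x c
  proof -
    have "q (smul (\<phi> x - c) 1) \<le> q (x - smul c 1) + q (x - smul (\<phi> x) 1)"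
      using algebra_seminorm_diff_le(1)[OF q, of "x - smul c 1" "x - smul (\<phi> x) 1"]
      by (simp add: scale_left_diff_distrib)
    then show ?thesis by (simp add: that \<phi> algebra_seminorm_scalar[OF q])
  qed
  have zero: "q x = 0" if "q x \<le> 0" for x using that algebra_seminormD(2)[OF q, of x] by simp
  have "cmod (\<phi> x) = q x" for x
    using algebra_seminorm_diff_le(2)[OF q, of x "smul (\<phi> x) 1"]
      algebra_seminorm_diff_le(2)[OF q, of "smul (\<phi> x) 1" x] algebra_seminorm_diff_le(3)[OF q, of x "smul (\<phi> x) 1"]
    by (simp add: \<phi> algebra_seminorm_scalar[OF q])
  moreover have "\<phi> 1 = 1" by (rule uniq) (use zero[of 0] algebra_seminormD(3)[OF q, of 0] in simp)
  moreover have "\<phi> (x + y) = \<phi> x + \<phi> y" for x y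
    using algebra_seminormD(4)[OF q, of "x - smul (\<phi> x) 1" "y - smul (\<phi> y) 1"] \<phi>
    by (intro uniq zero) (simp add: scale_left_distrib algebra_simps)
  moreover have xy: "\<phi> (x * y) = \<phi> x * \<phi> y" for x y
  proof (intro uniq zero)
    have "x * y - smul (\<phi> x * \<phi> y) 1 = (x - smul (\<phi> x) 1) * y + smul (\<phi> x) 1 * (y - smul (\<phi> y) 1)"
      by (simp add: left_diff_distrib right_diff_distrib scale_one_mult)
    then show "q (x * y - smul (\<phi> x * \<phi> y) 1) \<le> 0"
      using algebra_seminormD(4)[OF q, of "(x - smul (\<phi> x) 1) * y" "smul (\<phi> x) 1 * (y - smul (\<phi> y) 1)"]
      by (simp add: mult \<phi>)
  qed
  moreover have "\<phi> (smul c 1) = c" for c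
    by (rule uniq) (use zero[of 0] algebra_seminormD(3)[OF q, of 0] in simp)
  then have "\<phi> (smul c x) = c * \<phi> x" for c x
    using xy[of "smul c 1" x] by (simp add: scale_one_mult)
  ultimately have "character \<phi>" unfolding character_def using algebra_seminormD(3)[OF q] by simp
  then show ?thesis using \<open>\<And>x. cmod (\<phi> x) = q x\<close> that by blast
qed

text \<open>The spectral radius localised at \<open>u\<close> is a seminorm for which multiplication
  by \<open>u\<close> is a dilation by a positive factor. A minimal seminorm of this kind is the
  modulus of a character, and its value at \<open>u\<close> is that factor.\<close>

lemma character_nonzero_if_spectral_radius_pos:
  assumes "spectral_radius norm u > 0"
  obtains \<phi> where "character \<phi>" "\<phi> u \<noteq> 0"
proof -
  let ?p = "spectral_radius norm :: 'a \<Rightarrow> real"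
  have p: "algebra_seminorm ?p" by (rule algebra_seminorm_spectral_radius[OF algebra_seminorm_norm])
  have pow: "?p (u ^ n) = ?p u ^ n" for n
    by (rule algebra_seminorm_power_eq[OF p]) (rule spectral_radius_square[OF algebra_seminorm_norm])
  obtain q where q: "algebra_seminorm q" "\<And>x. q (u * x) = ?p u * q x"
    "\<And>q'. algebra_seminorm q' \<Longrightarrow> (\<And>x. q' (u * x) = ?p u * q' x) \<Longrightarrow> (\<And>x. q' x \<le> q x) \<Longrightarrow> q' = q"
    using exists_minimal_scaled_seminorm[OF assms algebra_seminorm_localised[of ?p u, OF p assms pow]
        localised_seminorm_mult[of ?p u, OF p assms pow]] by metis
  have "q (x * y) = q x * q y" for x y
    by (rule minimal_scaled_seminorm_multiplicative[OF assms q])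
  then obtain \<phi> where \<phi>: "character \<phi>" "\<And>x. cmod (\<phi> x) = q x"
    using character_of_multiplicative_seminorm[OF q(1)] by metis
  have "cmod (\<phi> u) = ?p u" using \<phi>(2)[of u] q(2)[of 1] algebra_seminormD(1)[OF q(1)] by simp
  then have "\<phi> u \<noteq> 0" using assms by auto
  then show ?thesis using \<phi>(1) that by blast
qed

lemma invertible_one_minus:
  fixes u :: 'a
  assumes "spectral_radius norm u < 1"
  shows "1 - u \<in> jordan_invertibles (*) 1"
proof -
  obtain r where r: "spectral_radius norm u < r" "r < 1" using assms dense by blast
  then have g: "r \<in> growth_rates norm u"
    using growth_rates_above_spectral_radius[OF algebra_seminorm_norm] by blast
  then obtain C where C: "\<And>n. norm (u ^ n) \<le> C * r ^ n" using growth_rateE algebra_seminorm_norm by metis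
  have "r > 0" using g by (simp add: growth_rates_def)
  then have "summable (\<lambda>n. C * r ^ n)" using r(2) by (intro summable_mult summable_geometric) simp
  then have sum: "summable (\<lambda>n. u ^ n)" by (rule summable_comparison_test'[where N = 0]) (rule C)
  have "(\<lambda>n. (1 - u) * (\<Sum>i<n. u ^ i)) \<longlonglongrightarrow> (1 - u) * (\<Sum>n. u ^ n)"
    by (intro tendsto_mult tendsto_const summable_LIMSEQ sum)
  moreover have "(\<lambda>n. (1 - u) * (\<Sum>i<n. u ^ i)) \<longlonglongrightarrow> 1 - 0"
    unfolding one_diff_power_eq[symmetric]
    by (intro tendsto_diff tendsto_const summable_LIMSEQ_zero sum)
  ultimately have "(1 - u) * (\<Sum>n. u ^ n) = 1" using LIMSEQ_unique by fastforce
  then show ?thesis unfolding jordan_invertible_commutative_iff by (metis dvd_triv_left)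
qed

lemma jordan_U_mult: "jordan_U (*) a x = a * a * (x :: 'a)"
  by (simp add: jordan_U_def scaleR_2 mult_ac)

text \<open>Elements of spectral radius zero form an ideal of quasi-invertible elements, because the
  spectral radius is a submultiplicative seminorm; every other element is detected by a
  character.\<close>

lemma characters_separate:
  assumes ss: "jordan_semisimple smul (*) 1" and u: "\<And>\<phi>. character \<phi> \<Longrightarrow> \<phi> u = 0"
  shows "u = 0"
proof -
  let ?p = "spectral_radius norm :: 'a \<Rightarrow> real"
  have p: "algebra_seminorm ?p" by (rule algebra_seminorm_spectral_radius[OF algebra_seminorm_norm])
  note pD = algebra_seminormD[OF p]
  define J where "J = {x. ?p x = 0}"
  have zero: "?p x = 0" if "?p x \<le> 0" for x using that pD(2)[of x] by simp
  have mult: "x * y \<in> J" "y * x \<in> J" if "x \<in> J" for x y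
    using that pD(5)[of x y] by (auto simp: J_def mult.commute intro: zero)
  have "subspace J"
  proof (rule subspaceI)
    show "0 \<in> J" using pD(3)[of 0] zero by (simp add: J_def)
    show "x + y \<in> J" if "x \<in> J" "y \<in> J" for x y
      using that pD(4)[of x y] by (simp add: J_def zero)
    show "smul c x \<in> J" if "x \<in> J" for c x
      using mult(2)[OF that, of "smul c 1"] by (simp add: scale_one_mult)
  qed
  then have "jordan_ideal smul (*) J"
    unfolding jordan_ideal_def jordan_U_mult using mult by auto
  moreover have "quasi_invertible (*) 1 x" if "x \<in> J" for x
    using that unfolding quasi_invertible_def by (intro invertible_one_minus) (simp add: J_def)
  ultimately have "J \<subseteq> {0}"
    using ss unfolding jordan_semisimple_def is_mccrimmon_radical_def quasi_invertible_ideal_def by blast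
  moreover have "u \<in> J"
  proof (rule ccontr)
    assume "u \<notin> J"
    then have "?p u > 0" using pD(2)[of u] by (simp add: J_def order_less_le)
    then show False using character_nonzero_if_spectral_radius_pos u by metis
  qed
  ultimately show ?thesis by blast
qed

end

section \<open>Functionals that do not vanish on a clopen quadratic subset\<close>

text \<open>If \<open>p = \<Prod>(1 - t / t\<^sub>i)\<close>, the left-hand side below is the modulus of \<open>\<Sum>1 / t\<^sub>i\<^sup>2\<close>.\<close>

lemma coeff_bound_if_no_small_roots:
  fixes p :: "complex poly"
  assumes "degree p \<le> n" and "coeff p 0 = 1" and r: "r > 0" and "\<And>t. cmod t < r \<Longrightarrow> poly p t \<noteq> 0"
  shows "cmod ((coeff p 1)\<^sup>2 - 2 * coeff p 2) \<le> real n / r\<^sup>2"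
  using assms(1,2,4)
proof (induction n arbitrary: p)
  case 0
  then show ?case by (simp add: coeff_eq_0)
next
  case (Suc n)
  show ?case
  proof (cases "degree p = 0")
    case True
    then show ?thesis by (simp add: coeff_eq_0)
  next
    case False
    then obtain z where z: "poly p z = 0"
      using fundamental_theorem_of_algebra[of p] constant_degree[of p] by metis
    then obtain p0 where p0: "p = [:- z, 1:] * p0" by (metis dvdE poly_eq_0_iff_dvd)
    have zr: "cmod z \<ge> r" using Suc.prems(3)[of z] z by force
    then have z0: "z \<noteq> 0" using r by auto
    define w where "w = 1 / z"
    \<comment> \<open>The factor of the root is normalised to \<open>1 - w t\<close>, so that the
      cofactor again has constant coefficient 1.\<close>
    define p1 where "p1 = smult (- z) p0"
    have p: "p = [:1, - w:] * p1"
    proof -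
      have "[:- z, 1:] = smult (- z) [:1, - w:]" using z0 by (simp add: w_def)
      then show ?thesis unfolding p0 p1_def mult_smult_right by (simp only: mult_smult_left)
    qed
    have "p1 \<noteq> 0" using p Suc.prems(2) by auto
    then have "degree p = degree [:1, - w:] + degree p1"
      unfolding p by (intro degree_mult_eq) simp_all
    then have "degree p = Suc (degree p1)" using z0 by (simp add: w_def)
    then have "degree p1 \<le> n" using Suc.prems(1) by simp
    moreover have "coeff p1 0 = 1" using Suc.prems(2) by (simp add: p)
    moreover have "poly p1 t \<noteq> 0" if "cmod t < r" for t
      using Suc.prems(3)[OF that] by (simp add: p)
    ultimately have IH: "cmod ((coeff p1 1)\<^sup>2 - 2 * coeff p1 2) \<le> real n / r\<^sup>2" by (rule Suc.IH)
    have c: "coeff p 1 = coeff p1 1 - w" "coeff p 2 = coeff p1 2 - w * coeff p1 1"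
      using \<open>coeff p1 0 = 1\<close> by (simp_all add: p numeral_2_eq_2 coeff_pCons)
    have "(coeff p 1)\<^sup>2 - 2 * coeff p 2 = ((coeff p1 1)\<^sup>2 - 2 * coeff p1 2) + w\<^sup>2"
      unfolding c by (simp add: power2_eq_square algebra_simps)
    also have "cmod \<dots> \<le> real n / r\<^sup>2 + 1 / r\<^sup>2"
    proof (rule norm_triangle_mono[OF IH])
      have "cmod (w\<^sup>2) = 1 / (cmod z)\<^sup>2" by (simp add: w_def norm_divide norm_power power_divide)
      also have "\<dots> \<le> 1 / r\<^sup>2" using zr r z0 by (intro divide_left_mono power_mono) auto
      finally show "cmod (w\<^sup>2) \<le> 1 / r\<^sup>2" .
    qed
    finally show ?thesis by (simp add: add_divide_distrib add.commute)
  qed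
qed

section \<open>Powers, complex-linear functionals and characters of a Jordan algebra\<close>

lemma complex_banach_space_complex: "complex_banach_space ((*) :: complex \<Rightarrow> complex \<Rightarrow> complex)"
  by unfold_locales (simp_all add: algebra_simps scaleR_conv_of_real norm_mult)

context unital_jordan_banach_algebra
begin

lemma jordan_power_scale: "jordan_power jp e (smul t x) k = smul (t ^ k) (jordan_power jp e x k)"
  by (induction k) (simp_all add: jp_scale_left jp_scale_right mult.commute)

lemma jordan_power_unit_add:
  "jordan_power jp e (e + w) n = (\<Sum>k\<le>n. of_nat (n choose k) *\<^sub>R jordan_power jp e w k)"
proof (induction n)
  case (Suc n)
  let ?w = "jordan_power jp e w"
  have shift: "(\<Sum>k\<le>Suc n. of_nat (n choose k) *\<^sub>R ?w k) =
      ?w 0 + (\<Sum>k\<le>n. of_nat (n choose Suc k) *\<^sub>R ?w (Suc k))"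
    unfolding sum.atMost_Suc_shift by simp
  have "(\<Sum>k\<le>Suc n. of_nat (Suc n choose k) *\<^sub>R ?w k) =
      ?w 0 + (\<Sum>k\<le>n. of_nat (n choose k) *\<^sub>R ?w (Suc k)) + (\<Sum>k\<le>n. of_nat (n choose Suc k) *\<^sub>R ?w (Suc k))"
    by (subst sum.atMost_Suc_shift) (simp add: scaleR_add_left sum.distrib)
  also have "?w 0 + (\<Sum>k\<le>n. of_nat (n choose k) *\<^sub>R ?w (Suc k)) + (\<Sum>k\<le>n. of_nat (n choose Suc k) *\<^sub>R ?w (Suc k)) =
      (\<Sum>k\<le>n. of_nat (n choose k) *\<^sub>R ?w (Suc k)) + (\<Sum>k\<le>Suc n. of_nat (n choose k) *\<^sub>R ?w k)"
    unfolding shift by (simp only: ac_simps)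
  also have "\<dots> = (\<Sum>k\<le>n. of_nat (n choose k) *\<^sub>R ?w (Suc k)) + (\<Sum>k\<le>n. of_nat (n choose k) *\<^sub>R ?w k)"
    by simp
  also have "\<dots> = jp (e + w) (\<Sum>k\<le>n. of_nat (n choose k) *\<^sub>R ?w k)"
    by (simp add: jp_add_left jp_unit bounded_bilinear.sum_right[OF bounded_bilinear_jp]
        bounded_bilinear.scaleR_right[OF bounded_bilinear_jp] add.commute
        scaleR_add_right sum.distrib)
  finally show ?case using Suc by simp
qed simp

lemma norm_jordan_power_le: "norm (jordan_power jp e x n) \<le> norm x ^ n"
proof (induction n)
  case (Suc n)
  then show ?case
    using order_trans[OF norm_jp_le mult_left_mono[OF Suc norm_ge_zero]] by simp
qed (simp add: norm_unit)

definition complex_functional :: "('a \<Rightarrow> complex) \<Rightarrow> bool" where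
  "complex_functional f \<longleftrightarrow> (\<forall>x y. f (x + y) = f x + f y) \<and> (\<forall>c x. f (smul c x) = c * f x)"

lemma complex_functionalD:
  assumes "complex_functional f"
  shows "f (x + y) = f x + f y" "f (smul c x) = c * f x" "f (r *\<^sub>R x) = of_real r * f x"
    "f 0 = 0" "f (x - y) = f x - f y" "f (sum g A) = (\<Sum>i\<in>A. f (g i))"
proof -
  show add: "f (x + y) = f x + f y" and sc: "f (smul c x) = c * f x" for x y c
    using assms by (simp_all add: complex_functional_def)
  show "f (r *\<^sub>R x) = of_real r * f x" using sc[of "of_real r"] by (simp add: scale_of_real)
  show 0: "f 0 = 0" using sc[of 0 0] by simp
  show "f (x - y) = f x - f y" using add[of "x - y" y] by simp
  show "f (sum g A) = (\<Sum>i\<in>A. f (g i))"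
    by (induction A rule: infinite_finite_induct) (simp_all add: 0 add)
qed

definition jordan_character :: "('a \<Rightarrow> complex) \<Rightarrow> bool" where
  "jordan_character \<psi> \<longleftrightarrow> complex_functional \<psi> \<and> \<psi> e = 1 \<and> (\<forall>x y. \<psi> (jp x y) = \<psi> x * \<psi> y)"

lemma jordan_characterI_square:
  assumes f: "complex_functional \<psi>" and e: "\<psi> e = 1" and sq: "\<And>x. \<psi> (jp x x) = \<psi> x * \<psi> x"
  shows "jordan_character \<psi>"
proof -
  have "\<psi> (jp x y) = \<psi> x * \<psi> y" for x y
    using sq[of "x + y"] sq[of x] sq[of y]
    by (simp add: complex_functionalD[OF f] jp_simps jp_commute[of y x] algebra_simps)
  then show ?thesis using f e by (simp add: jordan_character_def)
qed

lemma jordan_character_power: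
  "jordan_character \<psi> \<Longrightarrow> \<psi> (jordan_power jp e x n) = \<psi> x ^ n"
  by (induction n) (simp_all add: jordan_character_def)

text \<open>Applied to the n-th power of \<open>x\<close>, the bound reads
  \<open>cmod (\<psi> x) ^ n \<le> K * norm x ^ n\<close>; large \<open>n\<close> removes the
  constant \<open>K\<close>.\<close>

lemma jordan_character_norm_le:
  assumes \<psi>: "jordan_character \<psi>" and K: "\<And>x. cmod (\<psi> x) \<le> K * norm x"
  shows "cmod (\<psi> x) \<le> norm x"
proof (rule ccontr)
  assume "\<not> cmod (\<psi> x) \<le> norm x"
  then have lt: "norm x < cmod (\<psi> x)" by simp
  then have pos: "cmod (\<psi> x) > 0" using norm_ge_zero[of x] by linarith
  have K0: "K \<ge> 0" using order_trans[OF norm_ge_zero K[of e]] norm_unit by simp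
  have "1 \<le> K * (norm x / cmod (\<psi> x)) ^ n" for n
  proof -
    have "cmod (\<psi> x) ^ n \<le> K * norm x ^ n"
      using K[of "jordan_power jp e x n"] mult_left_mono[OF norm_jordan_power_le K0]
      by (simp add: jordan_character_power[OF \<psi>] norm_power) (meson order_trans)
    then show ?thesis using pos by (simp add: power_divide field_simps)
  qed
  moreover have "(\<lambda>n. K * (norm x / cmod (\<psi> x)) ^ n) \<longlonglongrightarrow> K * 0"
    using lt pos by (intro tendsto_mult tendsto_const LIMSEQ_realpow_zero) auto
  ultimately have "1 \<le> K * 0" using LIMSEQ_le_const by blast
  then show False by simp
qed

end

context clopen_quadratic_subset
begin

lemma functional_unit_power:
  assumes f: "complex_functional f"
  shows "f (jordan_power jp e (e + smul t x) n) = (\<Sum>k\<le>n. t ^ k * (of_nat (n choose k) * f (jordan_power jp e x k)))"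
  by (simp add: jordan_power_unit_add complex_functionalD[OF f] jordan_power_scale mult_ac)

text \<open>What matters is that \<open>r\<close> does not depend on \<open>n\<close>: it only keeps
  \<open>e + t x\<close> in \<open>S\<close>, and \<open>S\<close> is closed for powers. On the
  connected disc \<open>cmod f - cmod g\<close> has no zero along these powers, so it keeps its
  positive sign from \<open>t = 0\<close>.\<close>

lemma dominance_on_powers:
  assumes f: "complex_functional f" and g: "complex_functional g"
    and ne: "\<And>h. h \<in> S \<Longrightarrow> cmod (f h) \<noteq> cmod (g h)" and lt: "cmod (g e) < cmod (f e)"
  obtains r where "r > 0" "\<And>n t. cmod t < r \<Longrightarrow>
    cmod (g (jordan_power jp e (e + smul t x) n)) < cmod (f (jordan_power jp e (e + smul t x) n))"
proof -
  obtain d where d: "d > 0" "ball e d \<subseteq> S" using open_S unit_mem by (meson open_contains_ball)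
  define r where "r = d / (norm x + 1)"
  have r: "r > 0" using d(1) by (simp add: r_def add_nonneg_pos)
  have "cmod (g (jordan_power jp e (e + smul t x) n)) < cmod (f (jordan_power jp e (e + smul t x) n))"
    if t: "cmod t < r" for n t
  proof -
    have inS: "jordan_power jp e (e + smul t x) n \<in> S" if t: "cmod t < r" for t
    proof -
      have "cmod t * norm x \<le> cmod t * (norm x + 1)" by (intro mult_left_mono) auto
      also have "\<dots> < d" using t by (simp add: r_def less_divide_eq add_nonneg_pos)
      finally have "e + smul t x \<in> S" using d(2) by (auto simp: subset_iff dist_norm norm_scale)
      then show ?thesis using power_closed[of "e + smul t x" n] unit_mem by (cases "n = 0") simp_all
    qed
    define h where "h t = cmod (f (jordan_power jp e (e + smul t x) n)) - cmod (g (jordan_power jp e (e + smul t x) n))" for t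
    have "continuous_on (ball 0 r) h"
      unfolding h_def functional_unit_power[OF f] functional_unit_power[OF g] by (intro continuous_intros)
    then have "connected (h ` ball 0 r)" using connected_continuous_image connected_ball by blast
    moreover have "h t \<in> h ` ball 0 r" "h 0 \<in> h ` ball 0 r" using t r by simp_all
    moreover have "jordan_power jp e e n = e" by (induction n) (simp_all add: jp_unit)
    then have "h 0 > 0" using lt by (simp add: h_def)
    ultimately have "0 \<in> h ` ball 0 r" if "h t \<le> 0"
      using that unfolding connected_iff_interval by (meson less_imp_le)
    moreover have "0 \<notin> h ` ball 0 r" using ne inS by (auto simp: h_def)
    ultimately have "h t > 0" by (meson not_less)
    then show ?thesis by (simp add: h_def)
  qed
  then show ?thesis using r that by blast
qed

text \<open>As a function of \<open>t\<close>, the value of \<open>\<psi> = f / f e\<close> at the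
  n-th power of \<open>e + t x\<close> is a polynomial of degree at most \<open>n\<close> without
  zeros in a disc independent of \<open>n\<close>. With \<open>a = \<psi> x\<close> and
  \<open>b = \<psi> (x x)\<close> the coefficient bound becomes
  \<open>cmod (n (a a - b) + b) \<le> 1 / r ^ 2\<close>, and \<open>n\<close> tending to infinity
  forces \<open>b = a a\<close>.\<close>

lemma jordan_character_of_dominating_functional:
  assumes f: "complex_functional f" and g: "complex_functional g"
    and ne: "\<And>h. h \<in> S \<Longrightarrow> cmod (f h) \<noteq> cmod (g h)" and lt: "cmod (g e) < cmod (f e)"
  obtains \<psi> where "jordan_character \<psi>" "\<And>x. f x = f e * \<psi> x" "\<And>x. g x = g e * \<psi> x"
proof -
  have fe: "f e \<noteq> 0" using lt by auto
  define \<psi> where "\<psi> x = f x / f e" for x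
  have \<psi>lin: "complex_functional \<psi>"
    by (simp add: complex_functional_def \<psi>_def complex_functionalD[OF f] add_divide_distrib)
  have \<psi>: "jordan_character \<psi>"
  proof (rule jordan_characterI_square[OF \<psi>lin])
    show "\<psi> e = 1" using fe by (simp add: \<psi>_def)
    fix x
    obtain r where r: "r > 0" "\<And>n t. cmod t < r \<Longrightarrow>
        cmod (g (jordan_power jp e (e + smul t x) n)) < cmod (f (jordan_power jp e (e + smul t x) n))"
      using dominance_on_powers[OF f g ne lt] by metis
    define a b where "a = \<psi> x" and "b = \<psi> (jp x x)"
    have bound: "real n * cmod (a * a - b) \<le> 1 / r\<^sup>2 + cmod b" if n: "n \<ge> 2" for n
    proof -
      define c where "c k = of_nat (n choose k) * \<psi> (jordan_power jp e x k)" for k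
      define p where "p = (\<Sum>k\<le>n. monom (c k) k)"
      have p: "poly p t = \<psi> (jordan_power jp e (e + smul t x) n)" for t
        by (simp add: p_def c_def poly_sum poly_monom functional_unit_power[OF \<psi>lin] mult_ac)
      have coeff: "coeff p k = (if k \<le> n then c k else 0)" for k
        by (simp add: p_def coeff_sum)
      have "cmod ((coeff p 1)\<^sup>2 - 2 * coeff p 2) \<le> real n / r\<^sup>2"
      proof (rule coeff_bound_if_no_small_roots[OF _ _ r(1)])
        show "degree p \<le> n" by (rule degree_le) (simp add: coeff)
        show "coeff p 0 = 1" using fe by (simp add: coeff c_def \<psi>_def)
        show "poly p t \<noteq> 0" if "cmod t < r" for t
          using r(2)[OF that, of n] fe by (auto simp: p \<psi>_def)
      qed
      moreover have "(coeff p 1)\<^sup>2 - 2 * coeff p 2 = of_nat n * (of_nat n * (a * a - b) + b)"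
      proof -
        have "2 * of_nat (n choose 2) = (of_nat n * (of_nat n - 1) :: complex)"
        proof -
          have "2 * (n choose 2) = n * (n - 1)" 
          proof -
            have "even (n * (n - 1))" by (cases n) auto
            then show ?thesis by (simp add: choose_two)
          qed
          then have "of_nat (2 * (n choose 2)) = (of_nat (n * (n - 1)) :: complex)" by (simp only:)
          then show ?thesis using n by (simp add: of_nat_diff)
        qed
        moreover have "coeff p 1 = of_nat n * a" "coeff p 2 = of_nat (n choose 2) * b"
          using n by (simp_all add: coeff c_def a_def b_def jp_unit_right numeral_2_eq_2)
        ultimately have "(coeff p 1)\<^sup>2 - 2 * coeff p 2 = (of_nat n * a)\<^sup>2 - (of_nat n * (of_nat n - 1)) * b"
          by (metis mult.assoc)
        then show ?thesis by (simp add: power2_eq_square algebra_simps)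
      qed
      ultimately have "real n * cmod (of_nat n * (a * a - b) + b) \<le> real n * (1 / r\<^sup>2)"
        by (simp add: norm_mult)
      then have "cmod (of_nat n * (a * a - b) + b) \<le> 1 / r\<^sup>2"
        by (rule mult_left_le_imp_le) (use n in simp)
      moreover have "real n * cmod (a * a - b) = cmod ((of_nat n * (a * a - b) + b) - b)"
        by (simp add: norm_mult)
      ultimately show ?thesis using norm_triangle_ineq4[of "of_nat n * (a * a - b) + b" b] by linarith
    qed
    have "cmod (a * a - b) = 0"
    proof (rule ccontr)
      assume "cmod (a * a - b) \<noteq> 0"
      then have pos: "cmod (a * a - b) > 0" by simp
      obtain n where n: "1 / r\<^sup>2 + cmod b < real n * cmod (a * a - b)" using reals_Archimedean3[OF pos] by blast
      also have "\<dots> \<le> real (n + 2) * cmod (a * a - b)" by (intro mult_right_mono) auto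
      finally show False using bound[of "n + 2"] by simp
    qed
    then show "\<psi> (jp x x) = \<psi> x * \<psi> x" by (simp add: a_def b_def)
  qed
  \<comment> \<open>Here \<open>f\<close> takes the constant value \<open>f e\<close> at all these
    powers, so \<open>g\<close> is bounded there by \<open>cmod (f e)\<close>, uniformly in
    \<open>n\<close>. Its coefficient at \<open>t\<close> is \<open>n * g x\<close>, which must
    therefore vanish.\<close>
  have ker: "g x = 0" if x: "f x = 0" for x
  proof -
    obtain r where r: "r > 0" "\<And>n t. cmod t < r \<Longrightarrow>
        cmod (g (jordan_power jp e (e + smul t x) n)) < cmod (f (jordan_power jp e (e + smul t x) n))"
      using dominance_on_powers[OF f g ne lt] by metis
    have \<psi>x: "\<psi> x = 0" using x by (simp add: \<psi>_def)
    have fpow: "f (jordan_power jp e (e + smul t x) n) = f e" for t n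
    proof -
      have "\<psi> (jordan_power jp e (e + smul t x) n) = 1"
        using \<psi> \<psi>x by (simp add: jordan_character_power complex_functionalD[OF \<psi>lin]) (simp add: jordan_character_def)
      then show ?thesis using fe by (simp add: \<psi>_def)
    qed
    have "real n * (cmod (g x) * (r / 2)) \<le> cmod (f e)" for n
    proof (cases "n = 0")
      case False
      have "cmod (of_nat (n choose 1) * g (jordan_power jp e x 1)) * (r / 2) ^ 1 \<le> cmod (f e)"
      proof (rule complex_banach_space.cauchy_estimate[OF complex_banach_space_complex,
            where n = n and v = "\<lambda>k. of_nat (n choose k) * g (jordan_power jp e x k)"])
        fix t :: complex assume "cmod t = r / 2"
        then have "cmod t < r" using r(1) by simp
        then show "cmod (\<Sum>m\<le>n. t ^ m * (of_nat (n choose m) * g (jordan_power jp e x m))) \<le> cmod (f e)"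
          using r(2)[of t n] fpow functional_unit_power[OF g, of t x n] by simp
      qed (use r(1) False in auto)
      then show ?thesis by (simp add: norm_mult jp_unit_right)
    qed simp
    then have "\<not> 0 < cmod (g x) * (r / 2)" by (meson not_less reals_Archimedean3)
    then show "g x = 0" using r(1) by (simp add: zero_less_mult_iff)
  qed
  have "g x = g e * \<psi> x" for x
    using ker[of "x - smul (\<psi> x) e"] fe by (simp add: complex_functionalD[OF f] complex_functionalD[OF g] \<psi>_def)
  moreover have "f x = f e * \<psi> x" for x using fe by (simp add: \<psi>_def)
  ultimately show ?thesis using \<psi> that by blast
qed

end

section \<open>The isometry transports characters\<close>

text \<open>Since \<open>cmod (z + cnj w)\<close> depends on the phase of \<open>z * w\<close>, and
  multiplying both \<open>z\<close> and \<open>w\<close> by \<open>l\<close> multiplies this product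
  by \<open>l * l\<close>, a rotation can make the two summands reinforce or oppose each
  other.\<close>

lemma exists_unimodular_square:
  obtains l where "cmod l = 1" "l * l * z = of_real (cmod z)"
proof -
  define l where "l = (if z = 0 then 1 else csqrt (cnj (sgn z)))"
  have l2: "l * l = (if z = 0 then 1 else cnj (sgn z))"
    by (simp add: l_def flip: power2_eq_square)
  then have "cmod l * cmod l = 1" by (simp flip: norm_mult) (simp add: norm_sgn)
  then have "cmod l = 1" by (metis abs_norm_cancel real_sqrt_abs2 real_sqrt_one)
  moreover have "l * l * z = of_real (cmod z)"
  proof (cases "z = 0")
    case False
    have "cnj z * z = of_real (cmod z) * of_real (cmod z)"
      by (metis complex_norm_square mult.commute power2_eq_square of_real_mult)
    then show ?thesis using False by (simp add: l2 sgn_eq)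
  qed simp
  ultimately show ?thesis using that by blast
qed

lemma cmod_add_cnj_square:
  "(cmod (z + cnj w))\<^sup>2 = (cmod z)\<^sup>2 + (cmod w)\<^sup>2 + 2 * Re (z * w)"
  unfolding cmod_power2 by (simp add: power2_eq_square algebra_simps)

locale linear_surjective_isometry =
  CA: unital_commutative_banach_algebra scaleA +
  A: clopen_quadratic_subset scaleA "(*)" 1 SA +
  N: clopen_quadratic_subset scaleN jpN eN SN
  for scaleA :: "complex \<Rightarrow> 'a::{real_normed_algebra_1,comm_ring_1,banach} \<Rightarrow> 'a" and SA
    and scaleN :: "complex \<Rightarrow> 'b::banach \<Rightarrow> 'b" and jpN eN SN +
  fixes T :: "'a \<Rightarrow> 'b"
  assumes linear_T: "linear T" and norm_T: "\<And>x. norm (T x) = norm x" and range_T: "range T = UNIV"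
    and image_T: "T ` SA = SN" and semisimple: "jordan_semisimple scaleN jpN eN"
begin

lemma semisimple_domain: "jordan_semisimple scaleA (*) 1"
proof -
  have inv1: "x \<in> jordan_invertibles (*) 1 \<longleftrightarrow> x dvd 1" for x :: 'a
    by (rule jordan_invertible_commutative_iff)
  have zero: "a = 0" if J: "quasi_invertible_ideal scaleA (*) 1 J" and a: "a \<in> J" for J a
  proof -
    have sub: "CA.subspace J" and U: "\<And>m x. x \<in> J \<Longrightarrow> jordan_U (*) m x \<in> J"
      and qi: "\<And>x. x \<in> J \<Longrightarrow> 1 - x dvd 1"
      using J by (auto simp: quasi_invertible_ideal_def jordan_ideal_def quasi_invertible_def inv1)
    have mult: "m * x \<in> J" if "x \<in> J" for m x
    proof -
      \<comment> \<open>Ideals are only known to be stable under \<open>U\<close>; products come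
        back from \<open>(1 + m) ^ 2 - (1 - m) ^ 2 = 4 m\<close>.\<close>
      have "scaleA (1 / 4) (jordan_U (*) (1 + m) x - jordan_U (*) (1 - m) x) \<in> J"
        by (intro CA.subspace_scale CA.subspace_diff sub U that)
      moreover have "jordan_U (*) (1 + m) x - jordan_U (*) (1 - m) x = scaleA 4 (m * x)"
      proof -
        have "jordan_U (*) (1 + m) x - jordan_U (*) (1 - m) x = 4 * (m * x)"
          by (simp add: CA.jordan_U_mult algebra_simps)
        also have "\<dots> = 4 *\<^sub>R (m * x)" by (simp add: scaleR_conv_of_real)
        also have "\<dots> = scaleA 4 (m * x)" using CA.scale_of_real[of 4 "m * x"] by simp
        finally show ?thesis .
      qed
      ultimately show ?thesis by simp
    qed
    \<comment> \<open>The segment from \<open>g\<close> to \<open>g + x\<close> consists of the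
      invertible elements \<open>g (1 + t g' x)\<close>, with \<open>g'\<close> inverse to
      \<open>g\<close>, so it cannot leave the clopen set \<open>SA\<close>.\<close>
    have shift: "g + x \<in> SA" if g: "g \<in> SA" and x: "x \<in> J" for g x
    proof -
      obtain g' where g': "g' * g = 1"
        using g A.subset_invertibles inv1 by (metis dvdE mult.commute subsetD)
      have "continuous_on {0..1} (\<lambda>t::real. g + t *\<^sub>R x)" by (intro continuous_intros)
      then have "connected ((\<lambda>t::real. g + t *\<^sub>R x) ` {0..1})"
        by (rule connected_continuous_image) simp
      moreover have "(\<lambda>t::real. g + t *\<^sub>R x) ` {0..1} \<subseteq> jordan_invertibles (*) 1"
      proof clarify
        fix t :: real
        have "1 - (- t) *\<^sub>R g' * x dvd 1" by (rule qi) (rule mult[OF x])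
        moreover have "g dvd 1" using g' by (metis dvd_triv_right)
        ultimately have "g * (1 - (- t) *\<^sub>R g' * x) dvd 1" using mult_dvd_mono[of g 1 _ 1] by simp
        moreover have "g * (1 - (- t) *\<^sub>R g' * x) = g + t *\<^sub>R ((g' * g) * x)"
          by (simp add: algebra_simps)
        ultimately show "g + t *\<^sub>R x \<in> jordan_invertibles (*) 1" by (simp add: inv1 g')
      qed
      moreover have "g \<in> (\<lambda>t::real. g + t *\<^sub>R x) ` {0..1}" by (rule image_eqI[of _ _ 0]) simp_all
      ultimately have "(\<lambda>t::real. g + t *\<^sub>R x) ` {0..1} \<subseteq> SA" using g by (rule A.connected_subset)
      moreover have "g + x \<in> (\<lambda>t::real. g + t *\<^sub>R x) ` {0..1}" by (rule image_eqI[of _ _ 1]) simp_all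
      ultimately show ?thesis by blast
    qed
    have "T a \<in> N.shifts"
    proof (rule N.shiftsI_real)
      fix h r assume "h \<in> SN"
      then obtain g where g: "g \<in> SA" "h = T g" using image_T by blast
      have "r *\<^sub>R a \<in> J" using CA.subspace_scale[OF sub a, of "of_real r"] by (simp add: CA.scale_of_real)
      then have "T (g + r *\<^sub>R a) \<in> SN" using shift[OF g(1)] image_T by blast
      then show "h + r *\<^sub>R T a \<in> SN" by (simp add: g(2) linear_add[OF linear_T] linear_scale[OF linear_T])
    qed
    then have "T a = 0" using N.shifts_trivial[OF semisimple] by blast
    then show "a = 0" using norm_T[of a] by simp
  qed
  have "quasi_invertible_ideal scaleA (*) 1 {0}"
    by (auto simp: quasi_invertible_ideal_def jordan_ideal_def quasi_invertible_def inv1 CA.jordan_U_mult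
        CA.subspace_def)
  then show ?thesis using zero by (auto simp: jordan_semisimple_def is_mccrimmon_radical_def)
qed

text \<open>Additivity stands in for complex linearity, because \<open>\<psi>\<close> is the
  conjugate of a complex-linear character when \<open>\<phi>\<close> reaches \<open>N\<close>
  antilinearly.\<close>

definition transported_character :: "('a \<Rightarrow> complex) \<Rightarrow> complex \<Rightarrow> ('b \<Rightarrow> complex) \<Rightarrow> bool" where
  "transported_character \<phi> \<alpha> \<psi> \<longleftrightarrow> \<alpha> \<noteq> 0 \<and> \<psi> eN = 1 \<and> (\<forall>x y. \<psi> (x + y) = \<psi> x + \<psi> y) \<and>
     (\<forall>x y. \<psi> (jpN x y) = \<psi> x * \<psi> y) \<and> (\<forall>a. \<phi> a = \<alpha> * \<psi> (T a))"

lemma exists_transported_character: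
  assumes \<phi>: "CA.character \<phi>"
  shows "\<exists>\<alpha> \<psi>. transported_character \<phi> \<alpha> \<psi>"
proof -
  have \<phi>D: "\<phi> 1 = 1" "\<phi> (x + y) = \<phi> x + \<phi> y" "\<phi> (x * y) = \<phi> x * \<phi> y" "\<phi> (scaleA c x) = c * \<phi> x"
    "cmod (\<phi> x) \<le> norm x" for x y c
    using \<phi> by (auto simp: CA.character_def)
  have injT: "T x = T y \<Longrightarrow> x = y" for x y
    using norm_T[of "x - y"] by (simp add: linear_diff[OF linear_T])
  define Ti where "Ti = inv_into UNIV T"
  have TiT: "Ti (T x) = x" for x unfolding Ti_def using injT by (simp add: inj_def)
  have TTi: "T (Ti y) = y" for y unfolding Ti_def by (rule f_inv_into_f) (simp add: range_T)
  define f where "f x = \<phi> (Ti x)" for x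
  have Ti_add: "Ti (x + y) = Ti x + Ti y" for x y
    by (rule injT) (simp add: linear_add[OF linear_T] TTi)
  have Ti_scale: "Ti (r *\<^sub>R x) = r *\<^sub>R Ti x" for r x
    by (rule injT) (simp add: linear_scale[OF linear_T] TTi)
  have f_add: "f (x + y) = f x + f y" for x y by (simp add: f_def Ti_add \<phi>D)
  have f_scale: "f (r *\<^sub>R x) = of_real r * f x" for r x
    using \<phi>D(4)[of "of_real r"] by (simp add: f_def Ti_scale flip: CA.scale_of_real)
  have f_norm: "cmod (f x) \<le> norm x" for x
    using \<phi>D(5)[of "Ti x"] norm_T[of "Ti x"] by (simp add: f_def TTi)
  have fT: "f (T a) = \<phi> a" for a by (simp add: f_def TiT)
  have f_nz: "f h \<noteq> 0" if h: "h \<in> SN" for h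
  proof -
    obtain g where g: "g \<in> SA" "h = T g" using h image_T by blast
    then obtain b where "g * b = 1" using A.inverse_exists by (metis is_jordan_inverse_def)
    then have "\<phi> g * \<phi> b = 1" by (simp flip: \<phi>D(3) add: \<phi>D(1))
    then show ?thesis using g(2) fT by auto
  qed
  \<comment> \<open>The complex-linear and the conjugate of the antilinear part of \<open>f\<close>.\<close>
  define p1 where "p1 x = (f x - \<i> * f (scaleN \<i> x)) / 2" for x
  define p2 where "p2 x = cnj ((f x + \<i> * f (scaleN \<i> x)) / 2)" for x
  have split: "f x = p1 x + cnj (p2 x)" for x by (simp add: p1_def p2_def field_simps)
  have sc: "scaleN c x = Re c *\<^sub>R x + Im c *\<^sub>R scaleN \<i> x" for c x
    by (subst complex_eq[of c]) (simp add: N.scale_left_distrib N.scale_of_real mult.commute flip: N.scale_of_real)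
  have fc: "f (scaleN c x) = of_real (Re c) * f x + of_real (Im c) * f (scaleN \<i> x)" for c x
    by (subst sc) (simp add: f_add f_scale)
  have fi: "f (scaleN \<i> (scaleN c x)) = - of_real (Im c) * f x + of_real (Re c) * f (scaleN \<i> x)" for c x
    using fc[of "\<i> * c" x] by simp
  have rot: "(of_real a * u + of_real b * v) - \<i> * (- of_real b * u + of_real a * v) = Complex a b * (u - \<i> * v)"
    "(of_real a * u + of_real b * v) + \<i> * (- of_real b * u + of_real a * v) = cnj (Complex a b) * (u + \<i> * v)"
    for a b :: real and u v :: complex
    by (simp_all add: Complex_eq algebra_simps)
  have p1: "N.complex_functional p1"
    unfolding N.complex_functional_def
  proof (intro conjI allI)
    show "p1 (x + y) = p1 x + p1 y" for x y
      by (simp add: p1_def f_add N.scale_right_distrib distrib_left add_divide_distrib diff_divide_distrib)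
    show "p1 (scaleN c x) = c * p1 x" for c x
      unfolding p1_def fi[of c x] fc[of c x] rot by simp
  qed
  have p2: "N.complex_functional p2"
    unfolding N.complex_functional_def
  proof (intro conjI allI)
    show "p2 (x + y) = p2 x + p2 y" for x y
      by (simp add: p2_def f_add N.scale_right_distrib distrib_left add_divide_distrib)
    show "p2 (scaleN c x) = c * p2 x" for c x
      unfolding p2_def fi[of c x] fc[of c x] rot by simp
  qed
  \<comment> \<open>If the moduli agreed, some unimodular \<open>l\<close> would make
    \<open>l * p1 h\<close> and \<open>cnj (l * p2 h)\<close> cancel; but \<open>l h\<close> lies in
    \<open>SN\<close>, where \<open>f\<close> has no zero.\<close>
  have ne: "cmod (p1 h) \<noteq> cmod (p2 h)" if h: "h \<in> SN" for h
  proof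
    assume eq: "cmod (p1 h) = cmod (p2 h)"
    obtain l where l: "cmod l = 1" "l * l * (- (p1 h * p2 h)) = of_real (cmod (- (p1 h * p2 h)))"
      by (rule exists_unimodular_square)
    have "l \<noteq> 0" using l(1) by auto
    then have "f (scaleN l h) \<noteq> 0" using f_nz N.scale_closed[OF h] by blast
    moreover have "f (scaleN l h) = l * p1 h + cnj (l * p2 h)"
      by (simp add: split N.complex_functionalD[OF p1] N.complex_functionalD[OF p2])
    moreover have "(cmod (l * p1 h + cnj (l * p2 h)))\<^sup>2 = 0"
    proof -
      have "(l * p1 h) * (l * p2 h) = - of_real (cmod (p1 h) * cmod (p2 h))"
      proof -
        have "(l * p1 h) * (l * p2 h) = - (l * l * (- (p1 h * p2 h)))" by (simp add: mult_ac)
        then show ?thesis unfolding l(2) by (simp add: norm_mult)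
      qed
      then have "Re ((l * p1 h) * (l * p2 h)) = - (cmod (p1 h) * cmod (p2 h))" by simp
      then show ?thesis
        unfolding cmod_add_cnj_square using eq l(1) by (simp add: norm_mult power2_eq_square)
    qed
    ultimately show False by simp
  qed
  have "\<exists>\<psi>. N.jordan_character \<psi> \<and> (\<forall>x. p1 x = p1 eN * \<psi> x) \<and> (\<forall>x. p2 x = p2 eN * \<psi> x)"
  proof (cases "cmod (p2 eN) < cmod (p1 eN)")
    case True
    then show ?thesis using N.jordan_character_of_dominating_functional[OF p1 p2 ne] by metis
  next
    case False
    then have "cmod (p1 eN) < cmod (p2 eN)" using ne[OF N.unit_mem] by simp
    then show ?thesis using N.jordan_character_of_dominating_functional[OF p2 p1] ne by metis
  qed
  then obtain \<psi> where \<psi>: "N.jordan_character \<psi>" "\<And>x. p1 x = p1 eN * \<psi> x" "\<And>x. p2 x = p2 eN * \<psi> x"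
    by blast
  define \<alpha> \<beta> where "\<alpha> = p1 eN" and "\<beta> = p2 eN"
  have \<psi>D: "\<psi> eN = 1" "\<psi> (x + y) = \<psi> x + \<psi> y" "\<psi> (jpN x y) = \<psi> x * \<psi> y" "\<psi> (scaleN c x) = c * \<psi> x" for x y c
    using \<psi>(1) by (auto simp: N.jordan_character_def N.complex_functional_def)
  have f: "f x = \<alpha> * \<psi> x + cnj (\<beta> * \<psi> x)" for x
    using split[of x] \<psi>(2)[of x] \<psi>(3)[of x] by (simp add: \<alpha>_def \<beta>_def)
  have ab: "cmod \<alpha> \<noteq> cmod \<beta>" using ne[OF N.unit_mem] by (simp add: \<alpha>_def \<beta>_def)
  define D where "D = (cmod \<alpha>)\<^sup>2 - (cmod \<beta>)\<^sup>2"
  have D0: "D \<noteq> 0" using ab by (simp add: D_def power2_eq_iff_nonneg)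
  \<comment> \<open>\<open>D\<close> is the determinant of the real-linear map
    \<open>w \<mapsto> \<alpha> * w + cnj (\<beta> * w)\<close>; inverting it bounds
    \<open>\<psi>\<close> by \<open>f\<close>.\<close>
  have invert: "of_real D * \<psi> x = cnj \<alpha> * f x - cnj (\<beta> * f x)" for x
  proof -
    have D: "of_real D = \<alpha> * cnj \<alpha> - \<beta> * cnj \<beta>" unfolding D_def of_real_diff complex_norm_square ..
    show ?thesis unfolding D by (simp add: f algebra_simps)
  qed
  have \<psi>_norm: "cmod (\<psi> x) \<le> norm x" for x
  proof (rule N.jordan_character_norm_le[OF \<psi>(1)])
    fix x
    have "\<bar>D\<bar> * cmod (\<psi> x) = cmod (cnj \<alpha> * f x - cnj (\<beta> * f x))"
      using invert[of x] by (metis norm_mult norm_of_real)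
    also have "\<dots> \<le> (cmod \<alpha> + cmod \<beta>) * cmod (f x)"
      using norm_triangle_ineq4[of "cnj \<alpha> * f x" "cnj (\<beta> * f x)"] by (simp add: norm_mult distrib_right)
    also have "\<dots> \<le> (cmod \<alpha> + cmod \<beta>) * norm x" by (intro mult_left_mono f_norm) simp
    finally show "cmod (\<psi> x) \<le> ((cmod \<alpha> + cmod \<beta>) / \<bar>D\<bar>) * norm x"
      using D0 by (simp add: field_simps)
  qed
  \<comment> \<open>For suitable unimodular \<open>l\<close> the contractions \<open>f\<close> and \<open>\<psi> \<circ> T\<close> have modulus \<open>|\<alpha>| + |\<beta>|\<close> and
    \<open>1 / ||\<alpha>| - |\<beta>||\<close> at \<open>l 1\<close>, so both numbers are at most \<open>1\<close>.\<close>
  have "(cmod \<alpha> + cmod \<beta>)\<^sup>2 \<le> 1"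
  proof -
    obtain l where l: "cmod l = 1" "l * l * (\<alpha> * \<beta>) = of_real (cmod (\<alpha> * \<beta>))"
      by (rule exists_unimodular_square)
    have "f (scaleN l eN) = \<alpha> * l + cnj (\<beta> * l)" by (simp add: f \<psi>D)
    then have "cmod (\<alpha> * l + cnj (\<beta> * l)) \<le> 1"
      using f_norm[of "scaleN l eN"] l(1) by (simp add: N.norm_scale N.norm_unit)
    then have "(cmod (\<alpha> * l + cnj (\<beta> * l)))\<^sup>2 \<le> 1" by (simp add: power_le_one)
    moreover have "(\<alpha> * l) * (\<beta> * l) = of_real (cmod \<alpha> * cmod \<beta>)"
      using l(2) by (simp add: norm_mult mult_ac)
    then have "Re ((\<alpha> * l) * (\<beta> * l)) = cmod \<alpha> * cmod \<beta>" by simp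
    ultimately show ?thesis
      unfolding cmod_add_cnj_square using l(1) by (simp add: norm_mult power2_sum)
  qed
  moreover have "(cmod \<alpha> + cmod \<beta>)\<^sup>2 \<le> D\<^sup>2"
  proof -
    obtain l where l: "cmod l = 1" "l * l * (- (cnj \<alpha> * \<beta>)) = of_real (cmod (- (cnj \<alpha> * \<beta>)))"
      by (rule exists_unimodular_square)
    have "of_real D * \<psi> (T (scaleA l 1)) = cnj \<alpha> * l + cnj (- \<beta> * l)" by (simp add: invert fT \<phi>D)
    moreover have "cmod (\<psi> (T (scaleA l 1))) \<le> 1"
      using \<psi>_norm[of "T (scaleA l 1)"] l(1) by (simp add: norm_T CA.norm_scale)
    ultimately have "cmod (cnj \<alpha> * l + cnj (- \<beta> * l)) \<le> \<bar>D\<bar> * 1"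
      by (metis mult_left_mono abs_ge_zero norm_mult norm_of_real)
    then have "(cmod (cnj \<alpha> * l + cnj (- \<beta> * l)))\<^sup>2 \<le> D\<^sup>2"
      by (metis abs_le_square_iff abs_norm_cancel mult.right_neutral)
    moreover have "(cnj \<alpha> * l) * (- \<beta> * l) = of_real (cmod \<alpha> * cmod \<beta>)"
      using l(2) by (simp add: norm_mult mult_ac)
    then have "Re ((cnj \<alpha> * l) * (- \<beta> * l)) = cmod \<alpha> * cmod \<beta>" by simp
    ultimately show ?thesis
      unfolding cmod_add_cnj_square using l(1) by (simp add: norm_mult power2_sum)
  qed
  moreover have pos: "cmod \<alpha> + cmod \<beta> > 0" using ab by (smt (verit) norm_ge_zero)
  moreover have "D = (cmod \<alpha> + cmod \<beta>) * (cmod \<alpha> - cmod \<beta>)" by (simp add: D_def power2_eq_square algebra_simps)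
  ultimately have "cmod \<alpha> + cmod \<beta> \<le> 1" "1 \<le> (cmod \<alpha> - cmod \<beta>)\<^sup>2"
    by (simp_all add: power_mult_distrib power2_le_iff_abs_le abs_square_le_1)
  \<comment> \<open>The sum of the moduli is at most 1 and their difference at least 1 in absolute
    value, which is possible only if one of them is zero.\<close>
  then have "(cmod \<alpha> + cmod \<beta>)\<^sup>2 \<le> (cmod \<alpha> - cmod \<beta>)\<^sup>2"
    using pos by (meson less_imp_le order_trans power_le_one)
  then have "cmod \<alpha> * cmod \<beta> \<le> 0" by (simp add: power2_eq_square algebra_simps)
  then have "cmod \<alpha> = 0 \<or> cmod \<beta> = 0" by (metis norm_ge_zero mult_nonneg_nonneg antisym mult_eq_0_iff)
  then consider "\<alpha> \<noteq> 0" "\<beta> = 0" | "\<alpha> = 0" "\<beta> \<noteq> 0" using ab by auto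
  then show ?thesis
  proof cases
    case 1
    then have "transported_character \<phi> \<alpha> \<psi>"
      unfolding transported_character_def using \<psi>D f fT by simp
    then show ?thesis by blast
  next
    case 2
    then have "transported_character \<phi> (cnj \<beta>) (\<lambda>x. cnj (\<psi> x))"
      unfolding transported_character_def using \<psi>D f by (simp flip: fT)
    then show ?thesis by blast
  qed
qed

lemma eq_if_transported_characters_agree:
  assumes "\<And>\<phi> \<alpha> \<psi>. transported_character \<phi> \<alpha> \<psi> \<Longrightarrow> \<psi> x = \<psi> y"
  shows "x = y"
proof -
  obtain a where a: "T a = x - y" using range_T by (metis surjD)
  have "a = 0"
  proof (rule CA.characters_separate[OF semisimple_domain])
    fix \<phi> assume "CA.character \<phi>"
    then obtain \<alpha> \<psi> where t: "transported_character \<phi> \<alpha> \<psi>" using exists_transported_character by blast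
    have "\<psi> (x - y) + \<psi> y = \<psi> x" using t unfolding transported_character_def by (metis diff_add_cancel)
    then have "\<psi> (x - y) = 0" using assms[OF t] by simp
    then show "\<phi> a = 0" using t a by (simp add: transported_character_def)
  qed
  then show ?thesis using a by (simp add: linear_0[OF linear_T])
qed

lemma jordan_product_assoc: "jpN (jpN x y) z = jpN x (jpN y z)"
  by (rule eq_if_transported_characters_agree) (simp add: transported_character_def mult.assoc)

end

lemma (in unital_jordan_banach_algebra) group_invertible_group:
  assumes assoc: "\<And>x y z. jp (jp x y) z = jp x (jp y z)"
  shows "group (invertible_group jp e)"
proof (rule groupI)
  have inv_iff: "is_jordan_inverse jp e a b \<longleftrightarrow> jp a b = e" for a b
    unfolding is_jordan_inverse_def by (metis assoc jp_unit_right)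
  fix x y z
  assume x: "x \<in> carrier (invertible_group jp e)"
  then obtain x' where x': "jp x x' = e" by (auto simp: invertible_group_def jordan_invertibles_def inv_iff)
  show "\<one>\<^bsub>invertible_group jp e\<^esub> \<otimes>\<^bsub>invertible_group jp e\<^esub> x = x"
    by (simp add: invertible_group_def jp_unit)
  have "jp x' x = e" using x' by (simp add: jp_commute)
  then show "\<exists>y\<in>carrier (invertible_group jp e). y \<otimes>\<^bsub>invertible_group jp e\<^esub> x = \<one>\<^bsub>invertible_group jp e\<^esub>"
    by (auto simp: invertible_group_def jordan_invertibles_def inv_iff)
  assume y: "y \<in> carrier (invertible_group jp e)"
  then obtain y' where y': "jp y y' = e" by (auto simp: invertible_group_def jordan_invertibles_def inv_iff)
  have "jp (jp x y) (jp y' x') = jp x (jp (jp y y') x')" by (simp add: assoc)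
  then have "jp (jp x y) (jp y' x') = e" by (simp add: y' jp_unit x')
  then show "x \<otimes>\<^bsub>invertible_group jp e\<^esub> y \<in> carrier (invertible_group jp e)"
    by (auto simp: invertible_group_def jordan_invertibles_def inv_iff)
  show "x \<otimes>\<^bsub>invertible_group jp e\<^esub> y \<otimes>\<^bsub>invertible_group jp e\<^esub> z =
      x \<otimes>\<^bsub>invertible_group jp e\<^esub> (y \<otimes>\<^bsub>invertible_group jp e\<^esub> z)"
    by (simp add: invertible_group_def assoc)
next
  show "\<one>\<^bsub>invertible_group jp e\<^esub> \<in> carrier (invertible_group jp e)"
    by (auto simp: invertible_group_def jordan_invertibles_def is_jordan_inverse_def jp_unit)
qed

section \<open>The normalised isometry is an algebra isomorphism\<close>

context linear_surjective_isometry
begin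

definition normalised :: "'a \<Rightarrow> 'b" where
  "normalised a = jpN (jordan_inverse jpN eN (T 1)) (T a)"

lemma inverse_T_one: "jpN (jordan_inverse jpN eN (T 1)) (T 1) = eN"
proof -
  have "T 1 \<in> jordan_invertibles jpN eN"
    using A.unit_mem image_T N.subset_invertibles by blast
  then have "is_jordan_inverse jpN eN (T 1) (jordan_inverse jpN eN (T 1))"
    by (rule N.is_jordan_inverse_jordan_inverse)
  then show ?thesis by (simp add: is_jordan_inverse_def N.jp_commute)
qed

lemma T_one_normalised: "jpN (T 1) (normalised a) = T a"
proof -
  have "jpN (T 1) (normalised a) = jpN (jpN (jordan_inverse jpN eN (T 1)) (T 1)) (T a)"
    by (simp add: normalised_def N.jp_commute[of "T 1"] jordan_product_assoc)
  then show ?thesis by (simp add: inverse_T_one N.jp_unit)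
qed

lemma transported_character_normalised:
  assumes t: "transported_character \<phi> \<alpha> \<psi>" and \<phi>: "\<phi> 1 = 1"
  shows "\<psi> (normalised a) = \<phi> a"
proof -
  let ?w = "jordan_inverse jpN eN (T 1)"
  have "\<psi> ?w * \<psi> (T 1) = 1" "\<alpha> * \<psi> (T 1) = 1"
    using t \<phi> inverse_T_one unfolding transported_character_def by metis+
  then have "\<psi> ?w = \<alpha>" by (metis mult_cancel_right mult_zero_right zero_neq_one)
  then show ?thesis using t by (simp add: transported_character_def normalised_def)
qed

text \<open>The product in \<open>N\<close> is compared with \<open>a * b\<close> under the
  characters of \<open>A\<close>. The extra factor \<open>T 1\<close> in the choice of
  \<open>c\<close> absorbs the constant, because
  \<open>\<alpha> * \<psi> (T 1) = \<phi> 1 = 1\<close>.\<close>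

lemma normalised_mult: "normalised (a * b) = jpN (normalised a) (normalised b)"
proof -
  obtain c where c: "T c = jpN (T 1) (jpN (normalised a) (normalised b))" using range_T by (metis surjD)
  have "c = a * b"
  proof -
    have "c - a * b = 0"
    proof (rule CA.characters_separate[OF semisimple_domain])
      fix \<phi> assume ch: "CA.character \<phi>"
      then obtain \<alpha> \<psi> where t: "transported_character \<phi> \<alpha> \<psi>" using exists_transported_character by blast
      have \<phi>D: "\<phi> 1 = 1" "\<phi> (x + y) = \<phi> x + \<phi> y" "\<phi> (x * y) = \<phi> x * \<phi> y" for x y
        using ch by (auto simp: CA.character_def)
      have tD: "\<psi> (jpN x y) = \<psi> x * \<psi> y" "\<phi> x' = \<alpha> * \<psi> (T x')" for x y x'
        using t unfolding transported_character_def by metis+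
      have "\<phi> c = \<phi> 1 * (\<psi> (normalised a) * \<psi> (normalised b))"
        by (simp add: tD(2) c tD(1))
      then have "\<phi> c = \<phi> (a * b)"
        by (simp add: transported_character_normalised[OF t \<phi>D(1)] \<phi>D(1,3))
      then show "\<phi> (c - a * b) = 0" using \<phi>D(2)[of "c - a * b" "a * b"] by simp
    qed
    then show ?thesis by simp
  qed
  then have "jpN (jordan_inverse jpN eN (T 1)) (T (a * b)) = jpN (normalised a) (normalised b)"
    using c by (simp add: inverse_T_one N.jp_unit flip: jordan_product_assoc)
  then show ?thesis by (simp add: normalised_def)
qed

lemma linear_normalised: "linear normalised"
  by (rule linearI) (simp_all add: normalised_def linear_add[OF linear_T] linear_scale[OF linear_T] N.jp_simps)

text \<open>Both inequalities are submultiplicativity, provided the inverse of \<open>T 1\<close>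
  has norm at most 1. This holds because that inverse is \<open>T (b * b)\<close> for the
  \<open>b\<close> with \<open>T b = eN\<close>, and \<open>norm b = 1\<close>.\<close>

lemma norm_normalised: "norm (normalised a) = norm a"
proof (rule antisym)
  let ?w = "jordan_inverse jpN eN (T 1)"
  obtain b where b: "T b = eN" using range_T by (metis surjD)
  have "normalised b = ?w" by (simp add: normalised_def b N.jp_unit_right)
  then have "T (b * b) = jpN (T 1) (jpN ?w ?w)"
    using T_one_normalised[of "b * b"] by (simp add: normalised_mult)
  also have "\<dots> = ?w"
    by (simp add: N.jp_commute[of "T 1"] inverse_T_one N.jp_unit_right jordan_product_assoc)
  finally have "norm ?w = norm (b * b)" by (metis norm_T)
  also have "\<dots> \<le> norm b * norm b" by (rule norm_mult_ineq)
  also have "norm b = 1" using norm_T[of b] by (simp add: b N.norm_unit)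
  finally have w: "norm ?w \<le> 1" by simp
  have "norm (normalised a) \<le> norm ?w * norm (T a)" unfolding normalised_def by (rule N.norm_jp_le)
  also have "\<dots> \<le> 1 * norm (T a)" using w by (intro mult_right_mono) auto
  finally show "norm (normalised a) \<le> norm a" by (simp add: norm_T)
  have "norm (T a) \<le> norm (T 1) * norm (normalised a)"
    using N.norm_jp_le[of "T 1" "normalised a"] by (simp add: T_one_normalised)
  then show "norm a \<le> norm (normalised a)" by (simp add: norm_T)
qed

lemma isometric_real_algebra_iso_normalised: "isometric_real_algebra_iso (*) jpN normalised"
proof -
  have dist: "dist (normalised x) (normalised y) = dist x y" for x y
    using norm_normalised[of "x - y"] by (simp add: dist_norm linear_diff[OF linear_normalised])
  have "inj normalised" by (intro injI) (metis dist dist_eq_0_iff)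
  moreover have "\<exists>a. normalised a = y" for y
  proof -
    obtain a where "T a = jpN (T 1) y" using range_T by (metis surjD)
    then have "normalised a = y"
      by (simp add: normalised_def inverse_T_one N.jp_unit flip: jordan_product_assoc)
    then show ?thesis by blast
  qed
  then have "surj normalised" by (metis surjI)
  ultimately show ?thesis
    using linear_normalised normalised_mult dist
    by (simp add: isometric_real_algebra_iso_def isometric_on_def bij_def)
qed

lemma isometrically_isomorphic_invertible_groups:
  "isometrically_isomorphic_groups (invertible_group ((*) :: 'a \<Rightarrow> 'a \<Rightarrow> 'a) 1) (invertible_group jpN eN)"
proof -
  have iso: "bij normalised" "isometric_on UNIV normalised"
    using isometric_real_algebra_iso_normalised by (auto simp: isometric_real_algebra_iso_def)
  have onto: "\<exists>a. y = normalised a" for y using bij_is_surj[OF iso(1)] by (rule surjD)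
  have one: "normalised 1 = eN" by (simp add: normalised_def inverse_T_one)
  have eq_iff: "normalised x = normalised y \<longleftrightarrow> x = y" for x y using iso(1) by (simp add: bij_def inj_eq)
  have inv_iff: "is_jordan_inverse jpN eN (normalised a) (normalised b) \<longleftrightarrow> is_jordan_inverse (*) 1 a b" for a b
    unfolding is_jordan_inverse_def by (metis normalised_mult one eq_iff)
  have mem: "normalised a \<in> jordan_invertibles jpN eN \<longleftrightarrow> a \<in> jordan_invertibles (*) 1" for a
  proof -
    have "normalised a \<in> jordan_invertibles jpN eN \<longleftrightarrow> (\<exists>b. is_jordan_inverse jpN eN (normalised a) (normalised b))"
      unfolding jordan_invertibles_def mem_Collect_eq by (metis onto)
    then show ?thesis by (simp add: inv_iff jordan_invertibles_def)
  qed
  have "normalised ` jordan_invertibles (*) 1 = jordan_invertibles jpN eN"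
  proof
    show "normalised ` jordan_invertibles (*) 1 \<subseteq> jordan_invertibles jpN eN" using mem by blast
    show "jordan_invertibles jpN eN \<subseteq> normalised ` jordan_invertibles (*) 1"
    proof
      fix y assume "y \<in> jordan_invertibles jpN eN"
      moreover obtain a where "y = normalised a" using onto by blast
      ultimately show "y \<in> normalised ` jordan_invertibles (*) 1" using mem by blast
    qed
  qed
  then have "normalised \<in> Group.iso (invertible_group (*) 1) (invertible_group jpN eN)"
    using iso(1) mem normalised_mult
    by (auto simp: Group.iso_def hom_def invertible_group_def bij_betw_def bij_def inj_on_def)
  moreover have "isometric_on (carrier (invertible_group (*) 1)) normalised"
    using iso(2) isometric_on_subset by blast
  moreover have "group (invertible_group ((*) :: 'a \<Rightarrow> 'a \<Rightarrow> 'a) 1)"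
    by (rule CA.group_invertible_group) (rule mult.assoc)
  moreover have "group (invertible_group jpN eN)"
    by (rule N.group_invertible_group) (rule jordan_product_assoc)
  ultimately show ?thesis unfolding isometrically_isomorphic_groups_def by blast
qed

end

theorem corollary3p15:
  fixes scaleA :: "complex \<Rightarrow> 'a::{real_normed_algebra_1,comm_ring_1,banach} \<Rightarrow> 'a"
    and scaleN :: "complex \<Rightarrow> 'b::banach \<Rightarrow> 'b"
    and jpN :: "'b \<Rightarrow> 'b \<Rightarrow> 'b" and eN :: 'b
    and SA :: "'a set" and SN :: "'b set"
    and \<Delta> :: "'a \<Rightarrow> 'b"
  assumes "unital_commutative_banach_algebra scaleA"
    and "unital_jordan_banach_algebra scaleN jpN eN"
    and "jordan_semisimple scaleN jpN eN"
    and "quadratic_subset (*) 1 SA"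
    and "clopen_in (jordan_invertibles (*) 1) SA"
    and "closed_powers_inverses (*) 1 SA"
    and "quadratic_subset jpN eN SN"
    and "clopen_in (jordan_invertibles jpN eN) SN"
    and "closed_powers_inverses jpN eN SN"
    and "\<Delta> ` SA = SN"
    and "isometric_on SA \<Delta>"
  shows "jordan_semisimple scaleA (*) 1 \<and>
    (\<forall>x y z. jpN (jpN x y) z = jpN x (jpN y z)) \<and>
    (\<exists>\<Phi>. isometric_real_algebra_iso (*) jpN \<Phi> \<and>
         (\<forall>a\<in>SA. \<Phi> a = jpN (jordan_inverse jpN eN (\<Delta> 1)) (\<Delta> a))) \<and>
    isometrically_isomorphic_groups (invertible_group ((*) :: 'a \<Rightarrow> 'a \<Rightarrow> 'a) 1)
      (invertible_group jpN eN)"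
proof -
  interpret CA: unital_commutative_banach_algebra scaleA by fact
  interpret N: unital_jordan_banach_algebra scaleN jpN eN by fact
  interpret \<Delta>: surjective_isometry scaleA SA scaleN jpN eN SN \<Delta>
    by unfold_locales fact+
  obtain T where T: "linear T" "\<And>x. norm (T x) = norm x" "range T = UNIV" "\<And>a. a \<in> SA \<Longrightarrow> \<Delta> a = T a"
    using \<Delta>.linear_extension by blast
  interpret T: linear_surjective_isometry scaleA SA scaleN jpN eN SN T
  proof unfold_locales
    show "T (x + y) = T x + T y" "T (r *\<^sub>R x) = r *\<^sub>R T x" for x y r
      by (rule linear_add[OF T(1)] linear_scale[OF T(1)])+
    show "norm (T x) = norm x" for x by (fact T)
    show "range T = UNIV" by (fact T)
    show "T ` SA = SN" using T(4) \<open>\<Delta> ` SA = SN\<close> by (auto simp: image_def)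
    show "jordan_semisimple scaleN jpN eN" by fact
  qed
  have "T.normalised a = jpN (jordan_inverse jpN eN (\<Delta> 1)) (\<Delta> a)" if "a \<in> SA" for a
    using T(4)[OF that] T(4)[OF \<Delta>.A.unit_mem] by (simp add: T.normalised_def)
  then show ?thesis
    using T.semisimple_domain T.jordan_product_assoc T.isometric_real_algebra_iso_normalised
      T.isometrically_isomorphic_invertible_groups by blast
qed

end
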